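(* Let $(X,\omega_X),(Y,\omega_Y)$ be networks and let $k\ge 0$ be an integer. Then $$d_{\mathrm B}\bigl(\mathrm{Dgm}_k^{\bullet}(X),\mathrm{Dgm}_k^{\bullet}(Y)\bigr)\le 2\,d_{\mathcal N}(X,Y),$$ where $\mathrm{Dgm}^{\bullet}$ refers to either of $\mathrm{Dgm}^{\mathrm{si}}$ and $\mathrm{Dgm}^{\mathrm{so}}$ (the same choice for $X$ and $Y$).
   Context: A network is a pair $(X,\omega_X)$ where $X$ is a finite (nonempty) set and $\omega_X:X\times X\to\mathbb R$ is any function. For $\delta\in\mathbb R$, the Dowker $\delta$-sink complex $\mathfrak D^{\mathrm{si}}_{\delta,X}$ consists of all nonempty $\sigma\subseteq X$ for which there is $x'\in X$ with $\omega_X(x,x')\le\delta$ for all $x\in\sigma$; the Dowker $\delta$-source complex $\mathfrak D^{\mathrm{so}}_{\delta,X}$ consists of all nonempty $\sigma\subseteq X$ for which there is $x'\in X$ with $\omega_X(x',x)\le\delta$ for all $x\in\sigma$. Each family is a filtration under inclusion as $\delta$ increases. Fix a field $\mathbb K$. $\mathrm{Dgm}_k^{\mathrm{si}}(X)$ (resp. $\mathrm{Dgm}_k^{\mathrm{so}}(X)$) is the persistence diagram of the persistence vector space obtained by applying $H_k(\cdot;\mathbb K)$ to the sink (resp. source) filtration, i.e. the multiset of points $(a,b)\in\overline{\mathbb R}^2$ ($\overline{\mathbb R}=\mathbb R\cup\{\pm\infty\}$), one for each interval $[a,b)$ in its decomposition into interval modules. $d_{\mathrm B}$ is the bottleneck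 distance between persistence diagrams: the infimum over partial matchings of the two multisets (unmatched points being matched to the diagonal) of the largest $\ell^\infty$ displacement. A correspondence between $X$ and $Y$ is a relation $R\subseteq X\times Y$ whose projections to $X$ and to $Y$ are both surjective; its distortion is $\operatorname{dis}(R)=\max_{(x,y),(x',y')\in R}|\omega_X(x,x')-\omega_Y(y,y')|$. The network distance is $d_{\mathcal N}(X,Y)=\frac12\min_R\operatorname{dis}(R)$ over all correspondences $R$. *)

theory Defs
  imports
    "HOL-Library.Extended_Real"
    "HOL-Library.Multiset"
    "HOL-Library.FuncSet"
    "HOL-Library.Function_Algebras"
    "HOL-Library.Set_Algebras"
    "HOL-Combinatorics.Permutations"
begin

section \<open>Networks\<close>

text \<open>Only the values of the weight function on \<open>X \<times> X\<close> are ever used below.\<close>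

definition network :: "'a set \<Rightarrow> ('a \<Rightarrow> 'a \<Rightarrow> real) \<Rightarrow> bool" where
  "network X \<omega> \<longleftrightarrow> finite X \<and> X \<noteq> {}"

definition correspondences :: "'a set \<Rightarrow> 'b set \<Rightarrow> ('a \<times> 'b) set set" where
  "correspondences X Y = {R. R \<subseteq> X \<times> Y \<and> fst ` R = X \<and> snd ` R = Y}"

definition distortion ::
    "('a \<Rightarrow> 'a \<Rightarrow> real) \<Rightarrow> ('b \<Rightarrow> 'b \<Rightarrow> real) \<Rightarrow> ('a \<times> 'b) set \<Rightarrow> real" where
  "distortion \<omega>X \<omega>Y R =
     Max {\<bar>\<omega>X x x' - \<omega>Y y y'\<bar> | x y x' y'. (x, y) \<in> R \<and> (x', y') \<in> R}"

definition network_distance ::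
    "'a set \<Rightarrow> ('a \<Rightarrow> 'a \<Rightarrow> real) \<Rightarrow> 'b set \<Rightarrow> ('b \<Rightarrow> 'b \<Rightarrow> real) \<Rightarrow> real" where
  "network_distance X \<omega>X Y \<omega>Y = 1/2 * Min (distortion \<omega>X \<omega>Y ` correspondences X Y)"

definition dowker_sink :: "'a set \<Rightarrow> ('a \<Rightarrow> 'a \<Rightarrow> real) \<Rightarrow> real \<Rightarrow> 'a set set" where
  "dowker_sink X \<omega> \<delta> = {\<sigma>. \<sigma> \<noteq> {} \<and> \<sigma> \<subseteq> X \<and> (\<exists>x'\<in>X. \<forall>x\<in>\<sigma>. \<omega> x x' \<le> \<delta>)}"

definition dowker_source :: "'a set \<Rightarrow> ('a \<Rightarrow> 'a \<Rightarrow> real) \<Rightarrow> real \<Rightarrow> 'a set set" where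
  "dowker_source X \<omega> \<delta> = {\<sigma>. \<sigma> \<noteq> {} \<and> \<sigma> \<subseteq> X \<and> (\<exists>x'\<in>X. \<forall>x\<in>\<sigma>. \<omega> x' x \<le> \<delta>)}"


section \<open>Persistence vector spaces and their diagrams\<close>

record ('k, 'v) vspace =
  vcarrier :: "'v set"
  vadd :: "'v \<Rightarrow> 'v \<Rightarrow> 'v"
  vzero :: 'v
  vscale :: "'k \<Rightarrow> 'v \<Rightarrow> 'v"

definition linear_iso ::
    "('k, 'v) vspace \<Rightarrow> ('k, 'w) vspace \<Rightarrow> ('v \<Rightarrow> 'w) \<Rightarrow> bool" where
  "linear_iso V W \<phi> \<longleftrightarrow>
     bij_betw \<phi> (vcarrier V) (vcarrier W) \<and>
     (\<forall>x\<in>vcarrier V. \<forall>y\<in>vcarrier V. \<phi> (vadd V x y) = vadd W (\<phi> x) (\<phi> y)) \<and>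
     (\<forall>a. \<forall>x\<in>vcarrier V. \<phi> (vscale V a x) = vscale W a (\<phi> x))"

text \<open>The transition map \<open>ptrans P \<delta> \<delta>'\<close> is meaningful for \<open>\<delta> \<le> \<delta>'\<close> and on the carrier
  of \<open>pspace P \<delta>\<close> only.\<close>

record ('k, 'v) pvspace =
  pspace :: "real \<Rightarrow> ('k, 'v) vspace"
  ptrans :: "real \<Rightarrow> real \<Rightarrow> 'v \<Rightarrow> 'v"

definition pvspace_iso :: "('k, 'v) pvspace \<Rightarrow> ('k, 'w) pvspace \<Rightarrow> bool" where
  "pvspace_iso P Q \<longleftrightarrow>
     (\<exists>\<phi>. (\<forall>\<delta>. linear_iso (pspace P \<delta>) (pspace Q \<delta>) (\<phi> \<delta>)) \<and>
          (\<forall>\<delta> \<delta>'. \<delta> \<le> \<delta>' \<longrightarrow>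
             (\<forall>x\<in>vcarrier (pspace P \<delta>). \<phi> \<delta>' (ptrans P \<delta> \<delta>' x) = ptrans Q \<delta> \<delta>' (\<phi> \<delta> x))))"

definition bar :: "ereal \<times> ereal \<Rightarrow> real set" where
  "bar p = {\<delta>. fst p \<le> ereal \<delta> \<and> ereal \<delta> < snd p}"

definition interval_module :: "ereal \<times> ereal \<Rightarrow> ('k::field, 'k) pvspace" where
  "interval_module p =
     \<lparr>pspace = (\<lambda>\<delta>. \<lparr>vcarrier = (if \<delta> \<in> bar p then UNIV else {0}),
                      vadd = (+), vzero = 0, vscale = (*)\<rparr>),
      ptrans = (\<lambda>\<delta> \<delta>' x. if \<delta> \<in> bar p \<and> \<delta>' \<in> bar p then x else 0)\<rparr>"

text \<open>For a finite index set this product is the direct sum.\<close>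

definition direct_sum :: "'i set \<Rightarrow> ('i \<Rightarrow> ('k, 'v) pvspace) \<Rightarrow> ('k, 'i \<Rightarrow> 'v) pvspace" where
  "direct_sum I P =
     \<lparr>pspace = (\<lambda>\<delta>. \<lparr>vcarrier = (\<Pi>\<^sub>E i\<in>I. vcarrier (pspace (P i) \<delta>)),
                      vadd = (\<lambda>f g. \<lambda>i\<in>I. vadd (pspace (P i) \<delta>) (f i) (g i)),
                      vzero = (\<lambda>i\<in>I. vzero (pspace (P i) \<delta>)),
                      vscale = (\<lambda>a f. \<lambda>i\<in>I. vscale (pspace (P i) \<delta>) a (f i))\<rparr>),
      ptrans = (\<lambda>\<delta> \<delta>' f. \<lambda>i\<in>I. ptrans (P i) \<delta> \<delta>' (f i))\<rparr>"

text \<open>The condition \<open>a < b\<close> says that the interval \<open>[a, b)\<close> is nonempty.\<close>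

definition is_persistence_diagram ::
    "('k::field, 'v) pvspace \<Rightarrow> (ereal \<times> ereal) multiset \<Rightarrow> bool" where
  "is_persistence_diagram P D \<longleftrightarrow>
     (\<forall>(a, b)\<in>#D. a < b) \<and>
     (\<exists>ps. mset ps = D \<and>
           pvspace_iso P (direct_sum {..<length ps} (\<lambda>i. interval_module (ps ! i))))"

text \<open>By the structure theorem the diagram exists and is unique for the persistence vector spaces
  of finite filtrations considered below, and it is a finite multiset.\<close>

definition persistence_diagram ::
    "('k::field, 'v) pvspace \<Rightarrow> (ereal \<times> ereal) multiset" where
  "persistence_diagram P = (THE D. is_persistence_diagram P D)"


section \<open>Simplicial homology over a field\<close>

text \<open>A simplicial complex is given by the set of its (nonempty) simplices.  A \<open>k\<close>-chain is, as in
  Munkres, a finitely supported function on the oriented \<open>k\<close>-simplices that changes sign when the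
  orientation is reversed.  An oriented simplex \<open>[x\<^sub>0, \<dots>, x\<^sub>k]\<close> is written as a list without
  repetitions, so the coefficient of a list is multiplied by the sign of a permutation of its
  entries.\<close>

definition chains :: "'a set set \<Rightarrow> nat \<Rightarrow> ('a list \<Rightarrow> 'k::field) set" where
  "chains K k =
     {c. finite {xs. c xs \<noteq> 0} \<and>
         (\<forall>xs. c xs \<noteq> 0 \<longrightarrow> length xs = Suc k \<and> distinct xs \<and> set xs \<in> K) \<and>
         (\<forall>xs p. p permutes {..<length xs} \<longrightarrow> c (permute_list p xs) = of_int (sign p) * c xs)}"

text \<open>The chain \<open>c\<close> standing for \<open>[x\<^sub>0, \<dots>, x\<^sub>k]\<close> has \<open>c (x\<^sub>i # ys) = (-1)\<^sup>i\<close> where \<open>ys\<close> lists the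
  remaining vertices in their given order, so summing over the possible heads sends it to
  \<open>\<Sum>\<^sub>i (-1)\<^sup>i [x\<^sub>0, \<dots>, x\<^sub>i\<^sub>-\<^sub>1, x\<^sub>i\<^sub>+\<^sub>1, \<dots>, x\<^sub>k]\<close>.  The value at the empty list is set to zero because the
  homology is not reduced: the boundary of every \<open>0\<close>-chain vanishes.\<close>

definition boundary :: "('a list \<Rightarrow> 'k::field) \<Rightarrow> 'a list \<Rightarrow> 'k" where
  "boundary c = (\<lambda>ys. if ys = [] then 0 else (\<Sum>v | c (v # ys) \<noteq> 0. c (v # ys)))"

definition cycles :: "'a set set \<Rightarrow> nat \<Rightarrow> ('a list \<Rightarrow> 'k::field) set" where
  "cycles K k = {c \<in> chains K k. boundary c = 0}"

definition boundaries :: "'a set set \<Rightarrow> nat \<Rightarrow> ('a list \<Rightarrow> 'k::field) set" where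
  "boundaries K k = boundary ` chains K (Suc k)"

text \<open>The quotient \<open>Z / B\<close> of subspaces of a space of functions, as a space of cosets.  In
  \<open>vscale\<close> the summand \<open>B\<close> is needed only for the scalar \<open>0\<close>.\<close>

definition quotient_space ::
    "('i \<Rightarrow> 'k::field) set \<Rightarrow> ('i \<Rightarrow> 'k) set \<Rightarrow> ('k, ('i \<Rightarrow> 'k) set) vspace" where
  "quotient_space Z B =
     \<lparr>vcarrier = (\<lambda>z. z +o B) ` Z,
      vadd = (+),
      vzero = B,
      vscale = (\<lambda>a C. (\<lambda>c i. a * c i) ` C + B)\<rparr>"

definition homology :: "'a set set \<Rightarrow> nat \<Rightarrow> ('k::field, ('a list \<Rightarrow> 'k) set) vspace" where
  "homology K k = quotient_space (cycles K k) (boundaries K k)"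

text \<open>The map induced by an inclusion of complexes sends the class \<open>z + B\<close> to \<open>z + B'\<close>, which is
  \<open>(z + B) + B'\<close> since \<open>B \<subseteq> B'\<close>.\<close>

definition persistent_homology ::
    "(real \<Rightarrow> 'a set set) \<Rightarrow> nat \<Rightarrow> ('k::field, ('a list \<Rightarrow> 'k) set) pvspace" where
  "persistent_homology F k =
     \<lparr>pspace = (\<lambda>\<delta>. homology (F \<delta>) k),
      ptrans = (\<lambda>\<delta> \<delta>' C. C + boundaries (F \<delta>') k)\<rparr>"

text \<open>The field of coefficients is passed as a type.\<close>

definition dgm_sink ::
    "'k::field itself \<Rightarrow> nat \<Rightarrow> 'a set \<Rightarrow> ('a \<Rightarrow> 'a \<Rightarrow> real) \<Rightarrow> (ereal \<times> ereal) multiset" where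
  "dgm_sink _ k X \<omega> =
     persistence_diagram
       (persistent_homology (dowker_sink X \<omega>) k :: ('k, ('a list \<Rightarrow> 'k) set) pvspace)"

definition dgm_source ::
    "'k::field itself \<Rightarrow> nat \<Rightarrow> 'a set \<Rightarrow> ('a \<Rightarrow> 'a \<Rightarrow> real) \<Rightarrow> (ereal \<times> ereal) multiset" where
  "dgm_source _ k X \<omega> =
     persistence_diagram
       (persistent_homology (dowker_source X \<omega>) k :: ('k, ('a list \<Rightarrow> 'k) set) pvspace)"


section \<open>Bottleneck distance\<close>

text \<open>In \<^typ>\<open>ereal\<close> the difference \<open>\<infinity> - \<infinity>\<close> is \<open>\<infinity>\<close>, whereas equal infinite coordinates are at
  distance \<open>0\<close>.\<close>

definition coord_dist :: "ereal \<Rightarrow> ereal \<Rightarrow> ereal" where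
  "coord_dist x y = (if x = y then 0 else \<bar>x - y\<bar>)"

definition linf_dist :: "ereal \<times> ereal \<Rightarrow> ereal \<times> ereal \<Rightarrow> ereal" where
  "linf_dist p q = max (coord_dist (fst p) (fst q)) (coord_dist (snd p) (snd q))"

definition diagonal_dist :: "ereal \<times> ereal \<Rightarrow> ereal" where
  "diagonal_dist p = (INF t. linf_dist p (t, t))"

definition partial_matchings ::
    "'p multiset \<Rightarrow> 'q multiset \<Rightarrow> ('p \<times> 'q) multiset set" where
  "partial_matchings A B = {M. image_mset fst M \<subseteq># A \<and> image_mset snd M \<subseteq># B}"

text \<open>The element \<open>0\<close> makes the cost of the empty matching of empty diagrams \<open>0\<close> instead of
  \<open>Sup {} = -\<infinity>\<close>.\<close>

definition matching_cost ::
    "(ereal \<times> ereal) multiset \<Rightarrow> (ereal \<times> ereal) multiset \<Rightarrow>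
     ((ereal \<times> ereal) \<times> (ereal \<times> ereal)) multiset \<Rightarrow> ereal" where
  "matching_cost A B M =
     Sup (insert 0 ({linf_dist p q | p q. (p, q) \<in># M} \<union>
                    {diagonal_dist p | p. p \<in># A - image_mset fst M} \<union>
                    {diagonal_dist q | q. q \<in># B - image_mset snd M}))"

definition bottleneck_distance ::
    "(ereal \<times> ereal) multiset \<Rightarrow> (ereal \<times> ereal) multiset \<Rightarrow> ereal" where
  "bottleneck_distance A B = (INF M\<in>partial_matchings A B. matching_cost A B M)"

end

theory Submission
  imports Defs Complex_Main
begin

text \<open>Let \<open>R\<close> be a correspondence of minimal distortion \<open>e\<close>. Pull both weight functions back to \<open>R\<close>. A
  point of \<open>R\<close> dominates every other point with the same image in \<open>X\<close>, and removing a dominated vertex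
  does not change homology, so the diagrams of \<open>X\<close> and \<open>Y\<close> are the diagrams of two filtrations of
  the full simplex on \<open>R\<close> by sublevel sets of functions \<open>f\<close> and \<open>g\<close> with \<open>|f - g| \<le> e\<close>.

  The cycles and the boundaries of a filtration form two flags in a finite-dimensional space; a basis
  adapted to both decomposes persistent homology into intervals. Put \<open>h t = (1 - t) f + t g\<close>. For \<open>t\<close>
  close to \<open>x\<close> the order that \<open>h t\<close> induces on the simplices refines the one induced by \<open>h x\<close>, so a basis
  adapted to \<open>h t\<close> is adapted to \<open>h x\<close>, and matching the intervals of equal basis vectors costs at most
  \<open>|t - x| e\<close>. Such matchings compose along the path from \<open>f\<close> to \<open>g\<close>.\<close>

section \<open>Matchings up to the diagonal\<close>

text \<open>Four flags are involved, the cycles and the boundaries for \<open>f\<close> and those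
  for \<open>g\<close>, and in general no basis is adapted to all four; only two flags are sure to
  have one. This obstacle is the reason for the path \<open>h t\<close>: between nearby parameters
  the flags of the coarser function are subflags of those of the finer one, so two flags suffice.
  The bases chosen at different parameters are unrelated. The matchings compose nevertheless,
  because the diagram at the common parameter is one multiset, whichever basis computed it. This is
  what uniqueness of the interval decomposition supplies, and it also justifies the
  \<open>THE\<close> in \<open>persistence_diagram\<close>. Uniqueness rests on ranks: the number of
  bars alive at both \<open>s\<close> and \<open>t\<close> is the rank of a transition map. The
  pullback to \<open>R\<close> puts both filtrations on the same simplices, so that their values can
  be subtracted. The factor 1/2 in \<open>network_distance\<close> turns the bound \<open>e\<close>
  into twice the distance. Sources are the sinks of the transposed weights.\<close>

text \<open>A partial matching is encoded as a full matching of the multisets enlarged by diagonal points, so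
  that matchings compose as relations.\<close>

definition near :: "real \<Rightarrow> (ereal \<times> ereal) multiset \<Rightarrow> (ereal \<times> ereal) multiset \<Rightarrow> bool" where
  "near e A B \<longleftrightarrow> (\<exists>U V. (\<forall>p\<in>#U + V. fst p = snd p) \<and>
     rel_mset (\<lambda>p q. linf_dist p q \<le> ereal e) (A + U) (B + V))"

lemma coord_dist_triangle: "coord_dist x z \<le> coord_dist x y + coord_dist y z"
  by (cases x; cases y; cases z) (auto simp: coord_dist_def)

lemma coord_dist_commute: "coord_dist x y = coord_dist y x"
  by (cases x; cases y) (auto simp: coord_dist_def)

lemma linf_dist_self [simp]: "linf_dist p p = 0"
  by (simp add: linf_dist_def coord_dist_def)

lemma linf_dist_commute: "linf_dist p q = linf_dist q p"
  by (simp add: linf_dist_def coord_dist_commute)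

lemma linf_dist_triangle:
  assumes "linf_dist p q \<le> ereal d" "linf_dist q r \<le> ereal e"
  shows "linf_dist p r \<le> ereal (d + e)"
proof -
  have "coord_dist x z \<le> ereal (d + e)"
    if "coord_dist x y \<le> ereal d" "coord_dist y z \<le> ereal e" for x y z
    using order_trans[OF coord_dist_triangle[of x z y] add_mono[OF that]] by simp
  then show ?thesis
    using assms unfolding linf_dist_def by (meson max.boundedE max.boundedI)
qed

lemma rel_mset_mono: "rel_mset R A B \<Longrightarrow> (\<And>p q. R p q \<Longrightarrow> R' p q) \<Longrightarrow> rel_mset R' A B"
  by (metis multiset.rel_mono_strong)

lemma rel_mset_add:
  "rel_mset R A B \<Longrightarrow> rel_mset R A' B' \<Longrightarrow> rel_mset R (A + A') (B + B')"
  by (induction rule: rel_mset_induct) (auto simp: rel_mset_Plus)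

lemma rel_mset_refl: "(\<And>p. p \<in># A \<Longrightarrow> R p p) \<Longrightarrow> rel_mset R A A"
  by (rule multiset.rel_refl_strong)

text \<open>Each of the two matchings pads \<open>B\<close> by its own diagonal points. Adding the
  padding of the other one, with every point matched to itself at cost 0, makes both relations meet
  in the same multiset, where they compose.\<close>

lemma near_trans:
  assumes "near d A B" "near e B C" "0 \<le> d" "0 \<le> e"
  shows "near (d + e) A C"
proof -
  obtain U V where UV: "\<forall>p\<in>#U + V. fst p = snd p"
    and AB: "rel_mset (\<lambda>p q. linf_dist p q \<le> ereal d) (A + U) (B + V)"
    using assms(1) unfolding near_def by blast
  obtain U' V' where UV': "\<forall>p\<in>#U' + V'. fst p = snd p"
    and BC: "rel_mset (\<lambda>p q. linf_dist p q \<le> ereal e) (B + U') (C + V')"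
    using assms(2) unfolding near_def by blast
  have AB': "rel_mset (\<lambda>p q. linf_dist p q \<le> ereal d) (A + U + U') (B + V + U')"
    by (rule rel_mset_add[OF AB]) (auto intro!: rel_mset_refl assms)
  have "rel_mset (\<lambda>p q. linf_dist p q \<le> ereal e) (B + U' + V) (C + V' + V)"
    by (rule rel_mset_add[OF BC]) (auto intro!: rel_mset_refl assms)
  then have BC': "rel_mset (\<lambda>p q. linf_dist p q \<le> ereal e) (B + V + U') (C + V' + V)"
    by (simp add: ac_simps)
  have "rel_mset ((\<lambda>p q. linf_dist p q \<le> ereal d) OO (\<lambda>p q. linf_dist p q \<le> ereal e))
      (A + U + U') (C + V' + V)"
    unfolding multiset.rel_compp using AB' BC' by blast
  then have "rel_mset (\<lambda>p q. linf_dist p q \<le> ereal (d + e)) (A + (U + U')) (C + (V' + V))"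
    unfolding add.assoc by (rule rel_mset_mono) (auto intro: linf_dist_triangle)
  then show ?thesis
    unfolding near_def using UV UV' by (intro exI[of _ "U + U'"] exI[of _ "V' + V"]) auto
qed

lemma near_commute:
  assumes "near e A B"
  shows "near e B A"
proof -
  obtain U V where UV: "\<forall>p\<in>#U + V. fst p = snd p"
    and AB: "rel_mset (\<lambda>p q. linf_dist p q \<le> ereal e) (A + U) (B + V)"
    using assms unfolding near_def by blast
  have "rel_mset (\<lambda>p q. linf_dist p q \<le> ereal e)\<inverse>\<inverse> (B + V) (A + U)"
    using AB multiset.rel_flip by blast
  then have "rel_mset (\<lambda>p q. linf_dist p q \<le> ereal e) (B + V) (A + U)"
    by (rule rel_mset_mono) (simp add: linf_dist_commute)
  then show ?thesis
    unfolding near_def using UV by (intro exI[of _ V] exI[of _ U]) auto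
qed

lemma diagonal_dist_le: "fst q = snd q \<Longrightarrow> diagonal_dist p \<le> linf_dist p q"
  unfolding diagonal_dist_def by (rule INF_lower2[of "fst q"]) (auto simp: linf_dist_def)

text \<open>As \<open>A\<close> and \<open>B\<close> have no diagonal points, they are recovered as
  the off-diagonal parts of the padded multisets. Pairs of two off-diagonal points form the partial
  matching, a pair with exactly one such point shows that this point is within \<open>e\<close> of
  the diagonal, and pairs of two diagonal points are dropped.\<close>

lemma bottleneck_distance_le_near:
  assumes near: "near e A B" and e: "0 \<le> e"
    and A: "\<And>p. p \<in># A \<Longrightarrow> fst p \<noteq> snd p" and B: "\<And>p. p \<in># B \<Longrightarrow> fst p \<noteq> snd p"
  shows "bottleneck_distance A B \<le> ereal e"
proof -
  obtain U V where UV: "\<forall>p\<in>#U + V. fst p = snd p"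
    and AB: "rel_mset (\<lambda>p q. linf_dist p q \<le> ereal e) (A + U) (B + V)"
    using near unfolding near_def by blast
  obtain W where W: "set_mset W \<subseteq> {(p, q). linf_dist p q \<le> ereal e}"
    and W1: "image_mset fst W = A + U" and W2: "image_mset snd W = B + V"
    using AB unfolding multiset.in_rel by blast
  define off :: "ereal \<times> ereal \<Rightarrow> bool" where "off p \<longleftrightarrow> fst p \<noteq> snd p" for p
  define M where "M = filter_mset (\<lambda>w. off (fst w) \<and> off (snd w)) W"
  have "filter_mset off A = A" "filter_mset off U = {#}" "filter_mset off B = B"
    "filter_mset off V = {#}"
    using UV A B unfolding filter_mset_eq_conv off_def by auto
  then have "filter_mset off (A + U) = A" "filter_mset off (B + V) = B"
    by simp_all
  then have A': "A = image_mset fst (filter_mset (\<lambda>w. off (fst w)) W)"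
    and B': "B = image_mset snd (filter_mset (\<lambda>w. off (snd w)) W)"
    by (simp_all flip: W1 W2 add: filter_mset_image_mset)
  have "filter_mset (\<lambda>w. off (fst w)) W = M + filter_mset (\<lambda>w. off (fst w) \<and> \<not> off (snd w)) W"
    unfolding M_def by (rule multiset_eqI) auto
  then have A'': "A = image_mset fst M +
      image_mset fst (filter_mset (\<lambda>w. off (fst w) \<and> \<not> off (snd w)) W)"
    using A' by simp
  have "filter_mset (\<lambda>w. off (snd w)) W = M + filter_mset (\<lambda>w. \<not> off (fst w) \<and> off (snd w)) W"
    unfolding M_def by (rule multiset_eqI) auto
  then have B'': "B = image_mset snd M +
      image_mset snd (filter_mset (\<lambda>w. \<not> off (fst w) \<and> off (snd w)) W)"
    using B' by simp
  have W_le: "linf_dist (fst w) (snd w) \<le> ereal e" if "w \<in># W" for w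
    using W that by auto
  have "M \<in> partial_matchings A B"
    unfolding partial_matchings_def using A'' B'' by (metis (mono_tags, lifting) mem_Collect_eq mset_subset_eq_add_left)
  moreover have "matching_cost A B M \<le> ereal e"
    unfolding matching_cost_def
  proof (rule Sup_least, safe)
    show "0 \<le> ereal e" using e by simp
  next
    fix a b c d assume "((a, b), (c, d)) \<in># M"
    then show "linf_dist (a, b) (c, d) \<le> ereal e"
      using W_le unfolding M_def by fastforce
  next
    fix a b assume "(a, b) \<in># A - image_mset fst M"
    then have "(a, b) \<in># image_mset fst (filter_mset (\<lambda>w. off (fst w) \<and> \<not> off (snd w)) W)"
      by (subst (asm) A'') simp
    then obtain w where w: "w \<in># W" "fst w = (a, b)" "\<not> off (snd w)" by auto
    then show "diagonal_dist (a, b) \<le> ereal e"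
      using W_le[of w] diagonal_dist_le[of "snd w" "(a, b)"] by (auto simp: off_def)
  next
    fix a b assume "(a, b) \<in># B - image_mset snd M"
    then have "(a, b) \<in># image_mset snd (filter_mset (\<lambda>w. \<not> off (fst w) \<and> off (snd w)) W)"
      by (subst (asm) B'') simp
    then obtain w where w: "w \<in># W" "snd w = (a, b)" "\<not> off (fst w)" by auto
    then show "diagonal_dist (a, b) \<le> ereal e"
      using W_le[of w] diagonal_dist_le[of "fst w" "(a, b)"]
      by (auto simp: off_def linf_dist_commute)
  qed
  ultimately show ?thesis
    unfolding bottleneck_distance_def by (rule INF_lower2)
qed

section \<open>Uniqueness of persistence diagrams\<close>

abbreviation (input) fscale :: "'k::field \<Rightarrow> ('i \<Rightarrow> 'k) \<Rightarrow> 'i \<Rightarrow> 'k" where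
  "fscale a f \<equiv> \<lambda>i. a * f i"

text \<open>Chains and coordinate vectors of sums of intervals are both functions into the field, so
  one vector space structure serves for the two.\<close>

global_interpretation fs: vector_space "fscale :: 'k::field \<Rightarrow> ('i \<Rightarrow> 'k) \<Rightarrow> 'i \<Rightarrow> 'k"
  by unfold_locales (auto simp: fun_eq_iff algebra_simps)

definition unit_fun :: "'i \<Rightarrow> 'i \<Rightarrow> 'k::field" where
  "unit_fun i = (\<lambda>j. if j = i then 1 else 0)"

lemma sum_fun_apply: "sum f A x = (\<Sum>i\<in>A. f i x)"
  for f :: "'a \<Rightarrow> 'b \<Rightarrow> 'c::comm_monoid_add"
  by (induction A rule: infinite_finite_induct) auto

lemma inj_unit_fun: "inj (unit_fun :: 'i \<Rightarrow> 'i \<Rightarrow> 'k::field)"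
  by (rule injI) (metis unit_fun_def zero_neq_one)

lemma sum_unit_fun:
  assumes "finite A"
  shows "(\<Sum>i\<in>A. fscale (c i) (unit_fun i)) = (\<lambda>j. if j \<in> A then c j else 0 :: 'k::field)"
  by (rule ext) (simp add: sum_fun_apply unit_fun_def if_distrib assms cong: if_cong)

lemma span_unit_fun:
  assumes "finite A"
  shows "fs.span (unit_fun ` A) = {f :: 'i \<Rightarrow> 'k::field. \<forall>i. i \<notin> A \<longrightarrow> f i = 0}" (is "_ = ?V")
proof
  have "fs.subspace ?V"
    by (auto simp: fs.subspace_def)
  then show "fs.span (unit_fun ` A) \<subseteq> ?V"
    by (rule fs.span_minimal[rotated]) (auto simp: unit_fun_def)
  show "?V \<subseteq> fs.span (unit_fun ` A)"
  proof
    fix f :: "'i \<Rightarrow> 'k" assume "f \<in> ?V"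
    then have "f = (\<Sum>i\<in>A. fscale (f i) (unit_fun i))"
      by (auto simp: sum_unit_fun[OF assms])
    also have "\<dots> \<in> fs.span (unit_fun ` A)"
      by (intro fs.span_sum fs.span_scale fs.span_base) auto
    finally show "f \<in> fs.span (unit_fun ` A)" .
  qed
qed

lemma independent_unit_fun:
  assumes "finite A"
  shows "fs.independent (unit_fun ` A :: ('i \<Rightarrow> 'k::field) set)"
proof (rule fs.independent_if_scalars_zero)
  fix c :: "('i \<Rightarrow> 'k) \<Rightarrow> 'k" and x :: "'i \<Rightarrow> 'k"
  assume 0: "(\<Sum>x\<in>unit_fun ` A. fscale (c x) x) = 0" and x: "x \<in> unit_fun ` A"
  have "(\<Sum>x\<in>unit_fun ` A. fscale (c x) x) = (\<Sum>i\<in>A. fscale (c (unit_fun i)) (unit_fun i))"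
    by (rule sum.reindex_cong[OF inj_on_subset[OF inj_unit_fun subset_UNIV]]) auto
  also have "\<dots> = (\<lambda>j. if j \<in> A then c (unit_fun j) else 0)"
    by (rule sum_unit_fun[OF assms])
  finally have "(\<lambda>j. if j \<in> A then c (unit_fun j) else 0) = 0"
    unfolding 0 by (rule sym)
  then show "c x = 0"
    using x by (auto simp: fun_eq_iff split: if_splits)
qed (use assms in auto)

text \<open>The unit functions of \<open>A\<close> go to independent vectors in the span of the unit
  functions of \<open>B\<close>. Linearity is asked on all functions and injectivity only on those
  supported in \<open>A\<close>, which suits a map that is assembled from one defined on a
  carrier.\<close>

lemma card_le_if_linear_injective:
  fixes T :: "('i \<Rightarrow> 'k::field) \<Rightarrow> 'j \<Rightarrow> 'k"
  assumes "finite A" "finite B"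
    and add: "\<And>f g. T (f + g) = T f + T g" and scale: "\<And>a f. T (fscale a f) = fscale a (T f)"
    and inj: "\<And>f. (\<And>i. i \<notin> A \<Longrightarrow> f i = 0) \<Longrightarrow> T f = 0 \<Longrightarrow> f = 0"
    and range: "\<And>f j. j \<notin> B \<Longrightarrow> T f j = 0"
  shows "card A \<le> card B"
proof -
  interpret T: Vector_Spaces.linear "fscale :: 'k \<Rightarrow> ('i \<Rightarrow> 'k) \<Rightarrow> 'i \<Rightarrow> 'k"
    "fscale :: 'k \<Rightarrow> ('j \<Rightarrow> 'k) \<Rightarrow> 'j \<Rightarrow> 'k" T
    by unfold_locales (auto simp: add scale)
  have inj': "inj_on T (fs.span (unit_fun ` A))"
    unfolding T.inj_on_iff_eq_0[OF fs.subspace_span]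
    using inj by (auto simp: span_unit_fun[OF \<open>finite A\<close>])
  have ind: "fs.independent (T ` unit_fun ` A)"
    by (rule T.independent_injective_image[OF independent_unit_fun[OF \<open>finite A\<close>] inj'])
  have "T ` unit_fun ` A \<subseteq> fs.span (unit_fun ` B)"
    unfolding span_unit_fun[OF \<open>finite B\<close>] using range by auto
  then have "card (T ` unit_fun ` A) \<le> card (unit_fun ` B :: ('j \<Rightarrow> 'k) set)"
    using fs.independent_span_bound[OF _ ind] \<open>finite B\<close> by blast
  moreover have "inj_on T (unit_fun ` A)"
    using inj' by (rule inj_on_subset) (rule fs.span_superset)
  ultimately show ?thesis
    by (simp add: card_image inj_on_subset[OF inj_unit_fun])
qed

section \<open>Isomorphisms of persistence vector spaces\<close>

definition pvspace_closed :: "('k, 'v) pvspace \<Rightarrow> bool" where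
  "pvspace_closed P \<longleftrightarrow>
     (\<forall>\<delta>. \<forall>x\<in>vcarrier (pspace P \<delta>).
        (\<forall>y\<in>vcarrier (pspace P \<delta>). vadd (pspace P \<delta>) x y \<in> vcarrier (pspace P \<delta>)) \<and>
        (\<forall>a. vscale (pspace P \<delta>) a x \<in> vcarrier (pspace P \<delta>)) \<and>
        (\<forall>\<delta>'\<ge>\<delta>. ptrans P \<delta> \<delta>' x \<in> vcarrier (pspace P \<delta>')))"

text \<open>The inverse is compatible with the operations because \<open>\<phi>\<close> sends both
  sides to the same element. To cancel \<open>\<phi>\<close>, known to be injective on the carrier
  only, the results of the operations of \<open>P\<close> must lie in that carrier; the bare records
  do not guarantee this, hence \<open>pvspace_closed\<close>.\<close>

lemma pvspace_iso_sym:
  assumes P: "pvspace_closed P" and iso: "pvspace_iso P Q"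
  shows "pvspace_iso Q P"
proof -
  obtain \<phi> where lin: "\<And>\<delta>. linear_iso (pspace P \<delta>) (pspace Q \<delta>) (\<phi> \<delta>)"
    and nat: "\<And>\<delta> \<delta>' x. \<delta> \<le> \<delta>' \<Longrightarrow> x \<in> vcarrier (pspace P \<delta>) \<Longrightarrow>
      \<phi> \<delta>' (ptrans P \<delta> \<delta>' x) = ptrans Q \<delta> \<delta>' (\<phi> \<delta> x)"
    using iso unfolding pvspace_iso_def by blast
  define \<psi> where "\<psi> \<delta> = inv_into (vcarrier (pspace P \<delta>)) (\<phi> \<delta>)" for \<delta>
  have bij: "bij_betw (\<phi> \<delta>) (vcarrier (pspace P \<delta>)) (vcarrier (pspace Q \<delta>))" for \<delta>
    using lin unfolding linear_iso_def by blast
  have mem: "\<psi> \<delta> x \<in> vcarrier (pspace P \<delta>)" and right: "\<phi> \<delta> (\<psi> \<delta> x) = x"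
    if "x \<in> vcarrier (pspace Q \<delta>)" for \<delta> x
    using that bij[of \<delta>] unfolding \<psi>_def
    by (auto simp: bij_betw_def inv_into_into f_inv_into_f)
  have left: "\<psi> \<delta> (\<phi> \<delta> x) = x" if "x \<in> vcarrier (pspace P \<delta>)" for \<delta> x
    using that bij[of \<delta>] unfolding \<psi>_def by (simp add: bij_betw_def)
  have "linear_iso (pspace Q \<delta>) (pspace P \<delta>) (\<psi> \<delta>)" for \<delta>
    unfolding linear_iso_def
  proof (intro conjI ballI allI)
    show "bij_betw (\<psi> \<delta>) (vcarrier (pspace Q \<delta>)) (vcarrier (pspace P \<delta>))"
      unfolding \<psi>_def by (rule bij_betw_inv_into[OF bij])
  next
    fix x y assume x: "x \<in> vcarrier (pspace Q \<delta>)" and y: "y \<in> vcarrier (pspace Q \<delta>)"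
    have "\<phi> \<delta> (vadd (pspace P \<delta>) (\<psi> \<delta> x) (\<psi> \<delta> y)) = vadd (pspace Q \<delta>) x y"
      using lin[of \<delta>] mem[OF x] mem[OF y] right[OF x] right[OF y] unfolding linear_iso_def by simp
    then show "\<psi> \<delta> (vadd (pspace Q \<delta>) x y) = vadd (pspace P \<delta>) (\<psi> \<delta> x) (\<psi> \<delta> y)"
      using left[of "vadd (pspace P \<delta>) (\<psi> \<delta> x) (\<psi> \<delta> y)"] P mem[OF x] mem[OF y]
      unfolding pvspace_closed_def by metis
  next
    fix a x assume x: "x \<in> vcarrier (pspace Q \<delta>)"
    have "\<phi> \<delta> (vscale (pspace P \<delta>) a (\<psi> \<delta> x)) = vscale (pspace Q \<delta>) a x"
      using lin[of \<delta>] mem[OF x] right[OF x] unfolding linear_iso_def by simp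
    then show "\<psi> \<delta> (vscale (pspace Q \<delta>) a x) = vscale (pspace P \<delta>) a (\<psi> \<delta> x)"
      using left[of "vscale (pspace P \<delta>) a (\<psi> \<delta> x)"] P mem[OF x]
      unfolding pvspace_closed_def by metis
  qed
  moreover have "\<psi> \<delta>' (ptrans Q \<delta> \<delta>' x) = ptrans P \<delta> \<delta>' (\<psi> \<delta> x)"
    if "\<delta> \<le> \<delta>'" and x: "x \<in> vcarrier (pspace Q \<delta>)" for \<delta> \<delta>' x
    using nat[OF that(1) mem[OF x]] right[OF x] left[of "ptrans P \<delta> \<delta>' (\<psi> \<delta> x)" \<delta>'] P mem[OF x] that(1)
    unfolding pvspace_closed_def by metis
  ultimately show ?thesis
    unfolding pvspace_iso_def by blast
qed

lemma linear_iso_trans: "linear_iso U V f \<Longrightarrow> linear_iso V W g \<Longrightarrow> linear_iso U W (g \<circ> f)"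
  unfolding linear_iso_def by (auto intro: bij_betw_trans dest: bij_betwE)

lemma pvspace_iso_trans:
  assumes "pvspace_iso P Q" "pvspace_iso Q S"
  shows "pvspace_iso P S"
proof -
  obtain \<phi> \<psi> where \<phi>: "\<And>\<delta>. linear_iso (pspace P \<delta>) (pspace Q \<delta>) (\<phi> \<delta>)"
      "\<And>\<delta> \<delta>' x. \<delta> \<le> \<delta>' \<Longrightarrow> x \<in> vcarrier (pspace P \<delta>) \<Longrightarrow>
        \<phi> \<delta>' (ptrans P \<delta> \<delta>' x) = ptrans Q \<delta> \<delta>' (\<phi> \<delta> x)"
    and \<psi>: "\<And>\<delta>. linear_iso (pspace Q \<delta>) (pspace S \<delta>) (\<psi> \<delta>)"
      "\<And>\<delta> \<delta>' x. \<delta> \<le> \<delta>' \<Longrightarrow> x \<in> vcarrier (pspace Q \<delta>) \<Longrightarrow>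
        \<psi> \<delta>' (ptrans Q \<delta> \<delta>' x) = ptrans S \<delta> \<delta>' (\<psi> \<delta> x)"
    using assms unfolding pvspace_iso_def by blast
  have "\<phi> \<delta> x \<in> vcarrier (pspace Q \<delta>)" if "x \<in> vcarrier (pspace P \<delta>)" for \<delta> x
    using \<phi>(1)[of \<delta>] that unfolding linear_iso_def by (auto dest: bij_betwE)
  then show ?thesis
    unfolding pvspace_iso_def
    by (intro exI[of _ "\<lambda>\<delta>. \<psi> \<delta> \<circ> \<phi> \<delta>"]) (auto intro: linear_iso_trans[OF \<phi>(1) \<psi>(1)] simp: \<phi>(2) \<psi>(2))
qed

section \<open>Bar counts as ranks of transition maps\<close>

abbreviation bar_sum :: "(ereal \<times> ereal) list \<Rightarrow> ('k::field, nat \<Rightarrow> 'k) pvspace" where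
  "bar_sum ps \<equiv> direct_sum {..<length ps} (\<lambda>i. interval_module (ps ! i))"

lemma vcarrier_bar_sum:
  "vcarrier (pspace (bar_sum ps) \<delta>) =
     {f \<in> extensional {..<length ps}. \<forall>i<length ps. \<delta> \<notin> bar (ps ! i) \<longrightarrow> f i = 0}"
proof -
  have "x \<in> (if c then UNIV else {0}) \<longleftrightarrow> (\<not> c \<longrightarrow> x = 0)" for x :: 'a and c
    by simp
  then show ?thesis
    unfolding direct_sum_def interval_module_def set_eq_iff
    by (simp only: PiE_iff pvspace.simps vspace.simps mem_Collect_eq lessThan_iff Ball_def) blast
qed

lemma pspace_bar_sum [simp]:
  "vadd (pspace (bar_sum ps) \<delta>) f g = (\<lambda>i\<in>{..<length ps}. f i + g i)"
  "vscale (pspace (bar_sum ps) \<delta>) a f = (\<lambda>i\<in>{..<length ps}. a * f i)"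
  "ptrans (bar_sum ps) \<delta> \<delta>' f =
     (\<lambda>i\<in>{..<length ps}. if \<delta> \<in> bar (ps ! i) \<and> \<delta>' \<in> bar (ps ! i) then f i else 0)"
  by (auto simp: direct_sum_def interval_module_def)

lemma pvspace_closed_bar_sum: "pvspace_closed (bar_sum ps)"
  unfolding pvspace_closed_def vcarrier_bar_sum by auto

text \<open>The left-hand count is the rank of the transition from \<open>s\<close> to
  \<open>t\<close>. Vectors supported on the bars alive at both times are fixed by this transition,
  so by naturality \<open>\<phi> t\<close> maps them injectively into the image of the corresponding
  transition of the other sum.\<close>

lemma bar_count_le:
  assumes iso: "pvspace_iso (bar_sum ps :: ('k::field, nat \<Rightarrow> 'k) pvspace) (bar_sum qs)"
    and "s \<le> t"
  shows "card {i. i < length ps \<and> s \<in> bar (ps ! i) \<and> t \<in> bar (ps ! i)}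
       \<le> card {i. i < length qs \<and> s \<in> bar (qs ! i) \<and> t \<in> bar (qs ! i)}" (is "card ?A \<le> card ?B")
proof -
  let ?P = "bar_sum ps :: ('k, nat \<Rightarrow> 'k) pvspace" and ?Q = "bar_sum qs :: ('k, nat \<Rightarrow> 'k) pvspace"
  obtain \<phi> where lin: "\<And>\<delta>. linear_iso (pspace ?P \<delta>) (pspace ?Q \<delta>) (\<phi> \<delta>)"
    and nat: "\<And>x. x \<in> vcarrier (pspace ?P s) \<Longrightarrow> \<phi> t (ptrans ?P s t x) = ptrans ?Q s t (\<phi> s x)"
    using iso \<open>s \<le> t\<close> unfolding pvspace_iso_def by blast
  define r :: "(nat \<Rightarrow> 'k) \<Rightarrow> nat \<Rightarrow> 'k"
    where "r f = (\<lambda>i\<in>{..<length ps}. if i \<in> ?A then f i else 0)" for f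
  \<comment> \<open>Elements of a direct sum are \<open>undefined\<close> outside the index range;
    replacing these values by 0 makes \<open>T\<close> linear on functions.\<close>
  define T where "T f = (\<lambda>j. if j < length qs then \<phi> t (r f) j else 0)" for f
  have r_s: "r f \<in> vcarrier (pspace ?P s)" and r_t: "r f \<in> vcarrier (pspace ?P t)" for f
    unfolding vcarrier_bar_sum r_def by auto
  have add: "\<phi> t (vadd (pspace ?P t) (r f) (r g)) = vadd (pspace ?Q t) (\<phi> t (r f)) (\<phi> t (r g))"
    and scale: "\<phi> t (vscale (pspace ?P t) a (r f)) = vscale (pspace ?Q t) a (\<phi> t (r f))" for a f g
    using lin[of t] r_t unfolding linear_iso_def by blast+
  have r_add: "r (f + g) = vadd (pspace ?P t) (r f) (r g)"
    and r_scale: "r (fscale a f) = vscale (pspace ?P t) a (r f)" for a f g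
    unfolding pspace_bar_sum r_def by auto
  show ?thesis
  proof (rule card_le_if_linear_injective)
    show "T (f + g) = T f + T g" for f g
      unfolding T_def r_add add by auto
    show "T (fscale a f) = fscale a (T f)" for a f
      unfolding T_def r_scale scale by auto
  next
    fix f :: "nat \<Rightarrow> 'k" assume f: "\<And>i. i \<notin> ?A \<Longrightarrow> f i = 0" and "T f = 0"
    have "\<phi> t (r g) \<in> extensional {..<length qs}" for g
      using lin[of t] r_t[of g] unfolding linear_iso_def vcarrier_bar_sum by (auto dest: bij_betwE)
    moreover have "\<phi> t (r f) j = \<phi> t (r 0) j" if "j < length qs" for j
    proof -
      \<comment> \<open>\<open>linear_iso\<close> has no clause for the zero vector. The vector
        \<open>r 0\<close> is 0 times itself, which forces the coordinates of its image to
        vanish.\<close>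
      have "r 0 = vscale (pspace ?P t) 0 (r 0)"
        unfolding r_def by auto
      then have "\<phi> t (r 0) = vscale (pspace ?Q t) 0 (\<phi> t (r 0))"
        using scale[of 0 0] by simp
      then have "\<phi> t (r 0) j = vscale (pspace ?Q t) 0 (\<phi> t (r 0)) j"
        by (rule fun_cong)
      also have "\<dots> = 0"
        using that by simp
      finally have "\<phi> t (r 0) j = 0" .
      moreover have "\<phi> t (r f) j = 0"
        using fun_cong[OF \<open>T f = 0\<close>, of j] that unfolding T_def by simp
      ultimately show ?thesis by simp
    qed
    ultimately have "\<phi> t (r f) = \<phi> t (r 0)"
      by (intro extensionalityI[of _ "{..<length qs}"]) auto
    then have "r f = r 0"
      using lin[of t] r_t unfolding linear_iso_def bij_betw_def inj_on_def by blast
    have "f i = 0" if "i \<in> ?A" for i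
      using fun_cong[OF \<open>r f = r 0\<close>, of i] that unfolding r_def by auto
    then show "f = 0" using f by (intro ext) (auto; blast)
  next
    fix f j assume j: "j \<notin> ?B"
    have "ptrans ?P s t (r f) = r f"
      unfolding r_def by auto
    then have "\<phi> t (r f) = ptrans ?Q s t (\<phi> s (r f))"
      using nat[OF r_s[of f]] by (simp only:)
    then show "T f j = 0"
      using j unfolding T_def by auto
  qed auto
qed

text \<open>Finitely many endpoints leave room for a time \<open>s\<close> at or after the birth of
  \<open>p\<close> that no later birth in \<open>F\<close> precedes, and for a time \<open>t\<close>
  before the death of \<open>p\<close> but after all earlier deaths. A bar of \<open>F\<close> alive
  at both must then contain \<open>p\<close>.\<close>

lemma bar_endpoints:
  assumes "finite F" and ab: "fst p < snd p"
  obtains s t where "s \<le> t" "s \<in> bar p" "t \<in> bar p"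
    "\<And>q. q \<in> F \<Longrightarrow> s \<in> bar q \<Longrightarrow> t \<in> bar q \<Longrightarrow> fst q \<le> fst p \<and> snd p \<le> snd q"
proof -
  obtain s where s: "s \<in> bar p" "\<And>q. q \<in> F \<Longrightarrow> fst q \<le> ereal s \<Longrightarrow> fst q \<le> fst p"
  proof (cases "fst p")
    case (real r)
    then show ?thesis using ab by (intro that[of r]) (auto simp: bar_def)
  next
    case PInf
    then show ?thesis using ab by simp
  next
    case MInf
    \<comment> \<open>A bar born at minus infinity has no first moment; any time before its death
      and before all finite births in \<open>F\<close> serves.\<close>
    define m where "m = Min (insert (snd p) (fst ` {q \<in> F. fst q > fst p}))"
    have "fst p < m" unfolding m_def using assms by auto
    then obtain s where s: "fst p < ereal s" "ereal s < m" using ereal_dense2 by blast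
    have le: "m \<le> snd p" "\<And>q. q \<in> F \<Longrightarrow> fst q > fst p \<Longrightarrow> m \<le> fst q"
      unfolding m_def using assms by auto
    show ?thesis
    proof (rule that[of s])
      show "s \<in> bar p" using s le(1) by (auto simp: bar_def)
      show "fst q \<le> fst p" if "q \<in> F" "fst q \<le> ereal s" for q
        using le(2)[OF that(1)] that(2) s(2) by (meson leD leI le_less_trans)
    qed
  qed
  \<comment> \<open>The element \<open>ereal s\<close> keeps the set nonempty and makes
    \<open>t\<close> lie after \<open>s\<close>.\<close>
  define M where "M = Max (insert (ereal s) (snd ` {q \<in> F. snd q < snd p}))"
  have "M < snd p" unfolding M_def using assms s(1) by (auto simp: bar_def)
  then obtain t where t: "M < ereal t" "ereal t < snd p" using ereal_dense2 by blast
  have le: "ereal s \<le> M" "\<And>q. q \<in> F \<Longrightarrow> snd q < snd p \<Longrightarrow> snd q \<le> M"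
    unfolding M_def using assms by auto
  have st: "s \<le> t" using le(1) t(1) by (metis ereal_less_eq(3) less_imp_le order_trans)
  show ?thesis
  proof (rule that[OF st s(1)])
    show "t \<in> bar p"
      using s(1) st t(2) by (auto simp: bar_def intro: order_trans)
    fix q assume q: "q \<in> F" "s \<in> bar q" "t \<in> bar q"
    show "fst q \<le> fst p \<and> snd p \<le> snd q"
      using q s(2)[OF q(1)] le(2)[OF q(1)] t(1) unfolding bar_def
      by (metis (mono_tags, lifting) leI less_asym less_le_trans mem_Collect_eq)
  qed
qed

text \<open>If the multisets differ, consider a bar with different multiplicities that is maximal under
  inclusion: close to its endpoints no other bar with different multiplicities is alive.\<close>

lemma multiset_eq_if_bar_counts_eq:
  assumes A: "\<And>p. p \<in># A \<Longrightarrow> fst p < snd p" and B: "\<And>p. p \<in># B \<Longrightarrow> fst p < snd p"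
    and count: "\<And>s t. s \<le> t \<Longrightarrow> size (filter_mset (\<lambda>p. s \<in> bar p \<and> t \<in> bar p) A)
                              = size (filter_mset (\<lambda>p. s \<in> bar p \<and> t \<in> bar p) B)"
  shows "A = B"
proof (rule ccontr)
  define F where "F = {p \<in> set_mset A \<union> set_mset B. count A p \<noteq> count B p}"
  assume "A \<noteq> B"
  then obtain p where "count A p \<noteq> count B p"
    unfolding multiset_eq_iff by blast
  then have "p \<in> F"
    unfolding F_def by (cases "p \<in># A \<or> p \<in># B") (auto simp: not_in_iff)
  then have "F \<noteq> {}" by blast
  have fin: "finite F" unfolding F_def by simp
  \<comment> \<open>Smallest birth, then greatest death among these: a bar of \<open>F\<close> that
    contains \<open>(a, b)\<close> has the same birth and therefore the same death.\<close>
  define a where "a = Min (fst ` F)"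
  define b where "b = Max (snd ` {p \<in> F. fst p = a})"
  have "a \<in> fst ` F" unfolding a_def using fin \<open>F \<noteq> {}\<close> by simp
  then have "b \<in> snd ` {p \<in> F. fst p = a}" unfolding b_def using fin by (intro Max_in) auto
  then have pF: "(a, b) \<in> F" by force
  have maximal: "q = (a, b)" if "q \<in> F" "fst q \<le> a" "b \<le> snd q" for q
  proof -
    have "a \<le> fst q" unfolding a_def using fin that by simp
    moreover have "snd q \<le> b" if "fst q = a"
      unfolding b_def using fin \<open>q \<in> F\<close> that by simp
    ultimately show ?thesis using that by (auto simp: prod_eq_iff)
  qed
  have "fst (a, b) < snd (a, b)" using pF A B unfolding F_def by auto
  then obtain s t where st: "s \<le> t" "s \<in> bar (a, b)" "t \<in> bar (a, b)"
    and sub: "\<And>q. q \<in> F \<Longrightarrow> s \<in> bar q \<Longrightarrow> t \<in> bar q \<Longrightarrow> fst q \<le> a \<and> b \<le> snd q"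
    using bar_endpoints[OF fin, of "(a, b)"] by auto
  define alive where "alive p \<longleftrightarrow> s \<in> bar p \<and> t \<in> bar p" for p
  have "count A q = count B q" if "q \<noteq> (a, b)" "alive q" for q
  proof (cases "q \<in># A \<or> q \<in># B")
    case True
    moreover have "q \<notin> F" using that sub[of q] maximal[of q] unfolding alive_def by blast
    ultimately show ?thesis unfolding F_def by auto
  next
    case False
    then show ?thesis by (simp add: not_in_iff)
  qed
  \<comment> \<open>Among the bars alive at \<open>s\<close> and \<open>t\<close> only
    \<open>(a, b)\<close> can have different multiplicities. Once its copies are removed the rest
    agrees, so equal totals force equal counts.\<close>
  then have eq: "filter_mset alive A - replicate_mset (count A (a, b)) (a, b)
      = filter_mset alive B - replicate_mset (count B (a, b)) (a, b)"
    by (intro multiset_eqI) auto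
  have size: "size (filter_mset alive C) =
      size (filter_mset alive C - replicate_mset (count C (a, b)) (a, b)) + count C (a, b)" for C
  proof -
    have "replicate_mset (count C (a, b)) (a, b) \<subseteq># filter_mset alive C"
      using st by (auto simp: alive_def subseteq_mset_def)
    then show ?thesis
      using size_Diff_submset size_mset_mono by fastforce
  qed
  have "size (filter_mset alive A) = size (filter_mset alive B)"
    using count[OF st(1)] unfolding alive_def .
  then have "count A (a, b) = count B (a, b)"
    using size[of A] size[of B] unfolding eq by linarith
  then show False using pF unfolding F_def by simp
qed

text \<open>Two decompositions of \<open>P\<close> are isomorphic to each other through
  \<open>P\<close>, so the rank inequalities hold in both directions and all bar counts
  agree.\<close>

lemma persistence_diagram_unique:
  fixes P :: "('k::field, 'v) pvspace"
  assumes P: "pvspace_closed P" and D: "is_persistence_diagram P D" "is_persistence_diagram P D'"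
  shows "D = D'"
proof -
  have le: "size (filter_mset (\<lambda>p. s \<in> bar p \<and> t \<in> bar p) D)
      \<le> size (filter_mset (\<lambda>p. s \<in> bar p \<and> t \<in> bar p) D')"
    if D: "is_persistence_diagram P D" and D': "is_persistence_diagram P D'" and "s \<le> t" for D D' s t
  proof -
    obtain ps where ps: "mset ps = D" "pvspace_iso P (bar_sum ps)"
      using D unfolding is_persistence_diagram_def by blast
    obtain qs where qs: "mset qs = D'" "pvspace_iso P (bar_sum qs)"
      using D' unfolding is_persistence_diagram_def by blast
    have "pvspace_iso (bar_sum ps :: ('k, nat \<Rightarrow> 'k) pvspace) (bar_sum qs)"
      using pvspace_iso_trans[OF pvspace_iso_sym[OF P ps(2)] qs(2)] .
    from bar_count_le[OF this \<open>s \<le> t\<close>] show ?thesis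
      unfolding ps(1)[symmetric] qs(1)[symmetric] mset_filter[symmetric] size_mset
        length_filter_conv_card .
  qed
  show ?thesis
  proof (rule multiset_eq_if_bar_counts_eq)
    show "fst p < snd p" if "p \<in># D" for p
      using that D(1) unfolding is_persistence_diagram_def by auto
    show "fst p < snd p" if "p \<in># D'" for p
      using that D(2) unfolding is_persistence_diagram_def by auto
  qed (use le[OF D] le[OF D(2) D(1)] in \<open>auto intro: antisym\<close>)
qed

lemma persistence_diagram_eqI:
  assumes "pvspace_closed P" "is_persistence_diagram P D"
  shows "persistence_diagram P = D"
  unfolding persistence_diagram_def using persistence_diagram_unique[OF assms(1)] assms(2)
  by (intro the_equality) auto

lemma is_persistence_diagram_iso:
  assumes "pvspace_iso P Q" "is_persistence_diagram Q D"
  shows "is_persistence_diagram P D"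
  using assms(2) pvspace_iso_trans[OF assms(1)] unfolding is_persistence_diagram_def by blast

section \<open>Adapted bases\<close>

context vector_space
begin

text \<open>A vector of \<open>W\<close> outside \<open>V\<close> would extend a basis of
  \<open>V\<close> to an independent set exceeding \<open>dim W\<close>. The finite set
  \<open>C\<close> keeps the bases finite, so that \<open>dim\<close> compares true sizes.\<close>

lemma subspace_eq_if_dim_le:
  assumes sub: "subspace V" and "V \<subseteq> W" "W \<subseteq> span C" "finite C" and dim: "dim W \<le> dim V"
  shows "V = W"
proof (rule ccontr)
  assume "V \<noteq> W"
  then obtain x where x: "x \<in> W" "x \<notin> V" using \<open>V \<subseteq> W\<close> by blast
  obtain A where A: "A \<subseteq> V" "independent A" "V \<subseteq> span A" "card A = dim V"
    using basis_exists .
  obtain B where B: "B \<subseteq> W" "independent B" "W \<subseteq> span B" "card B = dim W"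
    using basis_exists .
  have fin: "finite B"
    using independent_span_bound[OF \<open>finite C\<close> B(2)] B(1) \<open>W \<subseteq> span C\<close> by blast
  have "span A = V"
    using A(1,3) sub by (simp add: span_subspace)
  then have ind: "independent (insert x A)" and "x \<notin> A"
    using independent_insertI[OF _ A(2), of x] A(1) x by auto
  have "insert x A \<subseteq> span B" using A(1) B(3) \<open>V \<subseteq> W\<close> x(1) by auto
  with independent_span_bound[OF fin ind] have "finite (insert x A)" "card (insert x A) \<le> card B"
    by auto
  then show False using A(4) B(4) \<open>x \<notin> A\<close> dim by simp
qed

text \<open>Extend a basis of \<open>V\<close> to one of \<open>span C\<close>. Since
  \<open>V\<close> is proper, some vector \<open>c\<close> is new; the others span a hyperplane that
  still contains \<open>V\<close>.\<close>

lemma hyperplane_above: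
  assumes C: "finite C" "independent C"
    and V: "subspace V" "V \<subseteq> span C" "V \<noteq> span C"
  obtains D c where "finite D" "independent D" "card C = Suc (card D)" "V \<subseteq> span D"
    "c \<notin> span D" "span (insert c D) = span C"
proof -
  obtain A where A: "A \<subseteq> V" "independent A" "V \<subseteq> span A"
    using maximal_independent_subset .
  have "A \<subseteq> span C" using A(1) V(2) by blast
  then obtain B where B: "A \<subseteq> B" "B \<subseteq> span C" "independent B" "span C \<subseteq> span B"
    using maximal_independent_subset_extend[OF _ A(2)] by metis
  have sB: "span B = span C"
    using B(2,4) by (simp add: span_minimal subset_antisym)
  have B': "finite B" "card B = card C"
    using independent_span_bound[OF C(1) B(3,2)]
      independent_span_bound[OF _ C(2), of B] sB span_superset[of C] by auto
  have "span A = V" using A(1,3) V(1) by (simp add: span_subspace)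
  then have "A \<noteq> B" using sB V(3) by blast
  then obtain c where c: "c \<in> B" "c \<notin> A" using B(1) by blast
  show ?thesis
  proof (rule that[of "B - {c}" c])
    show "independent (B - {c})" using B(3) by (rule independent_mono) blast
    show "card C = Suc (card (B - {c}))"
      using B' c(1) by (metis card_Suc_Diff1)
    show "V \<subseteq> span (B - {c})" using A(3) B(1) c(2) span_mono[of A "B - {c}"] by blast
    show "c \<notin> span (B - {c})" using B(3) c(1) unfolding dependent_def by blast
    show "span (insert c (B - {c})) = span C" using sB c(1) by (simp add: insert_absorb)
  qed (use B' in auto)
qed

text \<open>Two flags have a common adapted basis: split off a hyperplane \<open>H\<close> that contains every proper
  member of the first flag, and complete an adapted basis of \<open>H\<close> by a vector of the smallest member
  of the second flag that is not contained in \<open>H\<close>.\<close>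

lemma ex_adapted_basis:
  assumes "finite C" "independent C"
    and "\<forall>V\<in>\<U> \<union> \<W>. subspace V \<and> V \<subseteq> span C"
    and "\<forall>V\<in>\<U>. \<forall>W\<in>\<U>. V \<subseteq> W \<or> W \<subseteq> V" and "\<forall>V\<in>\<W>. \<forall>W\<in>\<W>. V \<subseteq> W \<or> W \<subseteq> V"
  shows "\<exists>B. finite B \<and> independent B \<and> span B = span C \<and> (\<forall>V\<in>\<U> \<union> \<W>. span (B \<inter> V) = V)"
  using assms
proof (induction "card C" arbitrary: C \<U> \<W>)
  case 0
  then have "C = {}" by simp
  moreover have "V = {0}" if "V \<in> \<U> \<union> \<W>" for V
    using that 0 \<open>C = {}\<close> subspace_0[of V] by auto
  ultimately show ?case using independent_empty by (intro exI[of _ "{}"]) auto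
next
  case (Suc n)
  note sub = \<open>\<forall>V\<in>\<U> \<union> \<W>. subspace V \<and> V \<subseteq> span C\<close>
  \<comment> \<open>The zero space guarantees a member even if the first flag has no proper
    one.\<close>
  define \<P> where "\<P> = insert {0} {V \<in> \<U>. V \<noteq> span C}"
  have "C \<noteq> {}" using Suc(2) by auto
  then obtain x where "x \<in> C" by blast
  then have "x \<in> span C" "x \<noteq> 0"
    using \<open>independent C\<close> dependent_zero by (auto intro: span_base)
  then have "span C \<noteq> {0}" by blast
  then have \<P>: "subspace V \<and> V \<subseteq> span C \<and> V \<noteq> span C" if "V \<in> \<P>" for V
    using that sub by (auto simp: \<P>_def span_zero)
  \<comment> \<open>The flag may be infinite; its largest proper member is found through the
    dimension, which is bounded by \<open>card C\<close>.\<close>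
  obtain V0 where V0: "V0 \<in> \<P>" and max: "\<And>V. V \<in> \<P> \<Longrightarrow> dim V \<le> dim V0"
  proof -
    have "{0} \<in> \<P>" unfolding \<P>_def by simp
    moreover have "\<forall>V. V \<in> \<P> \<longrightarrow> dim V < Suc (card C)"
      using dim_le_card[OF _ \<open>finite C\<close>] \<P> by (simp add: less_Suc_eq_le)
    ultimately have "\<exists>V. V \<in> \<P> \<and> (\<forall>W. W \<in> \<P> \<longrightarrow> dim W \<le> dim V)"
      by (rule Lattices_Big.ex_has_greatest_nat)
    then show ?thesis using that by blast
  qed
  have above: "V \<subseteq> V0" if V: "V \<in> \<P>" for V
  proof -
    have "V \<subseteq> V0 \<or> V0 \<subseteq> V"
    proof (cases "V = {0} \<or> V0 = {0}")
      case True
      then show ?thesis using subspace_0 \<P>[OF V] \<P>[OF V0] by blast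
    next
      case False
      then have "V \<in> \<U>" "V0 \<in> \<U>" using V V0 unfolding \<P>_def by simp_all
      then show ?thesis using Suc.prems(4) by blast
    qed
    moreover have "V0 = V" if "V0 \<subseteq> V"
      using subspace_eq_if_dim_le[of V0 V C] that max[OF V] \<P>[OF V] \<P>[OF V0] \<open>finite C\<close> by simp
    ultimately show ?thesis by blast
  qed
  obtain D c where D: "finite D" "independent D" "card C = Suc (card D)" "V0 \<subseteq> span D"
    and c: "c \<notin> span D" "span (insert c D) = span C"
    using hyperplane_above[OF \<open>finite C\<close> \<open>independent C\<close>, of V0] \<P>[OF V0] by metis
  define H where "H = span D"
  have subH: "subspace H" unfolding H_def by simp
  obtain v where v: "v \<in> span C" "v \<notin> H" and v_in: "\<And>W. W \<in> \<W> \<Longrightarrow> \<not> W \<subseteq> H \<Longrightarrow> v \<in> W"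
  proof (cases "\<exists>W\<in>\<W>. \<not> W \<subseteq> H")
    case True
    then obtain W1 where "W1 \<in> \<W> \<and> \<not> W1 \<subseteq> H" by blast
    then have "\<exists>W. (W \<in> \<W> \<and> \<not> W \<subseteq> H) \<and> (\<forall>V. V \<in> \<W> \<and> \<not> V \<subseteq> H \<longrightarrow> dim W \<le> dim V)"
      by (rule ex_has_least_nat)
    then obtain W0 where W0: "W0 \<in> \<W>" "\<not> W0 \<subseteq> H"
      and min: "\<And>W. W \<in> \<W> \<Longrightarrow> \<not> W \<subseteq> H \<Longrightarrow> dim W0 \<le> dim W"
      by blast
    have "W0 \<subseteq> W" if "W \<in> \<W>" "\<not> W \<subseteq> H" for W
    proof (cases "W \<subseteq> W0")
      case True
      then show ?thesis
        using subspace_eq_if_dim_le[of W W0 C] min[OF that] sub that(1) W0(1) \<open>finite C\<close> by simp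
    next
      case False
      then show ?thesis using Suc.prems(5) that(1) W0(1) by blast
    qed
    moreover obtain w where "w \<in> W0" "w \<notin> H" using W0(2) by blast
    moreover have "W0 \<subseteq> span C" using sub W0(1) by simp
    ultimately show ?thesis using that[of w] by blast
  next
    case False
    have "c \<in> span C" using c(2) span_base[of c "insert c D"] by simp
    moreover have "c \<notin> H" using c(1) unfolding H_def .
    ultimately show ?thesis using False that[of c] by blast
  qed
  \<comment> \<open>Intersecting with \<open>H\<close> preserves inclusions, so both families remain
    flags, now inside a space of dimension one less.\<close>
  have IH: "\<exists>B. finite B \<and> independent B \<and> span B = span D \<and>
      (\<forall>V\<in>(\<lambda>V. V \<inter> H) ` \<U> \<union> (\<lambda>V. V \<inter> H) ` \<W>. span (B \<inter> V) = V)"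
  proof (rule Suc.hyps(1))
    show "\<forall>V\<in>(\<lambda>V. V \<inter> H) ` \<U> \<union> (\<lambda>V. V \<inter> H) ` \<W>. subspace V \<and> V \<subseteq> span D"
      using sub subH unfolding H_def by (auto intro!: subspace_inter)
    show "\<forall>V\<in>(\<lambda>V. V \<inter> H) ` \<U>. \<forall>W\<in>(\<lambda>V. V \<inter> H) ` \<U>. V \<subseteq> W \<or> W \<subseteq> V"
      using Suc.prems(4) by blast
    show "\<forall>V\<in>(\<lambda>V. V \<inter> H) ` \<W>. \<forall>W\<in>(\<lambda>V. V \<inter> H) ` \<W>. V \<subseteq> W \<or> W \<subseteq> V"
      using Suc.prems(5) by blast
  qed (use D Suc.hyps(2) in auto)
  then obtain B where B: "finite B" "independent B" "span B = span D"
    and "\<forall>V\<in>(\<lambda>V. V \<inter> H) ` \<U> \<union> (\<lambda>V. V \<inter> H) ` \<W>. span (B \<inter> V) = V"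
    by (elim exE conjE)
  then have adapted: "span (B \<inter> (V \<inter> H)) = V \<inter> H" if "V \<in> \<U> \<union> \<W>" for V
    using that by (simp add: image_Un[symmetric])
  have B: "finite B" "independent B" "span B = H" using B unfolding H_def .
  have "B \<subseteq> H" using B(3) span_superset[of B] by blast
  have spB: "span (insert v B) = span C"
  proof
    show "span (insert v B) \<subseteq> span C"
    proof (rule span_minimal)
      have "H \<subseteq> span C" unfolding H_def c(2)[symmetric] by (rule span_mono) blast
      then show "insert v B \<subseteq> span C" using v(1) \<open>B \<subseteq> H\<close> by blast
    qed simp
    have "c \<in> span (insert v D)"
      using in_span_insert[of v c D] v c(2) unfolding H_def by simp
    moreover have "span (insert v D) \<subseteq> span (insert v B)"
    proof (rule span_minimal)
      have "D \<subseteq> span B" using B(3) span_superset[of D] unfolding H_def by blast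
      then show "insert v D \<subseteq> span (insert v B)"
        using span_mono[of B "insert v B"] span_base[of v "insert v B"] by auto
    qed simp
    ultimately have "insert c D \<subseteq> span (insert v B)"
      using span_superset[of "insert v D"] by blast
    then show "span C \<subseteq> span (insert v B)"
      unfolding c(2)[symmetric] by (rule span_minimal) simp
  qed
  have inside: "span (insert v B \<inter> V) = V" if "V \<in> \<U> \<union> \<W>" "V \<subseteq> H" for V
  proof -
    have "insert v B \<inter> V = B \<inter> (V \<inter> H)" "V \<inter> H = V" using v(2) that(2) by auto
    then show ?thesis using adapted[OF that(1)] by simp
  qed
  have "span (insert v B \<inter> V) = V" if V: "V \<in> \<U> \<union> \<W>" for V
  proof (cases "V \<subseteq> H")
    case True
    then show ?thesis using inside V by blast
  next
    case False
    show ?thesis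
    proof (cases "V = span C")
      case True
      then have "insert v B \<inter> V = insert v B"
        using span_superset[of "insert v B"] spB by blast
      then show ?thesis using spB True by simp
    next
      case False
      have "V0 \<subseteq> H" using D(4) unfolding H_def .
      \<comment> \<open>All proper members of the first flag lie in \<open>V0\<close>, hence in
        \<open>H\<close>. A proper subspace not contained in \<open>H\<close> therefore comes from
        the second flag and contains \<open>v\<close>.\<close>
      then have "V \<notin> \<P>" using above[of V] \<open>\<not> V \<subseteq> H\<close> by auto
      then have "V \<in> \<W>" using V False unfolding \<P>_def by auto
      then have vV: "v \<in> V" using v_in \<open>\<not> V \<subseteq> H\<close> by blast
      have subV: "subspace V" and VC: "V \<subseteq> span C" using sub V by auto
      show ?thesis
      proof
        show "span (insert v B \<inter> V) \<subseteq> V" using subV by (intro span_minimal) auto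
        show "V \<subseteq> span (insert v B \<inter> V)"
        proof
          fix w assume w: "w \<in> V"
          then have "w \<in> span (insert v B)" using VC spB by auto
          \<comment> \<open>Removing the \<open>v\<close> component moves \<open>w\<close> into
            \<open>V \<inter> H\<close>, where the basis \<open>B\<close> is already
            adapted.\<close>
          then obtain k where k: "w - k *s v \<in> H" using B(3) unfolding span_insert by blast
          have "w - k *s v \<in> V" using w vV subV by (simp add: subspace_diff subspace_scale)
          then have "w - k *s v \<in> span (B \<inter> (V \<inter> H))" using k adapted[OF V] by simp
          also have "\<dots> \<subseteq> span (insert v B \<inter> V)" by (rule span_mono) blast
          finally have "w - k *s v \<in> span (insert v B \<inter> V)" .
          moreover have "k *s v \<in> span (insert v B \<inter> V)"
            using vV by (intro span_scale span_base) auto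
          ultimately show "w \<in> span (insert v B \<inter> V)"
            using span_add[of "w - k *s v" _ "k *s v"] by simp
        qed
      qed
    qed
  qed
  moreover have "independent (insert v B)"
    using B v(2) by (intro independent_insertI) auto
  ultimately show ?case using B(1) spB by (intro exI[of _ "insert v B"]) auto
qed

lemma span_decompose:
  assumes "x \<in> span S" "S \<subseteq> A \<union> B"
  obtains a b where "a \<in> span A" "b \<in> span B" "x = a + b"
  using assms span_mono[OF assms(2)] unfolding span_Un by blast

text \<open>The coordinates of \<open>x\<close> with respect to \<open>S\<close> vanish outside
  \<open>A\<close> and also outside \<open>B\<close>, hence everywhere.\<close>

lemma span_Int_zero:
  assumes ind: "independent S" and "A \<subseteq> S" "B \<subseteq> S" "A \<inter> B = {}" and x: "x \<in> span A" "x \<in> span B"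
  shows "x = 0"
proof -
  have "representation S x = representation A x" "representation S x = representation B x"
    using representation_extend[OF ind x(1) \<open>A \<subseteq> S\<close>] representation_extend[OF ind x(2) \<open>B \<subseteq> S\<close>]
    by simp_all
  moreover have "representation A x v = 0 \<or> representation B x v = 0" for v
    using representation_ne_zero[of A x v] representation_ne_zero[of B x v] \<open>A \<inter> B = {}\<close> by auto
  ultimately have "representation A x v = 0" for v by metis
  moreover have "independent A" using ind \<open>A \<subseteq> S\<close> independent_mono by blast
  ultimately show ?thesis
    using sum_nonzero_representation_eq[of A x] x(1) by simp
qed

end

section \<open>Interval decompositions of quotients\<close>

lemma mem_coset_iff: "x \<in> z +o B \<longleftrightarrow> x - z \<in> B" for z :: "'a::ab_group_add"
  by (simp add: set_minus_plus[symmetric])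

lemma subspace_absorb:
  assumes "fs.subspace B'" "B \<subseteq> B'" "0 \<in> B"
  shows "B + B' = B'"
  using assms set_zero_plus2[of B B'] by (auto elim!: set_plus_elim intro: fs.subspace_add)

lemma coset_eq_iff:
  assumes "fs.subspace B"
  shows "z +o B = w +o B \<longleftrightarrow> z - w \<in> B"
proof
  assume "z +o B = w +o B"
  moreover have "z \<in> z +o B" unfolding mem_coset_iff using fs.subspace_0[OF assms] by simp
  ultimately show "z - w \<in> B" unfolding mem_coset_iff[symmetric] by blast
next
  assume *: "z - w \<in> B"
  have "x - z \<in> B \<longleftrightarrow> x - w \<in> B" for x
  proof
    assume "x - z \<in> B"
    then show "x - w \<in> B" using fs.subspace_add[OF assms _ *, of "x - z"] by simp
  next
    assume "x - w \<in> B"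
    then show "x - z \<in> B" using fs.subspace_diff[OF assms _ *, of "x - w"] by simp
  qed
  then show "z +o B = w +o B" unfolding set_eq_iff mem_coset_iff by blast
qed

lemma coset_plus_subspace:
  assumes "fs.subspace B" "fs.subspace B'" "B \<subseteq> B'"
  shows "(z +o B) + B' = z +o B'"
  unfolding set_plus_rearrange3 using assms by (simp add: subspace_absorb fs.subspace_0)

lemma coset_plus_coset:
  assumes "fs.subspace B"
  shows "(z +o B) + (w +o B) = (z + w) +o B"
  unfolding set_plus_rearrange using assms by (simp add: subspace_absorb fs.subspace_0)

text \<open>The image of a coset may be only a part of a coset of \<open>B'\<close>; adding
  \<open>B'\<close> fills it up. Scaling in a quotient and the maps induced between quotients both
  have this shape.\<close>

lemma linear_image_coset:
  fixes T :: "('i \<Rightarrow> 'k::field) \<Rightarrow> 'j \<Rightarrow> 'k"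
  assumes add: "\<And>x y. T (x + y) = T x + T y" and B: "fs.subspace B" and B': "fs.subspace B'"
    and "T ` B \<subseteq> B'"
  shows "T ` (z +o B) + B' = T z +o B'"
proof
  show "T ` (z +o B) + B' \<subseteq> T z +o B'"
  proof
    fix x assume "x \<in> T ` (z +o B) + B'"
    then obtain y b where y: "y - z \<in> B" "b \<in> B'" and x: "x = T y + b"
      by (auto elim!: set_plus_elim simp: mem_coset_iff)
    have "x - T z = T (y - z) + b"
      unfolding x using add[of "y - z" z] by simp
    also have "\<dots> \<in> B'"
      using B' y \<open>T ` B \<subseteq> B'\<close> by (intro fs.subspace_add) auto
    finally show "x \<in> T z +o B'" unfolding mem_coset_iff .
  qed
  show "T z +o B' \<subseteq> T ` (z +o B) + B'"
  proof (rule set_plus_mono3)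
    have "z \<in> z +o B" unfolding mem_coset_iff using fs.subspace_0[OF B] by simp
    then show "T z \<in> T ` (z +o B)" by blast
  qed
qed

lemma scale_coset:
  assumes B: "fs.subspace B"
  shows "fscale a ` (z +o B) + B = fscale a z +o B"
proof (rule linear_image_coset[OF _ B B])
  show "fscale a (x + y) = fscale a x + fscale a y" for x y
    by (simp add: fun_eq_iff distrib_left)
  show "fscale a ` B \<subseteq> B"
    using fs.subspace_scale[OF B] by blast
qed

text \<open>Persistent homology with the cycles and boundaries replaced by arbitrary families of
  subspaces, so that the decomposition is a matter of linear algebra alone.\<close>

definition quotient_pvspace ::
    "(real \<Rightarrow> ('i \<Rightarrow> 'k::field) set) \<Rightarrow> (real \<Rightarrow> ('i \<Rightarrow> 'k) set) \<Rightarrow> ('k, ('i \<Rightarrow> 'k) set) pvspace" where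
  "quotient_pvspace Z B = \<lparr>pspace = (\<lambda>\<delta>. quotient_space (Z \<delta>) (B \<delta>)), ptrans = (\<lambda>\<delta> \<delta>' C. C + B \<delta>')\<rparr>"

lemma quotient_space_simps [simp]:
  "vcarrier (quotient_space Z B) = (\<lambda>z. z +o B) ` Z"
  "vadd (quotient_space Z B) = (+)"
  "vscale (quotient_space Z B) a C = fscale a ` C + B"
  by (simp_all add: quotient_space_def)

lemma quotient_pvspace_simps [simp]:
  "pspace (quotient_pvspace Z B) \<delta> = quotient_space (Z \<delta>) (B \<delta>)"
  "ptrans (quotient_pvspace Z B) \<delta> \<delta>' C = C + B \<delta>'"
  by (simp_all add: quotient_pvspace_def)

lemma pvspace_closed_quotient:
  assumes Z: "\<And>\<delta>. fs.subspace (Z \<delta>)" and B: "\<And>\<delta>. fs.subspace (B \<delta>)"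
    and "\<And>\<delta> \<delta>'. \<delta> \<le> \<delta>' \<Longrightarrow> Z \<delta> \<subseteq> Z \<delta>'" and "\<And>\<delta> \<delta>'. \<delta> \<le> \<delta>' \<Longrightarrow> B \<delta> \<subseteq> B \<delta>'"
  shows "pvspace_closed (quotient_pvspace Z B)"
  unfolding pvspace_closed_def
proof (intro allI ballI conjI impI)
  fix \<delta> x assume "x \<in> vcarrier (pspace (quotient_pvspace Z B) \<delta>)"
  then obtain z where z: "z \<in> Z \<delta>" and x: "x = z +o B \<delta>" by auto
  show "vscale (pspace (quotient_pvspace Z B) \<delta>) a x \<in> vcarrier (pspace (quotient_pvspace Z B) \<delta>)" for a
    using fs.subspace_scale[OF Z z] by (simp add: x scale_coset[OF B])
  show "ptrans (quotient_pvspace Z B) \<delta> \<delta>' x \<in> vcarrier (pspace (quotient_pvspace Z B) \<delta>')"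
    if "\<delta> \<le> \<delta>'" for \<delta>'
    using z assms(3)[OF that] by (auto simp: x coset_plus_subspace[OF B B assms(4)[OF that]])
  fix y assume "y \<in> vcarrier (pspace (quotient_pvspace Z B) \<delta>)"
  then obtain w where w: "w \<in> Z \<delta>" and y: "y = w +o B \<delta>" by auto
  show "vadd (pspace (quotient_pvspace Z B) \<delta>) x y \<in> vcarrier (pspace (quotient_pvspace Z B) \<delta>)"
    using fs.subspace_add[OF Z z w] by (simp add: x y coset_plus_coset[OF B])
qed

text \<open>At each time the vectors of \<open>S\<close> in \<open>Z \<delta>\<close> but not in
  \<open>B \<delta>\<close> represent a basis of the quotient. A vector \<open>v\<close> belongs to
  this basis exactly while its interval \<open>p v\<close> is alive, so it spans one interval
  module; vectors with an empty interval never contribute.\<close>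

lemma is_persistence_diagram_quotient:
  fixes Z B :: "real \<Rightarrow> ('i \<Rightarrow> 'k::field) set" and p :: "('i \<Rightarrow> 'k) \<Rightarrow> ereal \<times> ereal"
  assumes S: "finite S" "fs.independent S"
    and Z: "\<And>\<delta>. fs.span (S \<inter> Z \<delta>) = Z \<delta>" and B: "\<And>\<delta>. fs.span (S \<inter> B \<delta>) = B \<delta>"
    and birth: "\<And>v \<delta>. v \<in> S \<Longrightarrow> v \<in> Z \<delta> \<longleftrightarrow> fst (p v) \<le> ereal \<delta>"
    and death: "\<And>v \<delta>. v \<in> S \<Longrightarrow> v \<in> B \<delta> \<longleftrightarrow> snd (p v) \<le> ereal \<delta>"
    and BZ: "\<And>\<delta>. B \<delta> \<subseteq> Z \<delta>"
  shows "is_persistence_diagram (quotient_pvspace Z B)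
    (image_mset p (mset_set {v \<in> S. fst (p v) < snd (p v)}))"
proof -
  have subZ: "fs.subspace (Z \<delta>)" and subB: "fs.subspace (B \<delta>)" for \<delta>
    using fs.subspace_span Z B by metis+
  have monoZ: "S \<inter> Z \<delta> \<subseteq> S \<inter> Z \<delta>'" and monoB: "S \<inter> B \<delta> \<subseteq> S \<inter> B \<delta>'" if "\<delta> \<le> \<delta>'" for \<delta> \<delta>'
    using birth death order_trans[OF _ ereal_less_eq(3)[THEN iffD2, OF that]] by auto
  have monoB': "B \<delta> \<subseteq> B \<delta>'" if "\<delta> \<le> \<delta>'" for \<delta> \<delta>'
    using fs.span_mono[OF monoB[OF that]] unfolding B .
  obtain ws where ws: "set ws = {v \<in> S. fst (p v) < snd (p v)}" "distinct ws"
    using finite_distinct_list[of "{v \<in> S. fst (p v) < snd (p v)}"] S(1) by auto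
  define n where "n = length ws"
  define D :: "('k, nat \<Rightarrow> 'k) pvspace" where "D = bar_sum (map p ws)"
  have bij: "bij_betw ((!) ws) {..<n} (set ws)"
    unfolding n_def using ws(2) by (intro bij_betw_nth) auto
  have ws_S: "ws ! i \<in> S" if "i < n" for i
    using that nth_mem[of i ws] ws(1) unfolding n_def by auto
  have alive: "\<delta> \<in> bar (p v) \<longleftrightarrow> v \<in> Z \<delta> \<and> v \<notin> B \<delta>" if "v \<in> S" for v \<delta>
    using birth[OF that] death[OF that] unfolding bar_def by (auto simp: not_le)
  have carrier: "vcarrier (pspace D \<delta>) =
      {f \<in> extensional {..<n}. \<forall>i<n. \<delta> \<notin> bar (p (ws ! i)) \<longrightarrow> f i = 0}" for \<delta>
    unfolding D_def vcarrier_bar_sum n_def by auto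
  have D_ops: "vadd (pspace D \<delta>) f g = (\<lambda>i\<in>{..<n}. f i + g i)"
    "vscale (pspace D \<delta>) a f = (\<lambda>i\<in>{..<n}. a * f i)"
    "ptrans D \<delta> \<delta>' f =
      (\<lambda>i\<in>{..<n}. if \<delta> \<in> bar (p (ws ! i)) \<and> \<delta>' \<in> bar (p (ws ! i)) then f i else 0)" for \<delta> \<delta>' f g a
    unfolding D_def pspace_bar_sum n_def by auto
  \<comment> \<open>Coordinates are read as the linear combination of the vectors \<open>ws\<close>;
    its coset is the image under the isomorphism.\<close>
  define L where "L f = (\<Sum>i<n. fscale (f i) (ws ! i))" for f :: "nat \<Rightarrow> 'k"
  have L_reindex: "L (\<lambda>i\<in>{..<n}. u (ws ! i)) = (\<Sum>v\<in>set ws. fscale (u v) v)" for u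
    unfolding L_def sum.reindex_bij_betw[OF bij, symmetric] by (intro sum.cong) auto
  have L_apply: "L f x = (\<Sum>i<n. f i * (ws ! i) x)" for f x
    unfolding L_def by (simp add: sum_fun_apply)
  have L_add: "L (\<lambda>i\<in>{..<n}. f i + g i) = L f + L g" for f g
    by (rule ext) (simp add: L_apply sum.distrib[symmetric] distrib_right)
  have L_diff: "L (\<lambda>i. f i - g i) = L f - L g" for f g
    by (rule ext) (simp add: L_apply sum_subtractf[symmetric] left_diff_distrib)
  have L_scale: "L (\<lambda>i\<in>{..<n}. a * f i) = fscale a (L f)" for a f
    by (rule ext) (simp add: L_apply sum_distrib_left mult.assoc)
  have L_inj: "c i = 0" if "L c = 0" "i < n" for c i
  proof -
    define u where "u v = c (the_inv_into {..<n} ((!) ws) v)" for v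
    have u: "u (ws ! j) = c j" if "j < n" for j
      unfolding u_def using bij that by (simp add: the_inv_into_f_f bij_betw_def)
    have "(\<Sum>v\<in>set ws. fscale (u v) v) = L c"
      unfolding L_def sum.reindex_bij_betw[OF bij, symmetric] by (intro sum.cong) (auto simp: u)
    then have "(\<Sum>v\<in>set ws. fscale (u v) v) = 0" using that by simp
    moreover have "fs.independent (set ws)"
      using fs.independent_mono[OF S(2)] ws(1) by auto
    moreover have "ws ! i \<in> set ws" using that(2) unfolding n_def by simp
    ultimately have "u (ws ! i) = 0"
      using fs.independentD[of "set ws" "set ws" u "ws ! i"] by auto
    then show ?thesis using u[OF that(2)] by simp
  qed
  \<comment> \<open>The vectors alive at \<open>\<delta>\<close>. They are disjoint from
    \<open>S \<inter> B \<delta>\<close>, which gives injectivity on cosets, and together with it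
    they cover \<open>S \<inter> Z \<delta>\<close>, which gives surjectivity.\<close>
  define A where "A \<delta> = {v \<in> set ws. \<delta> \<in> bar (p v)}" for \<delta>
  have A_sub: "A \<delta> \<subseteq> S \<inter> Z \<delta>" and A_disj: "A \<delta> \<inter> (S \<inter> B \<delta>) = {}" for \<delta>
    unfolding A_def using ws(1) alive by auto
  have L_span: "L f \<in> fs.span (A \<delta>)" if "\<And>i. i < n \<Longrightarrow> \<delta> \<notin> bar (p (ws ! i)) \<Longrightarrow> f i = 0" for f \<delta>
    unfolding L_def
  proof (rule fs.span_sum)
    fix i assume "i \<in> {..<n}"
    show "fscale (f i) (ws ! i) \<in> fs.span (A \<delta>)"
    proof (cases "\<delta> \<in> bar (p (ws ! i))")
      case True
      then have "ws ! i \<in> A \<delta>" using \<open>i \<in> {..<n}\<close> unfolding A_def n_def by simp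
      then show ?thesis by (intro fs.span_scale fs.span_base)
    next
      case False
      then have "fscale (f i) (ws ! i) = 0" using that \<open>i \<in> {..<n}\<close> by auto
      then show ?thesis by (simp only: fs.span_zero)
    qed
  qed
  have L_Z: "L f \<in> Z \<delta>" if "f \<in> vcarrier (pspace D \<delta>)" for f \<delta>
    using L_span[of \<delta> f] that fs.span_mono[OF A_sub[of \<delta>]] unfolding carrier Z by auto
  have "linear_iso (pspace D \<delta>) (pspace (quotient_pvspace Z B) \<delta>) (\<lambda>f. L f +o B \<delta>)" for \<delta>
    unfolding linear_iso_def
  proof (intro conjI ballI allI)
    show "L (vadd (pspace D \<delta>) f g) +o B \<delta> =
        vadd (pspace (quotient_pvspace Z B) \<delta>) (L f +o B \<delta>) (L g +o B \<delta>)" for f g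
      unfolding D_ops L_add by (simp add: coset_plus_coset[OF subB])
    show "L (vscale (pspace D \<delta>) a f) +o B \<delta> =
        vscale (pspace (quotient_pvspace Z B) \<delta>) a (L f +o B \<delta>)" for a f
      unfolding D_ops L_scale by (simp add: scale_coset[OF subB])
    show "bij_betw (\<lambda>f. L f +o B \<delta>) (vcarrier (pspace D \<delta>))
        (vcarrier (pspace (quotient_pvspace Z B) \<delta>))"
      unfolding bij_betw_def
    proof
      show "inj_on (\<lambda>f. L f +o B \<delta>) (vcarrier (pspace D \<delta>))"
      proof (rule inj_onI)
        fix f g assume f: "f \<in> vcarrier (pspace D \<delta>)" and g: "g \<in> vcarrier (pspace D \<delta>)"
          and "L f +o B \<delta> = L g +o B \<delta>"
        then have "L (\<lambda>i. f i - g i) \<in> fs.span (S \<inter> B \<delta>)"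
          unfolding L_diff B by (simp add: coset_eq_iff[OF subB])
        moreover have "L (\<lambda>i. f i - g i) \<in> fs.span (A \<delta>)"
          using f g unfolding carrier by (intro L_span) auto
        ultimately have "L (\<lambda>i. f i - g i) = 0"
          using fs.span_Int_zero[OF S(2) _ _ A_disj] A_sub by blast
        then have "f i = g i" if "i < n" for i
          using L_inj[OF _ that, of "\<lambda>i. f i - g i"] by simp
        then show "f = g"
          using f g unfolding carrier by (intro extensionalityI[of f "{..<n}"]) auto
      qed
      have "\<exists>f\<in>vcarrier (pspace D \<delta>). z +o B \<delta> = L f +o B \<delta>" if "z \<in> Z \<delta>" for z
      proof -
        have "S \<inter> Z \<delta> \<subseteq> A \<delta> \<union> (S \<inter> B \<delta>)"
        proof
          fix v assume v: "v \<in> S \<inter> Z \<delta>"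
          show "v \<in> A \<delta> \<union> (S \<inter> B \<delta>)"
          proof (cases "v \<in> B \<delta>")
            case False
            then have *: "\<delta> \<in> bar (p v)" using alive v by auto
            then have "fst (p v) < snd (p v)" unfolding bar_def by (auto intro: le_less_trans)
            then show ?thesis using * v ws(1) unfolding A_def by auto
          qed (use v in auto)
        qed
        moreover have "z \<in> fs.span (S \<inter> Z \<delta>)" unfolding Z by (rule that)
        ultimately obtain a b where ab: "a \<in> fs.span (A \<delta>)" "b \<in> fs.span (S \<inter> B \<delta>)" "z = a + b"
          using fs.span_decompose by metis
        have "finite (A \<delta>)" unfolding A_def by simp
        then obtain u where u: "a = (\<Sum>v\<in>A \<delta>. fscale (u v) v)"
          using ab(1) by (auto simp: fs.span_finite)
        define u' where "u' v = (if v \<in> A \<delta> then u v else 0)" for v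
        define f where "f = (\<lambda>i\<in>{..<n}. u' (ws ! i))"
        have "a = (\<Sum>v\<in>set ws. fscale (u' v) v)"
          unfolding u by (rule sum.mono_neutral_cong_left) (auto simp: A_def u'_def zero_fun_def)
        then have "a = L f" unfolding f_def L_reindex .
        moreover have "f \<in> vcarrier (pspace D \<delta>)"
          unfolding carrier f_def u'_def A_def by auto
        moreover have "z +o B \<delta> = a +o B \<delta>"
          using ab(2,3) by (simp add: coset_eq_iff[OF subB] B)
        ultimately show ?thesis by auto
      qed
      then show "(\<lambda>f. L f +o B \<delta>) ` vcarrier (pspace D \<delta>) =
          vcarrier (pspace (quotient_pvspace Z B) \<delta>)"
        unfolding quotient_pvspace_simps quotient_space_simps using L_Z by blast
    qed
  qed
  moreover have "L (ptrans D \<delta> \<delta>' f) +o B \<delta>' = ptrans (quotient_pvspace Z B) \<delta> \<delta>' (L f +o B \<delta>)"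
    if "\<delta> \<le> \<delta>'" and f: "f \<in> vcarrier (pspace D \<delta>)" for \<delta> \<delta>' f
  proof -
    let ?g = "ptrans D \<delta> \<delta>' f"
    have g: "?g = (\<lambda>i\<in>{..<n}. if \<delta> \<in> bar (p (ws ! i)) \<and> \<delta>' \<in> bar (p (ws ! i)) then f i else 0)"
      by (rule D_ops)
    \<comment> \<open>The transition erases only coordinates of vectors that have died by
      \<open>\<delta>'\<close>. These vectors lie in \<open>B \<delta>'\<close>, so the coset does
      not notice.\<close>
    have "L (\<lambda>i. ?g i - f i) \<in> B \<delta>'"
      unfolding L_def
    proof (rule fs.subspace_sum[OF subB])
      fix i assume i: "i \<in> {..<n}"
      then have v: "ws ! i \<in> S" using ws_S by simp
      show "fscale (?g i - f i) (ws ! i) \<in> B \<delta>'"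
      proof (cases "\<delta> \<in> bar (p (ws ! i)) \<and> \<delta>' \<notin> bar (p (ws ! i))")
        case True
        then have "ws ! i \<in> B \<delta>'" using alive[OF v] monoZ[OF \<open>\<delta> \<le> \<delta>'\<close>] v by auto
        then show ?thesis by (rule fs.subspace_scale[OF subB])
      next
        case False
        then have "?g i - f i = 0" using f i unfolding carrier g by auto
        then have "fscale (?g i - f i) (ws ! i) = 0" by (simp add: zero_fun_def)
        then show ?thesis using fs.subspace_0[OF subB] by (simp only:)
      qed
    qed
    then show ?thesis
      unfolding L_diff by (simp add: coset_plus_subspace[OF subB subB monoB'[OF \<open>\<delta> \<le> \<delta>'\<close>]]
          coset_eq_iff[OF subB])
  qed
  ultimately have "pvspace_iso D (quotient_pvspace Z B)"
    unfolding pvspace_iso_def by (intro exI[of _ "\<lambda>\<delta> f. L f +o B \<delta>"]) blast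
  then have "pvspace_iso (quotient_pvspace Z B) D"
    unfolding D_def by (rule pvspace_iso_sym[OF pvspace_closed_bar_sum])
  moreover have "mset (map p ws) = image_mset p (mset_set {v \<in> S. fst (p v) < snd (p v)})"
    unfolding ws(1)[symmetric] by (simp add: mset_set_set ws(2))
  ultimately show ?thesis
    unfolding is_persistence_diagram_def D_def using S(1) by (auto intro!: exI[of _ "map p ws"])
qed

section \<open>Alternating chains\<close>

text \<open>The sign rule of \<open>chains\<close> expressed by adjacent swaps, which generate all
  permutations. In this form it can be checked by pattern matching on lists, without permutation
  signs.\<close>

definition alternating :: "('a list \<Rightarrow> 'k::field) \<Rightarrow> bool" where
  "alternating c \<longleftrightarrow> (\<forall>us x y zs. c (us @ y # x # zs) = - c (us @ x # y # zs))"

lemma alternatingD: "alternating c \<Longrightarrow> c (us @ y # x # zs) = - c (us @ x # y # zs)"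
  unfolding alternating_def by blast

text \<open>Induction on the distance: moving one entry past \<open>m\<close> before the shorter
  swap and the other past \<open>m\<close> after it costs two signs, which cancel.\<close>

lemma alternating_swap:
  assumes "alternating c"
  shows "c (us @ y # ms @ x # zs) = - c (us @ x # ms @ y # zs)"
proof (induction ms arbitrary: us)
  case Nil
  show ?case using alternatingD[OF assms, of us y x zs] by simp
next
  case (Cons m ms)
  have "c (us @ y # (m # ms) @ x # zs) = - c ((us @ [m]) @ y # ms @ x # zs)"
    using alternatingD[OF assms, of us y m] by simp
  also have "\<dots> = c ((us @ [m]) @ x # ms @ y # zs)"
    using Cons.IH[of "us @ [m]"] by simp
  also have "\<dots> = - c (us @ x # (m # ms) @ y # zs)"
    using alternatingD[OF assms, of us m x] by simp
  finally show ?case .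
qed

lemma permute_list_transpose_less:
  assumes "i < j" "j < length xs"
  obtains us x ms y zs where "xs = us @ x # ms @ y # zs"
    "permute_list (Transposition.transpose i j) xs = us @ y # ms @ x # zs"
proof
  define us ms zs where "us = take i xs" and "ms = take (j - Suc i) (drop (Suc i) xs)"
    and "zs = drop (Suc j) xs"
  have "drop (Suc i) xs = ms @ xs ! j # zs"
    using assms id_take_nth_drop[of "j - Suc i" "drop (Suc i) xs"] unfolding ms_def zs_def by simp
  then show xs: "xs = us @ xs ! i # ms @ xs ! j # zs"
    using assms id_take_nth_drop[of i xs] unfolding us_def by simp
  have len: "length us = i" "length ms = j - Suc i" "length xs = Suc j + length zs"
    using assms by (auto simp: us_def ms_def zs_def)
  show "permute_list (Transposition.transpose i j) xs = us @ xs ! j # ms @ xs ! i # zs"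
  proof (rule nth_equalityI)
    show "length (permute_list (Transposition.transpose i j) xs) =
        length (us @ xs ! j # ms @ xs ! i # zs)"
      using len assms by simp
    fix l assume "l < length (permute_list (Transposition.transpose i j) xs)"
    then have l: "l < length xs" by simp
    have "permute_list (Transposition.transpose i j) xs ! l = xs ! Transposition.transpose i j l"
      using l by (simp add: permute_list_def)
    also have "\<dots> = (us @ xs ! j # ms @ xs ! i # zs) ! l"
    proof (cases "l = i \<or> l = j")
      case True
      then show ?thesis using len assms by (auto simp: nth_append)
    next
      case False
      then have "Transposition.transpose i j l = l" by (simp add: transpose_apply_other)
      moreover have "(us @ a # ms @ b # zs) ! l = (us @ a' # ms @ b' # zs) ! l" for a b a' b'
        using False len assms by (auto simp: nth_append nth_Cons split: nat.splits)
      ultimately show ?thesis using xs by metis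
    qed
    finally show "permute_list (Transposition.transpose i j) xs ! l =
        (us @ xs ! j # ms @ xs ! i # zs) ! l" .
  qed
qed

lemma alternating_transpose:
  assumes "alternating c" "i < length xs" "j < length xs" "i \<noteq> j"
  shows "c (permute_list (Transposition.transpose i j) xs) = - c xs"
proof -
  have *: "c (permute_list (Transposition.transpose i j) xs) = - c xs"
    if ij: "i < j" "j < length xs" for i j
  proof -
    obtain us x ms y zs where "xs = us @ x # ms @ y # zs"
      "permute_list (Transposition.transpose i j) xs = us @ y # ms @ x # zs"
      using permute_list_transpose_less[OF ij] .
    then show ?thesis using alternating_swap[OF assms(1), of us y ms x zs] by simp
  qed
  show ?thesis
  proof (cases "i < j")
    case True
    then show ?thesis using * assms(3) by blast
  next
    case False
    then show ?thesis
      using *[of j i] assms(2,4) unfolding transpose_commute[of i j] by linarith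
  qed
qed

text \<open>A permutation is built up from transpositions, each of which contributes the factor -1.
  The converse is the case of two adjacent positions.\<close>

lemma alternating_iff:
  fixes c :: "'a list \<Rightarrow> 'k::field"
  shows "alternating c \<longleftrightarrow>
    (\<forall>xs p. p permutes {..<length xs} \<longrightarrow> c (permute_list p xs) = of_int (sign p) * c xs)"
proof
  assume alt: "alternating c"
  have "c (permute_list p xs) = of_int (sign p) * c xs"
    if "length xs = n" "p permutes {..<n}" for n p xs
    using that(2) finite_lessThan that(1)
  proof (induction arbitrary: xs rule: permutes_induct)
    case id
    then show ?case by simp
  next
    case (swap a b p)
    have tr: "Transposition.transpose a b permutes {..<length xs}"
      using swap by (intro permutes_swap_id) auto
    have "permutation p"
      by (rule permutes_imp_permutation[OF finite_lessThan \<open>p permutes {..<n}\<close>])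
    have "c (permute_list (Transposition.transpose a b \<circ> p) xs) =
        c (permute_list p (permute_list (Transposition.transpose a b) xs))"
      using swap by (simp add: permute_list_compose)
    also have "\<dots> = of_int (sign p) * c (permute_list (Transposition.transpose a b) xs)"
      using swap by simp
    also have "\<dots> = - of_int (sign p) * c xs"
      using swap alternating_transpose[OF alt, of a xs b] by simp
    also have "- of_int (sign p) = (of_int (sign (Transposition.transpose a b \<circ> p)) :: 'k)"
      using swap \<open>permutation p\<close> by (simp add: sign_compose permutation_swap_id sign_swap_id)
    finally show ?case .
  qed
  then show "\<forall>xs p. p permutes {..<length xs} \<longrightarrow> c (permute_list p xs) = of_int (sign p) * c xs"
    by blast
next
  assume perm: "\<forall>xs p. p permutes {..<length xs} \<longrightarrow> c (permute_list p xs) = of_int (sign p) * c xs"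
  show "alternating c"
    unfolding alternating_def
  proof (intro allI)
    fix us :: "'a list" and x y zs
    let ?i = "length us" and ?xs = "us @ x # y # zs"
    let ?p = "Transposition.transpose ?i (Suc ?i)"
    have p: "?p permutes {..<length ?xs}" by (rule permutes_swap_id) auto
    have "permute_list ?p ?xs = us @ y # x # zs"
    proof (rule nth_equalityI)
      fix l assume "l < length (permute_list ?p ?xs)"
      then have "permute_list ?p ?xs ! l = ?xs ! ?p l"
        unfolding length_permute_list by (rule permute_list_nth[OF p])
      also have "\<dots> = (us @ y # x # zs) ! l"
        by (cases "l = ?i"; cases "l = Suc ?i")
          (auto simp: nth_append nth_Cons transpose_apply_other split: nat.splits)
      finally show "permute_list ?p ?xs ! l = (us @ y # x # zs) ! l" .
    qed simp
    then show "c (us @ y # x # zs) = - c (us @ x # y # zs)"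
      using perm[rule_format, OF p] by (simp add: sign_swap_id)
  qed
qed

lemma chains_iff:
  assumes "finite X" "K \<subseteq> Pow X"
  shows "c \<in> chains K k \<longleftrightarrow>
    (\<forall>xs. c xs \<noteq> 0 \<longrightarrow> length xs = Suc k \<and> distinct xs \<and> set xs \<in> K) \<and> alternating c"
proof -
  have "finite {xs. c xs \<noteq> 0}"
    if "\<forall>xs. c xs \<noteq> 0 \<longrightarrow> length xs = Suc k \<and> distinct xs \<and> set xs \<in> K"
  proof (rule finite_subset[OF _ finite_lists_length_eq[OF assms(1), of "Suc k"]])
    show "{xs. c xs \<noteq> 0} \<subseteq> {xs. set xs \<subseteq> X \<and> length xs = Suc k}"
      using that assms(2) by blast
  qed
  then show ?thesis unfolding chains_def alternating_iff by blast
qed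

section \<open>Complexes on a finite vertex set and their boundary maps\<close>

definition complex_on :: "'a set \<Rightarrow> 'a set set \<Rightarrow> bool" where
  "complex_on X K \<longleftrightarrow> finite X \<and> K \<subseteq> Pow X \<and> (\<forall>\<sigma>\<in>K. \<forall>\<tau>\<subseteq>\<sigma>. \<tau> \<noteq> {} \<longrightarrow> \<tau> \<in> K)"

lemma complex_onD:
  assumes "complex_on X K"
  shows "finite X" "K \<subseteq> Pow X" "\<sigma> \<in> K \<Longrightarrow> \<tau> \<subseteq> \<sigma> \<Longrightarrow> \<tau> \<noteq> {} \<Longrightarrow> \<tau> \<in> K"
  using assms unfolding complex_on_def by auto

text \<open>The sum runs over a fixed vertex set instead of the support of \<open>c\<close>, which
  makes the boundary visibly linear in \<open>c\<close>.\<close>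

definition boundary_on :: "'a set \<Rightarrow> ('a list \<Rightarrow> 'k::field) \<Rightarrow> 'a list \<Rightarrow> 'k" where
  "boundary_on X c = (\<lambda>ys. if ys = [] then 0 else \<Sum>v\<in>X. c (v # ys))"

lemma boundary_on_linear:
  "boundary_on X (c + d) = boundary_on X c + boundary_on X d"
  "boundary_on X (c - d) = boundary_on X c - boundary_on X d"
  "boundary_on X (fscale a c) = fscale a (boundary_on X c)"
  "boundary_on X 0 = 0"
  by (auto simp: boundary_on_def fun_eq_iff sum.distrib sum_subtractf sum_distrib_left)

lemma boundary_eq_boundary_on:
  assumes "finite X" "\<And>xs. c xs \<noteq> 0 \<Longrightarrow> set xs \<subseteq> X"
  shows "boundary c = boundary_on X c"
proof
  fix ys
  have "(\<Sum>v | c (v # ys) \<noteq> 0. c (v # ys)) = (\<Sum>v\<in>X. c (v # ys))"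
    using assms(2)[of "_ # ys"] by (intro sum.mono_neutral_left assms(1)) auto
  then show "boundary c ys = boundary_on X c ys"
    unfolding boundary_def boundary_on_def by simp
qed

lemma boundary_chain_eq:
  assumes "finite X" "K \<subseteq> Pow X" "c \<in> chains K k"
  shows "boundary c = boundary_on X c"
proof (rule boundary_eq_boundary_on[OF assms(1)])
  show "set xs \<subseteq> X" if "c xs \<noteq> 0" for xs
    using assms(2,3) that unfolding chains_def by blast
qed

text \<open>Adding an element contributes a row and a column that cancel. The vanishing diagonal is
  a separate hypothesis because in characteristic 2 antisymmetry does not imply it.\<close>

lemma sum_alternating_eq_0:
  fixes g :: "'a \<Rightarrow> 'a \<Rightarrow> 'b::ab_group_add"
  assumes "finite X" "\<And>v w. g v w = - g w v" "\<And>v. g v v = 0"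
  shows "(\<Sum>v\<in>X. \<Sum>w\<in>X. g v w) = 0"
  using assms(1)
proof induction
  case (insert a X)
  have "(\<Sum>v\<in>X. g v a) = - (\<Sum>w\<in>X. g a w)"
    unfolding sum_negf[symmetric] by (intro sum.cong assms refl)
  then show ?case using insert assms(3) by (simp add: sum.distrib)
qed simp

lemma boundary_on_chain:
  assumes K: "complex_on X K" and c: "c \<in> chains K (Suc k)"
  shows "boundary_on X c \<in> chains K k"
proof -
  note X = complex_onD(1,2)[OF K]
  note c = c[unfolded chains_iff[OF X]]
  show ?thesis
    unfolding chains_iff[OF X]
  proof (intro conjI allI impI)
    fix ys assume nz: "boundary_on X c ys \<noteq> 0"
    then have "ys \<noteq> []" by (auto simp: boundary_on_def)
    moreover have "\<exists>v\<in>X. c (v # ys) \<noteq> 0"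
      using nz unfolding boundary_on_def by (metis (mono_tags, lifting) sum.neutral)
    ultimately obtain v where "v \<in> X" "c (v # ys) \<noteq> 0" "ys \<noteq> []" by blast
    then have *: "length (v # ys) = Suc (Suc k)" "distinct (v # ys)" "set (v # ys) \<in> K"
      using c by blast+
    then show "length ys = Suc k" "distinct ys" by auto
    show "set ys \<in> K"
      using complex_onD(3)[OF K *(3), of "set ys"] \<open>ys \<noteq> []\<close> by auto
  next
    show "alternating (boundary_on X c)"
      unfolding alternating_def
    proof (intro allI)
      fix us x y zs
      have "c (v # us @ y # x # zs) = - c (v # us @ x # y # zs)" for v
        using alternatingD[of c "v # us" y x zs] c by simp
      then have "(\<Sum>v\<in>X. c (v # us @ y # x # zs)) = - (\<Sum>v\<in>X. c (v # us @ x # y # zs))"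
        unfolding sum_negf[symmetric] by (rule sum.cong[OF refl])
      then show "boundary_on X c (us @ y # x # zs) = - boundary_on X c (us @ x # y # zs)"
        unfolding boundary_on_def by simp
    qed
  qed
qed

text \<open>Two distinct heads occur in both orders with opposite signs, and a repeated head gives a
  list with repetition, on which a chain vanishes.\<close>

lemma boundary_on_boundary_on:
  assumes K: "complex_on X K" and c: "c \<in> chains K k"
  shows "boundary_on X (boundary_on X c) = 0"
proof
  fix ys
  note X = complex_onD(1,2)[OF K]
  note c = c[unfolded chains_iff[OF X]]
  have "(\<Sum>v\<in>X. \<Sum>w\<in>X. c (w # v # ys)) = 0"
  proof (rule sum_alternating_eq_0[OF X(1)])
    show "c (w # v # ys) = - c (v # w # ys)" for v w
      using alternatingD[of c "[]" w v ys] c by simp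
    show "c (v # v # ys) = 0" for v
      using c by (metis distinct_length_2_or_more)
  qed
  then show "boundary_on X (boundary_on X c) ys = 0 ys"
    by (simp add: boundary_on_def)
qed

lemma subspace_chains:
  assumes "finite X" "K \<subseteq> Pow X"
  shows "fs.subspace (chains K k :: ('a list \<Rightarrow> 'k::field) set)"
proof (rule fs.subspaceI)
  show "0 \<in> chains K k"
    unfolding chains_iff[OF assms] by (simp add: alternating_def)
next
  fix c d :: "'a list \<Rightarrow> 'k" assume c: "c \<in> chains K k" and d: "d \<in> chains K k"
  note c = c[unfolded chains_iff[OF assms]] and d = d[unfolded chains_iff[OF assms]]
  have "c xs \<noteq> 0 \<or> d xs \<noteq> 0" if "(c + d) xs \<noteq> 0" for xs using that by auto
  moreover have "alternating (c + d)"
    unfolding alternating_def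
  proof (intro allI)
    show "(c + d) (us @ y # x # zs) = - (c + d) (us @ x # y # zs)" for us x y zs
      using alternatingD[of c us y x zs] alternatingD[of d us y x zs] c d by simp
  qed
  ultimately show "c + d \<in> chains K k"
    using c d unfolding chains_iff[OF assms] by blast
next
  fix a and c :: "'a list \<Rightarrow> 'k" assume c: "c \<in> chains K k"
  note c = c[unfolded chains_iff[OF assms]]
  have "alternating (fscale a c)"
    unfolding alternating_def
  proof (intro allI)
    show "a * c (us @ y # x # zs) = - (a * c (us @ x # y # zs))" for us x y zs
      using alternatingD[of c us y x zs] c by simp
  qed
  moreover have "c xs \<noteq> 0" if "a * c xs \<noteq> 0" for xs using that by auto
  ultimately show "fscale a c \<in> chains K k"
    using c unfolding chains_iff[OF assms] by blast
qed

lemma cycles_eq: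
  assumes "finite X" "K \<subseteq> Pow X"
  shows "cycles K k = {c \<in> chains K k :: ('a list \<Rightarrow> 'k::field) set. boundary_on X c = 0}"
proof -
  have "boundary c = boundary_on X c" if "c \<in> chains K k" for c :: "'a list \<Rightarrow> 'k"
    using boundary_chain_eq[OF assms that] .
  then show ?thesis unfolding cycles_def by auto
qed

lemma boundaries_eq:
  assumes "finite X" "K \<subseteq> Pow X"
  shows "boundaries K k = boundary_on X ` chains K (Suc k)"
  unfolding boundaries_def using boundary_chain_eq[OF assms] by (intro image_cong) auto

lemma subspace_cycles:
  assumes "finite X" "K \<subseteq> Pow X"
  shows "fs.subspace (cycles K k)"
  using subspace_chains[OF assms, of k] unfolding cycles_eq[OF assms]
  by (auto simp: fs.subspace_def boundary_on_linear)

lemma subspace_boundaries: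
  assumes "finite X" "K \<subseteq> Pow X"
  shows "fs.subspace (boundaries K k)"
  unfolding boundaries_eq[OF assms]
proof (rule fs.subspaceI)
  note sub = subspace_chains[OF assms, of "Suc k"]
  show "0 \<in> boundary_on X ` chains K (Suc k)"
    using fs.subspace_0[OF sub] boundary_on_linear(4) by (metis imageI)
  show "x + y \<in> boundary_on X ` chains K (Suc k)"
    if xy: "x \<in> boundary_on X ` chains K (Suc k)" "y \<in> boundary_on X ` chains K (Suc k)" for x y
  proof -
    obtain c d where cd: "c \<in> chains K (Suc k)" "d \<in> chains K (Suc k)"
      and "x = boundary_on X c" "y = boundary_on X d" using xy by blast
    then have "x + y = boundary_on X (c + d)" by (simp only: boundary_on_linear)
    then show ?thesis using fs.subspace_add[OF sub cd] by blast
  qed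
  show "fscale a x \<in> boundary_on X ` chains K (Suc k)"
    if x: "x \<in> boundary_on X ` chains K (Suc k)" for a x
  proof -
    obtain c where c: "c \<in> chains K (Suc k)" and "x = boundary_on X c" using x by blast
    then have "fscale a x = boundary_on X (fscale a c)" by (simp only: boundary_on_linear)
    then show ?thesis using fs.subspace_scale[OF sub c] by blast
  qed
qed

lemma boundaries_subset_cycles:
  assumes "complex_on X K"
  shows "boundaries K k \<subseteq> cycles K k"
  using boundary_on_chain[OF assms] boundary_on_boundary_on[OF assms]
  unfolding boundaries_eq[OF complex_onD(1,2)[OF assms]] cycles_eq[OF complex_onD(1,2)[OF assms]]
  by auto

lemma chains_mono: "K \<subseteq> L \<Longrightarrow> chains K k \<subseteq> chains L k"
  unfolding chains_def by blast

lemma cycles_mono: "K \<subseteq> L \<Longrightarrow> cycles K k \<subseteq> cycles L k"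
  unfolding cycles_def using chains_mono by blast

lemma boundaries_mono: "K \<subseteq> L \<Longrightarrow> boundaries K k \<subseteq> boundaries L k"
  unfolding boundaries_def using chains_mono by blast

lemma chains_subset_span:
  assumes "finite X" "K \<subseteq> Pow X"
  shows "chains K k \<subseteq> fs.span (unit_fun ` {xs. set xs \<subseteq> X \<and> length xs = Suc k})"
proof
  fix c assume "c \<in> chains K k"
  then have "c xs = 0" if "xs \<notin> {xs. set xs \<subseteq> X \<and> length xs = Suc k}" for xs
    using that assms(2) unfolding chains_iff[OF assms] by blast
  then show "c \<in> fs.span (unit_fun ` {xs. set xs \<subseteq> X \<and> length xs = Suc k})"
    unfolding span_unit_fun[OF finite_lists_length_eq[OF assms(1)]] by blast
qed

lemma persistent_homology_eq:
  "persistent_homology F k = quotient_pvspace (\<lambda>\<delta>. cycles (F \<delta>) k) (\<lambda>\<delta>. boundaries (F \<delta>) k)"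
  unfolding persistent_homology_def quotient_pvspace_def homology_def ..

definition filtration_on :: "'a set \<Rightarrow> (real \<Rightarrow> 'a set set) \<Rightarrow> bool" where
  "filtration_on X F \<longleftrightarrow> (\<forall>\<delta>. complex_on X (F \<delta>)) \<and> mono F"

lemma pvspace_closed_persistent_homology:
  assumes "filtration_on X F"
  shows "pvspace_closed (persistent_homology F k :: ('k::field, ('a list \<Rightarrow> 'k) set) pvspace)"
proof -
  have "finite X" "F \<delta> \<subseteq> Pow X" for \<delta>
    using assms complex_onD(1,2) unfolding filtration_on_def by blast+
  moreover have "F \<delta> \<subseteq> F \<delta>'" if "\<delta> \<le> \<delta>'" for \<delta> \<delta>'
    using assms that unfolding filtration_on_def by (auto dest: monoD)
  ultimately show ?thesis
    unfolding persistent_homology_eq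
    by (intro pvspace_closed_quotient subspace_cycles subspace_boundaries cycles_mono boundaries_mono)
qed

section \<open>Stability for sublevel filtrations\<close>

definition sublevel :: "'a set set \<Rightarrow> ('a set \<Rightarrow> real) \<Rightarrow> real \<Rightarrow> 'a set set" where
  "sublevel S f \<delta> = {\<sigma> \<in> S. f \<sigma> \<le> \<delta>}"

text \<open>The value is \<open>\<infinity>\<close> if \<open>Q\<close> holds for no sublevel complex.\<close>

definition entry :: "'a set set \<Rightarrow> ('a set \<Rightarrow> real) \<Rightarrow> ('a set set \<Rightarrow> bool) \<Rightarrow> ereal" where
  "entry S f Q = (INF \<delta>\<in>{\<delta>. Q (sublevel S f \<delta>)}. ereal \<delta>)"

text \<open>The infimum is attained: no new simplex appears between \<open>\<delta>\<close> and the
  next value of \<open>f\<close>, so a property that fails at \<open>\<delta>\<close> fails on a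
  whole interval to its right.\<close>

lemma entry_le_iff:
  assumes "finite S" and mono: "\<And>K L. K \<subseteq> L \<Longrightarrow> Q K \<Longrightarrow> Q L"
  shows "Q (sublevel S f \<delta>) \<longleftrightarrow> entry S f Q \<le> ereal \<delta>"
proof
  assume "Q (sublevel S f \<delta>)"
  then show "entry S f Q \<le> ereal \<delta>"
    unfolding entry_def by (intro INF_lower) simp
next
  assume le: "entry S f Q \<le> ereal \<delta>"
  show "Q (sublevel S f \<delta>)"
  proof (rule ccontr)
    assume not: "\<not> Q (sublevel S f \<delta>)"
    \<comment> \<open>The element \<open>\<delta> + 1\<close> covers the case that no value of
      \<open>f\<close> exceeds \<open>\<delta>\<close>.\<close>
    define d where "d = Min (insert (\<delta> + 1) {x \<in> f ` S. \<delta> < x})"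
    have "\<delta> < d" unfolding d_def using assms(1) by simp
    have "d \<le> \<delta>'" if "Q (sublevel S f \<delta>')" for \<delta>'
    proof (rule ccontr)
      assume "\<not> d \<le> \<delta>'"
      have "sublevel S f \<delta>' \<subseteq> sublevel S f \<delta>"
      proof
        fix \<sigma> assume "\<sigma> \<in> sublevel S f \<delta>'"
        then have \<sigma>: "\<sigma> \<in> S" "f \<sigma> < d" using \<open>\<not> d \<le> \<delta>'\<close> unfolding sublevel_def by auto
        have "f \<sigma> \<le> \<delta>"
        proof (rule ccontr)
          assume "\<not> f \<sigma> \<le> \<delta>"
          then have "d \<le> f \<sigma>" unfolding d_def using assms(1) \<sigma>(1) by (intro Min_le) auto
          then show False using \<sigma>(2) by simp
        qed
        then show "\<sigma> \<in> sublevel S f \<delta>" using \<sigma>(1) unfolding sublevel_def by simp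
      qed
      then show False using mono that not by blast
    qed
    then have "ereal d \<le> entry S f Q"
      unfolding entry_def by (intro INF_greatest) simp
    then have "ereal d \<le> ereal \<delta>" using le by (rule order_trans)
    then show False using \<open>\<delta> < d\<close> by simp
  qed
qed

lemma coord_dist_leI:
  assumes "x \<le> y + ereal e" "y \<le> x + ereal e" "0 \<le> e"
  shows "coord_dist x y \<le> ereal e"
  using assms by (cases x; cases y) (auto simp: coord_dist_def)

text \<open>Every sublevel complex of \<open>f\<close> lies in the sublevel complex of
  \<open>g\<close> at the level raised by \<open>e\<close>, and \<open>Q\<close> passes to larger
  complexes.\<close>

lemma entry_le_entry_plus:
  assumes near: "\<And>\<sigma>. \<sigma> \<in> S \<Longrightarrow> g \<sigma> \<le> f \<sigma> + e" and mono: "\<And>K L. K \<subseteq> L \<Longrightarrow> Q K \<Longrightarrow> Q L"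
  shows "entry S g Q \<le> entry S f Q + ereal e"
proof -
  have "entry S g Q - ereal e \<le> ereal \<delta>" if "Q (sublevel S f \<delta>)" for \<delta>
  proof -
    have "sublevel S f \<delta> \<subseteq> sublevel S g (\<delta> + e)"
      using near unfolding sublevel_def by force
    then have "Q (sublevel S g (\<delta> + e))" using mono that by blast
    then have "entry S g Q \<le> ereal (\<delta> + e)" unfolding entry_def by (intro INF_lower) simp
    then show ?thesis by (cases "entry S g Q") auto
  qed
  then have "entry S g Q - ereal e \<le> entry S f Q"
    unfolding entry_def[of S f] by (intro INF_greatest) simp
  then show ?thesis by (cases "entry S g Q"; cases "entry S f Q") auto
qed

lemma coord_dist_entry_le:
  assumes near: "\<And>\<sigma>. \<sigma> \<in> S \<Longrightarrow> \<bar>f \<sigma> - g \<sigma>\<bar> \<le> e" and "0 \<le> e"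
    and mono: "\<And>K L. K \<subseteq> L \<Longrightarrow> Q K \<Longrightarrow> Q L"
  shows "coord_dist (entry S f Q) (entry S g Q) \<le> ereal e"
proof (rule coord_dist_leI[OF _ _ \<open>0 \<le> e\<close>])
  have *: "f \<sigma> \<le> g \<sigma> + e" "g \<sigma> \<le> f \<sigma> + e" if "\<sigma> \<in> S" for \<sigma>
    using near[OF that] by auto
  show "entry S f Q \<le> entry S g Q + ereal e"
    by (rule entry_le_entry_plus[OF *(1) mono])
  show "entry S g Q \<le> entry S f Q + ereal e"
    by (rule entry_le_entry_plus[OF *(2) mono])
qed

section \<open>Filtrations by functions that increase with faces\<close>

definition face_monotone :: "'a set set \<Rightarrow> ('a set \<Rightarrow> real) \<Rightarrow> bool" where
  "face_monotone S f \<longleftrightarrow> (\<forall>\<sigma>\<in>S. \<forall>\<tau>\<subseteq>\<sigma>. \<tau> \<noteq> {} \<longrightarrow> f \<tau> \<le> f \<sigma>)"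

lemma filtration_on_sublevel:
  assumes S: "complex_on X S" and f: "face_monotone S f"
  shows "filtration_on X (sublevel S f)"
  unfolding filtration_on_def
proof (intro conjI allI monoI)
  fix \<delta>
  show "complex_on X (sublevel S f \<delta>)"
    unfolding complex_on_def
  proof (intro conjI ballI allI impI)
    fix \<sigma> \<tau> assume \<sigma>: "\<sigma> \<in> sublevel S f \<delta>" "\<tau> \<subseteq> \<sigma>" "\<tau> \<noteq> {}"
    then have "\<tau> \<in> S" "f \<tau> \<le> f \<sigma>"
      using complex_onD(3)[OF S] f unfolding face_monotone_def sublevel_def by blast+
    then show "\<tau> \<in> sublevel S f \<delta>" using \<sigma>(1) unfolding sublevel_def by simp
  qed (use complex_onD(1,2)[OF S] in \<open>auto simp: sublevel_def\<close>)
next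
  show "sublevel S f x \<subseteq> sublevel S f y" if "x \<le> y" for x y
    using that unfolding sublevel_def by auto
qed

text \<open>A sublevel set of \<open>g\<close> is closed downwards in the order given by
  \<open>f\<close>, so it is the sublevel set of \<open>f\<close> at the largest value that
  \<open>f\<close> takes on it.\<close>

lemma sublevel_coarser:
  assumes "finite S" and coarser: "\<And>\<sigma> \<tau>. \<sigma> \<in> S \<Longrightarrow> \<tau> \<in> S \<Longrightarrow> f \<sigma> \<le> f \<tau> \<Longrightarrow> g \<sigma> \<le> g \<tau>"
  shows "\<exists>\<delta>'. sublevel S g \<delta> = sublevel S f \<delta>'"
proof -
  \<comment> \<open>A level below all values of \<open>f\<close>, used when the sublevel set of
    \<open>g\<close> is empty; the 0 keeps the minimum defined for empty \<open>S\<close>.\<close>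
  define m where "m = Min (insert 0 (f ` S)) - 1"
  have m: "m < f \<sigma>" if "\<sigma> \<in> S" for \<sigma>
  proof -
    have "Min (insert 0 (f ` S)) \<le> f \<sigma>" using that assms(1) by (intro Min_le) auto
    then show ?thesis unfolding m_def by simp
  qed
  define \<delta>' where "\<delta>' = Max (insert m (f ` sublevel S g \<delta>))"
  have fin: "finite (f ` sublevel S g \<delta>)" using assms(1) unfolding sublevel_def by simp
  have "sublevel S g \<delta> \<subseteq> sublevel S f \<delta>'"
  proof
    fix \<sigma> assume \<sigma>: "\<sigma> \<in> sublevel S g \<delta>"
    then have "f \<sigma> \<le> \<delta>'" unfolding \<delta>'_def using fin by (intro Max_ge) auto
    then show "\<sigma> \<in> sublevel S f \<delta>'" using \<sigma> unfolding sublevel_def by simp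
  qed
  moreover have "sublevel S f \<delta>' \<subseteq> sublevel S g \<delta>"
  proof
    fix \<sigma> assume \<sigma>: "\<sigma> \<in> sublevel S f \<delta>'"
    have "\<delta>' \<in> insert m (f ` sublevel S g \<delta>)" unfolding \<delta>'_def using fin by (intro Max_in) auto
    moreover have "\<delta>' \<noteq> m" using \<sigma> m unfolding sublevel_def by force
    ultimately obtain \<tau> where "\<tau> \<in> sublevel S g \<delta>" "\<delta>' = f \<tau>" by auto
    then show "\<sigma> \<in> sublevel S g \<delta>"
      using \<sigma> coarser[of \<sigma> \<tau>] unfolding sublevel_def by auto
  qed
  ultimately show ?thesis by blast
qed

text \<open>If \<open>g\<close> is coarser than \<open>f\<close>, every sublevel complex of \<open>g\<close> is one of \<open>f\<close>, so that a basis adapted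
  to the cycles and boundaries of the filtration by \<open>f\<close> is adapted to that by \<open>g\<close> as well.\<close>

lemma persistence_diagrams_near_if_coarser:
  fixes f g :: "'a set \<Rightarrow> real"
  assumes S: "complex_on X S" and f: "face_monotone S f" and g: "face_monotone S g"
    and coarser: "\<And>\<sigma> \<tau>. \<sigma> \<in> S \<Longrightarrow> \<tau> \<in> S \<Longrightarrow> f \<sigma> \<le> f \<tau> \<Longrightarrow> g \<sigma> \<le> g \<tau>"
    and near: "\<And>\<sigma>. \<sigma> \<in> S \<Longrightarrow> \<bar>f \<sigma> - g \<sigma>\<bar> \<le> e" and "0 \<le> e"
  shows "\<exists>D E. is_persistence_diagram
      (persistent_homology (sublevel S f) k :: ('k::field, ('a list \<Rightarrow> 'k) set) pvspace) D \<and>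
    is_persistence_diagram
      (persistent_homology (sublevel S g) k :: ('k, ('a list \<Rightarrow> 'k) set) pvspace) E \<and>
    near e D E"
proof -
  note X = complex_onD(1,2)[OF S]
  have "finite S" using X by (meson finite_Pow_iff finite_subset)
  define Z B :: "'a set set \<Rightarrow> ('a list \<Rightarrow> 'k) set"
    where "Z K = cycles K k" and "B K = boundaries K k" for K
  define C :: "('a list \<Rightarrow> 'k) set" where "C = unit_fun ` {xs. set xs \<subseteq> X \<and> length xs = Suc k}"
  have fin: "finite {xs. set xs \<subseteq> X \<and> length xs = Suc k}"
    by (rule finite_lists_length_eq[OF X(1)])
  have cx: "complex_on X (sublevel S h \<delta>)" if "face_monotone S h" for h \<delta>
    using filtration_on_sublevel[OF S that] unfolding filtration_on_def by blast
  have mono: "sublevel S h \<delta> \<subseteq> sublevel S h \<delta>'" if "\<delta> \<le> \<delta>'" for h \<delta> \<delta>'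
    using that unfolding sublevel_def by auto
  have BZ: "B (sublevel S h \<delta>) \<subseteq> Z (sublevel S h \<delta>)" if "face_monotone S h" for h \<delta>
    unfolding B_def Z_def by (rule boundaries_subset_cycles[OF cx[OF that]])
  have Z_span: "Z (sublevel S f \<delta>) \<subseteq> fs.span C" for \<delta>
    using chains_subset_span[OF complex_onD(1,2)[OF cx[OF f]]] unfolding Z_def C_def cycles_def
    by blast
  have "\<exists>A. finite A \<and> fs.independent A \<and> fs.span A = fs.span C \<and>
      (\<forall>V\<in>range (\<lambda>\<delta>. Z (sublevel S f \<delta>)) \<union> range (\<lambda>\<delta>. B (sublevel S f \<delta>)). fs.span (A \<inter> V) = V)"
  proof (rule fs.ex_adapted_basis)
    show "finite C" "fs.independent C"
      unfolding C_def using fin independent_unit_fun[OF fin] by simp_all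
    show "\<forall>V\<in>range (\<lambda>\<delta>. Z (sublevel S f \<delta>)) \<union> range (\<lambda>\<delta>. B (sublevel S f \<delta>)).
        fs.subspace V \<and> V \<subseteq> fs.span C"
      using subspace_cycles[OF complex_onD(1,2)[OF cx[OF f]]] subspace_boundaries[OF complex_onD(1,2)[OF cx[OF f]]]
        Z_span order_trans[OF BZ[OF f] Z_span] unfolding Z_def B_def by blast
    have chain: "\<forall>V\<in>range G. \<forall>W\<in>range G. V \<subseteq> W \<or> W \<subseteq> V"
      if "\<And>\<delta> \<delta>'. \<delta> \<le> \<delta>' \<Longrightarrow> G \<delta> \<subseteq> G \<delta>'" for G :: "real \<Rightarrow> ('a list \<Rightarrow> 'k) set"
    proof (intro ballI)
      fix V W assume V: "V \<in> range G" and W: "W \<in> range G"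
      obtain a where a: "V = G a" using V by blast
      obtain b where b: "W = G b" using W by blast
      show "V \<subseteq> W \<or> W \<subseteq> V"
        unfolding a b using that[of a b] that[of b a] linear[of a b] by blast
    qed
    show "\<forall>V\<in>range (\<lambda>\<delta>. Z (sublevel S f \<delta>)). \<forall>W\<in>range (\<lambda>\<delta>. Z (sublevel S f \<delta>)). V \<subseteq> W \<or> W \<subseteq> V"
      by (rule chain) (unfold Z_def, intro cycles_mono mono)
    show "\<forall>V\<in>range (\<lambda>\<delta>. B (sublevel S f \<delta>)). \<forall>W\<in>range (\<lambda>\<delta>. B (sublevel S f \<delta>)). V \<subseteq> W \<or> W \<subseteq> V"
      by (rule chain) (unfold B_def, intro boundaries_mono mono)
  qed
  then obtain A where A: "finite A" "fs.independent A"
    and adapted: "\<forall>V\<in>range (\<lambda>\<delta>. Z (sublevel S f \<delta>)) \<union> range (\<lambda>\<delta>. B (sublevel S f \<delta>)).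
      fs.span (A \<inter> V) = V"
    by (elim exE conjE)
  have adapted_f: "fs.span (A \<inter> Z (sublevel S f \<delta>)) = Z (sublevel S f \<delta>)"
      "fs.span (A \<inter> B (sublevel S f \<delta>)) = B (sublevel S f \<delta>)" for \<delta>
    by (rule adapted[rule_format], simp)+
  have adapted_g: "fs.span (A \<inter> Z (sublevel S g \<delta>)) = Z (sublevel S g \<delta>)"
      "fs.span (A \<inter> B (sublevel S g \<delta>)) = B (sublevel S g \<delta>)" for \<delta>
  proof -
    have "\<exists>\<delta>'. sublevel S g \<delta> = sublevel S f \<delta>'"
      by (rule sublevel_coarser[OF \<open>finite S\<close> coarser])
    then obtain \<delta>' where "sublevel S g \<delta> = sublevel S f \<delta>'" ..
    then show "fs.span (A \<inter> Z (sublevel S g \<delta>)) = Z (sublevel S g \<delta>)"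
      "fs.span (A \<inter> B (sublevel S g \<delta>)) = B (sublevel S g \<delta>)"
      using adapted_f[of \<delta>'] by simp_all
  qed
  \<comment> \<open>The birth and death of each vector of the one basis \<open>A\<close>, for either
    filtration: the entry into the cycles and into the boundaries.\<close>
  define p where "p h v = (entry S h (\<lambda>K. v \<in> Z K), entry S h (\<lambda>K. v \<in> B K))" for h v
  have monoZ: "v \<in> Z L" if "K \<subseteq> L" "v \<in> Z K" for K L v
    using cycles_mono[OF that(1)] that(2) unfolding Z_def by (rule subsetD)
  have monoB: "v \<in> B L" if "K \<subseteq> L" "v \<in> B K" for K L v
    using boundaries_mono[OF that(1)] that(2) unfolding B_def by (rule subsetD)
  define D where "D h = image_mset (p h) (mset_set {v \<in> A. fst (p h v) < snd (p h v)})" for h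
  \<comment> \<open>The vectors whose birth and death coincide, among them those that never become
    cycles, serve as diagonal padding. With them both diagrams are indexed by all of
    \<open>A\<close>, and the matching is the identity of \<open>A\<close>.\<close>
  define U where "U h = image_mset (p h) (mset_set {v \<in> A. \<not> fst (p h v) < snd (p h v)})" for h
  have D: "is_persistence_diagram
      (persistent_homology (sublevel S h) k :: ('k, ('a list \<Rightarrow> 'k) set) pvspace) (D h)"
    if h: "face_monotone S h" and "\<And>\<delta>. fs.span (A \<inter> Z (sublevel S h \<delta>)) = Z (sublevel S h \<delta>)"
      "\<And>\<delta>. fs.span (A \<inter> B (sublevel S h \<delta>)) = B (sublevel S h \<delta>)" for h
    unfolding persistent_homology_eq D_def Z_def[symmetric] B_def[symmetric]
  proof (rule is_persistence_diagram_quotient[OF A that(2,3)])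
    show "v \<in> Z (sublevel S h \<delta>) \<longleftrightarrow> fst (p h v) \<le> ereal \<delta>" for v \<delta>
      unfolding p_def fst_conv by (rule entry_le_iff[OF \<open>finite S\<close> monoZ])
    show "v \<in> B (sublevel S h \<delta>) \<longleftrightarrow> snd (p h v) \<le> ereal \<delta>" for v \<delta>
      unfolding p_def snd_conv by (rule entry_le_iff[OF \<open>finite S\<close> monoB])
    show "B (sublevel S h \<delta>) \<subseteq> Z (sublevel S h \<delta>)" for \<delta>
      by (rule BZ[OF h])
  qed
  have diag: "fst q = snd q" if qU: "q \<in># U h" and h: "face_monotone S h" for q h
  proof -
    obtain v where q: "q = p h v" and "\<not> fst (p h v) < snd (p h v)"
      using qU A(1) unfolding U_def by auto
    moreover have "fst (p h v) \<le> snd (p h v)"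
      unfolding p_def entry_def fst_conv snd_conv
      using BZ[OF h] by (intro INF_superset_mono) auto
    ultimately show ?thesis by simp
  qed
  have sum: "D h + U h = image_mset (p h) (mset_set A)" for h
  proof -
    have "mset_set {v \<in> A. fst (p h v) < snd (p h v)} + mset_set {v \<in> A. \<not> fst (p h v) < snd (p h v)}
        = mset_set ({v \<in> A. fst (p h v) < snd (p h v)} \<union> {v \<in> A. \<not> fst (p h v) < snd (p h v)})"
      using A(1) by (intro mset_set_Union[symmetric]) auto
    also have "{v \<in> A. fst (p h v) < snd (p h v)} \<union> {v \<in> A. \<not> fst (p h v) < snd (p h v)} = A"
      by blast
    finally show ?thesis unfolding D_def U_def image_mset_union[symmetric] by simp
  qed
  have "linf_dist (p f v) (p g v) \<le> ereal e" for v
    unfolding linf_dist_def p_def fst_conv snd_conv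
    using coord_dist_entry_le[where Q = "\<lambda>K. v \<in> Z K", OF near \<open>0 \<le> e\<close> monoZ]
      coord_dist_entry_le[where Q = "\<lambda>K. v \<in> B K", OF near \<open>0 \<le> e\<close> monoB]
    by (rule max.boundedI)
  then have "rel_mset (\<lambda>p q. linf_dist p q \<le> ereal e) (D f + U f) (D g + U g)"
    unfolding sum multiset.rel_map by (intro rel_mset_refl)
  then have "near e (D f) (D g)"
    unfolding near_def using diag f g by (intro exI[of _ "U f"] exI[of _ "U g"]) auto
  then show ?thesis
    using D[OF f adapted_f] D[OF g adapted_g] by blast
qed

definition sublevel_diagram ::
    "'k::field itself \<Rightarrow> nat \<Rightarrow> 'a set set \<Rightarrow> ('a set \<Rightarrow> real) \<Rightarrow> (ereal \<times> ereal) multiset" where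
  "sublevel_diagram _ k S f =
     persistence_diagram (persistent_homology (sublevel S f) k :: ('k, ('a list \<Rightarrow> 'k) set) pvspace)"

lemma is_persistence_diagram_sublevel_diagram:
  assumes S: "complex_on X S" and f: "face_monotone S f"
  shows "is_persistence_diagram
    (persistent_homology (sublevel S f) k :: ('k::field, ('a list \<Rightarrow> 'k) set) pvspace)
    (sublevel_diagram TYPE('k) k S f)"
proof -
  \<comment> \<open>Existence of a diagram is the comparison of \<open>f\<close> with
    itself.\<close>
  obtain D where D: "is_persistence_diagram
      (persistent_homology (sublevel S f) k :: ('k, ('a list \<Rightarrow> 'k) set) pvspace) D"
    using persistence_diagrams_near_if_coarser[OF S f f, of 0] by auto
  moreover have "sublevel_diagram TYPE('k) k S f = D"
    unfolding sublevel_diagram_def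
    by (rule persistence_diagram_eqI[OF pvspace_closed_persistent_homology[OF filtration_on_sublevel[OF S f]] D])
  ultimately show ?thesis by simp
qed

lemma sublevel_diagram_near_if_coarser:
  fixes f g :: "'a set \<Rightarrow> real"
  assumes S: "complex_on X S" and f: "face_monotone S f" and g: "face_monotone S g"
    and "\<And>\<sigma> \<tau>. \<sigma> \<in> S \<Longrightarrow> \<tau> \<in> S \<Longrightarrow> f \<sigma> \<le> f \<tau> \<Longrightarrow> g \<sigma> \<le> g \<tau>"
    and "\<And>\<sigma>. \<sigma> \<in> S \<Longrightarrow> \<bar>f \<sigma> - g \<sigma>\<bar> \<le> e" and "0 \<le> e"
  shows "near e (sublevel_diagram TYPE('k::field) k S f) (sublevel_diagram TYPE('k) k S g)"
proof -
  have "\<exists>D E. is_persistence_diagram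
      (persistent_homology (sublevel S f) k :: ('k, ('a list \<Rightarrow> 'k) set) pvspace) D \<and>
    is_persistence_diagram
      (persistent_homology (sublevel S g) k :: ('k, ('a list \<Rightarrow> 'k) set) pvspace) E \<and>
    near e D E"
    by (rule persistence_diagrams_near_if_coarser[OF assms])
  then obtain D E where D: "is_persistence_diagram
      (persistent_homology (sublevel S f) k :: ('k, ('a list \<Rightarrow> 'k) set) pvspace) D"
    and E: "is_persistence_diagram
      (persistent_homology (sublevel S g) k :: ('k, ('a list \<Rightarrow> 'k) set) pvspace) E"
    and near: "near e D E"
    by (elim exE conjE)
  have "sublevel_diagram TYPE('k) k S f = D"
    unfolding sublevel_diagram_def
    by (rule persistence_diagram_eqI[OF pvspace_closed_persistent_homology[OF filtration_on_sublevel[OF S f]] D])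
  moreover have "sublevel_diagram TYPE('k) k S g = E"
    unfolding sublevel_diagram_def
    by (rule persistence_diagram_eqI[OF pvspace_closed_persistent_homology[OF filtration_on_sublevel[OF S g]] E])
  ultimately show ?thesis using near by simp
qed

text \<open>A strict inequality at \<open>x\<close> survives nearby by continuity, and finitely many
  pairs share one radius. Leaving \<open>x\<close> may break ties but reverses no strict order, so
  the order at \<open>x\<close> is the coarser one.\<close>

lemma eventually_order_preserved:
  fixes f g :: "'a \<Rightarrow> real"
  assumes "finite S"
  obtains d where "d > 0"
    "\<And>t \<sigma> \<tau>. \<bar>t - x\<bar> < d \<Longrightarrow> \<sigma> \<in> S \<Longrightarrow> \<tau> \<in> S \<Longrightarrow>
      (1 - t) * f \<sigma> + t * g \<sigma> \<le> (1 - t) * f \<tau> + t * g \<tau> \<Longrightarrow>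
      (1 - x) * f \<sigma> + x * g \<sigma> \<le> (1 - x) * f \<tau> + x * g \<tau>"
proof -
  define h where "h t \<sigma> = (1 - t) * f \<sigma> + t * g \<sigma>" for t \<sigma>
  have "\<forall>q\<in>S \<times> S. \<forall>\<^sub>F t in nhds x. h t (fst q) \<le> h t (snd q) \<longrightarrow> h x (fst q) \<le> h x (snd q)"
  proof
    fix q assume "q \<in> S \<times> S"
    show "\<forall>\<^sub>F t in nhds x. h t (fst q) \<le> h t (snd q) \<longrightarrow> h x (fst q) \<le> h x (snd q)"
    proof (cases "h x (fst q) \<le> h x (snd q)")
      case False
      have tends: "((\<lambda>t. h t (fst q) - h t (snd q)) \<longlongrightarrow> h x (fst q) - h x (snd q)) (nhds x)"
        unfolding h_def by (intro tendsto_intros filterlim_ident)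
      have "\<forall>\<^sub>F t in nhds x. 0 < h t (fst q) - h t (snd q)"
        by (rule order_tendstoD(1)[OF tends]) (use False in simp)
      then show ?thesis by (rule eventually_mono) auto
    qed simp
  qed
  then have "\<forall>\<^sub>F t in nhds x. \<forall>q\<in>S \<times> S. h t (fst q) \<le> h t (snd q) \<longrightarrow> h x (fst q) \<le> h x (snd q)"
    using assms by (intro eventually_ball_finite) auto
  then obtain d where "d > 0" "\<And>t. dist t x < d \<Longrightarrow>
      \<forall>q\<in>S \<times> S. h t (fst q) \<le> h t (snd q) \<longrightarrow> h x (fst q) \<le> h x (snd q)"
    unfolding eventually_nhds_metric by blast
  then show ?thesis
    using that[of d] unfolding h_def dist_real_def by force
qed

text \<open>\<open>Bolzano\<close> is the bisection principle: a property of intervals that is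
  inherited under concatenation and holds for all short intervals around each point holds for
  \<open>[0, 1]\<close>. It takes the place of listing the parameters at which the order
  changes.\<close>

lemma sublevel_diagram_stability:
  assumes S: "complex_on X S" and f: "face_monotone S f" and g: "face_monotone S g"
    and near: "\<And>\<sigma>. \<sigma> \<in> S \<Longrightarrow> \<bar>f \<sigma> - g \<sigma>\<bar> \<le> e" and "0 \<le> e"
  shows "near e (sublevel_diagram TYPE('k::field) k S f) (sublevel_diagram TYPE('k) k S g)"
proof -
  have "finite S" using complex_onD(1,2)[OF S] by (meson finite_Pow_iff finite_subset)
  define h where "h t \<sigma> = (1 - t) * f \<sigma> + t * g \<sigma>" for t \<sigma>
  have h: "face_monotone S (h t)" if "0 \<le> t" "t \<le> 1" for t
    using f g that unfolding face_monotone_def h_def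
    by (auto intro!: add_mono mult_left_mono)
  have lip: "\<bar>h s \<sigma> - h t \<sigma>\<bar> \<le> \<bar>s - t\<bar> * e" if "\<sigma> \<in> S" for s t \<sigma>
  proof -
    have "h s \<sigma> - h t \<sigma> = (t - s) * (f \<sigma> - g \<sigma>)" unfolding h_def by (simp add: algebra_simps)
    then have "\<bar>h s \<sigma> - h t \<sigma>\<bar> = \<bar>s - t\<bar> * \<bar>f \<sigma> - g \<sigma>\<bar>"
      by (simp only: abs_mult abs_minus_commute[of t s])
    then show ?thesis using near[OF that] by (simp add: mult_left_mono)
  qed
  define D where "D t = sublevel_diagram TYPE('k) k S (h t)" for t
  \<comment> \<open>Short intervals around a point may stick out of \<open>[0, 1]\<close>, where
    \<open>h t\<close> is no longer a convex combination and can fail to be face monotone; the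
    premise excludes them.\<close>
  have "0 \<le> (0::real) \<and> (1::real) \<le> 1 \<longrightarrow> near ((1 - 0) * e) (D 0) (D 1)"
  proof (rule Bolzano[of 0 1 "\<lambda>a b. 0 \<le> a \<and> b \<le> 1 \<longrightarrow> near ((b - a) * e) (D a) (D b)"])
    fix a b c :: real
    assume ab: "0 \<le> a \<and> b \<le> 1 \<longrightarrow> near ((b - a) * e) (D a) (D b)" "a \<le> b"
      and bc: "0 \<le> b \<and> c \<le> 1 \<longrightarrow> near ((c - b) * e) (D b) (D c)" "b \<le> c"
    show "0 \<le> a \<and> c \<le> 1 \<longrightarrow> near ((c - a) * e) (D a) (D c)"
    proof
      assume "0 \<le> a \<and> c \<le> 1"
      then have "near ((b - a) * e + (c - b) * e) (D a) (D c)"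
        using ab bc \<open>0 \<le> e\<close> by (intro near_trans[of _ _ "D b"]) auto
      then show "near ((c - a) * e) (D a) (D c)" by (simp add: algebra_simps)
    qed
  next
    fix x :: real assume x: "0 \<le> x" "x \<le> 1"
    obtain d where "d > 0" and d: "\<And>t \<sigma> \<tau>. \<bar>t - x\<bar> < d \<Longrightarrow> \<sigma> \<in> S \<Longrightarrow> \<tau> \<in> S \<Longrightarrow>
        h t \<sigma> \<le> h t \<tau> \<Longrightarrow> h x \<sigma> \<le> h x \<tau>"
      using eventually_order_preserved[OF \<open>finite S\<close>, of x f g] unfolding h_def by metis
    have *: "near (\<bar>t - x\<bar> * e) (D t) (D x)" if "\<bar>t - x\<bar> < d" "0 \<le> t" "t \<le> 1" for t
      unfolding D_def
      using d[OF that(1)] lip \<open>0 \<le> e\<close>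
      by (intro sublevel_diagram_near_if_coarser[OF S h[OF that(2,3)] h[OF x]]) auto
    \<comment> \<open>The order at \<open>x\<close> is coarser than those at both ends, so the ends
      are compared through \<open>D x\<close>; the two costs add up exactly because \<open>x\<close>
      lies between \<open>a\<close> and \<open>b\<close>.\<close>
    have "near ((b - a) * e) (D a) (D b)"
      if "a \<le> x" "x \<le> b" "b - a < d" "0 \<le> a" "b \<le> 1" for a b
    proof -
      have "near (\<bar>a - x\<bar> * e) (D a) (D x)" "near (\<bar>b - x\<bar> * e) (D x) (D b)"
        using *[of a] near_commute[OF *[of b]] that x by auto
      then have "near (\<bar>a - x\<bar> * e + \<bar>b - x\<bar> * e) (D a) (D b)"
        using \<open>0 \<le> e\<close> by (intro near_trans) auto
      then show ?thesis using that by (simp add: algebra_simps)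
    qed
    then show "\<exists>d>0. \<forall>a b. a \<le> x \<and> x \<le> b \<and> b - a < d \<longrightarrow>
        0 \<le> a \<and> b \<le> 1 \<longrightarrow> near ((b - a) * e) (D a) (D b)"
      using \<open>d > 0\<close> by blast
  qed simp
  moreover have "h 0 = f" "h 1 = g" unfolding h_def by auto
  ultimately show ?thesis unfolding D_def by simp
qed

section \<open>Dominated vertices\<close>

text \<open>One linear map serves for all \<open>\<delta>\<close>, so naturality is immediate and
  only bijectivity on each quotient remains, split into \<open>inj\<close> and
  \<open>surj\<close>.\<close>

lemma pvspace_iso_quotient:
  fixes T :: "('i \<Rightarrow> 'k::field) \<Rightarrow> 'j \<Rightarrow> 'k"
  assumes add: "\<And>x y. T (x + y) = T x + T y" and scale: "\<And>a x. T (fscale a x) = fscale a (T x)"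
    and Z: "\<And>\<delta>. fs.subspace (Z \<delta>)" and B: "\<And>\<delta>. fs.subspace (B \<delta>)"
    and B': "\<And>\<delta>. fs.subspace (B' \<delta>)"
    and monoB: "\<And>\<delta> \<delta>'. \<delta> \<le> \<delta>' \<Longrightarrow> B \<delta> \<subseteq> B \<delta>'" and monoB': "\<And>\<delta> \<delta>'. \<delta> \<le> \<delta>' \<Longrightarrow> B' \<delta> \<subseteq> B' \<delta>'"
    and TZ: "\<And>\<delta>. T ` Z \<delta> \<subseteq> Z' \<delta>" and TB: "\<And>\<delta>. T ` B \<delta> \<subseteq> B' \<delta>"
    and inj: "\<And>\<delta> z. z \<in> Z \<delta> \<Longrightarrow> T z \<in> B' \<delta> \<Longrightarrow> z \<in> B \<delta>"
    and surj: "\<And>\<delta> z'. z' \<in> Z' \<delta> \<Longrightarrow> \<exists>z\<in>Z \<delta>. z' - T z \<in> B' \<delta>"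
  shows "pvspace_iso (quotient_pvspace Z B) (quotient_pvspace Z' B')"
proof -
  define \<phi> where "\<phi> \<delta> C = T ` C + B' \<delta>" for \<delta> C
  have \<phi>: "\<phi> \<delta> (z +o B \<delta>) = T z +o B' \<delta>" for \<delta> z
    unfolding \<phi>_def by (rule linear_image_coset[OF add B B' TB])
  have diff: "T (x - y) = T x - T y" for x y
    using add[of "x - y" y] by simp
  have "linear_iso (pspace (quotient_pvspace Z B) \<delta>) (pspace (quotient_pvspace Z' B') \<delta>) (\<phi> \<delta>)" for \<delta>
    unfolding linear_iso_def quotient_pvspace_simps quotient_space_simps
  proof (intro conjI ballI allI)
    show "bij_betw (\<phi> \<delta>) ((\<lambda>z. z +o B \<delta>) ` Z \<delta>) ((\<lambda>z. z +o B' \<delta>) ` Z' \<delta>)"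
      unfolding bij_betw_def
    proof
      show "inj_on (\<phi> \<delta>) ((\<lambda>z. z +o B \<delta>) ` Z \<delta>)"
      proof (rule inj_onI)
        fix C D assume "C \<in> (\<lambda>z. z +o B \<delta>) ` Z \<delta>" "D \<in> (\<lambda>z. z +o B \<delta>) ` Z \<delta>"
          and eq: "\<phi> \<delta> C = \<phi> \<delta> D"
        then obtain z w where z: "z \<in> Z \<delta>" "C = z +o B \<delta>" and w: "w \<in> Z \<delta>" "D = w +o B \<delta>" by blast
        have "T (z - w) \<in> B' \<delta>"
          using eq unfolding z w \<phi> coset_eq_iff[OF B'] diff .
        then have "z - w \<in> B \<delta>"
          by (rule inj[OF fs.subspace_diff[OF Z z(1) w(1)]])
        then show "C = D" unfolding z w coset_eq_iff[OF B] .
      qed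
      show "\<phi> \<delta> ` (\<lambda>z. z +o B \<delta>) ` Z \<delta> = (\<lambda>z. z +o B' \<delta>) ` Z' \<delta>"
      proof
        show "\<phi> \<delta> ` (\<lambda>z. z +o B \<delta>) ` Z \<delta> \<subseteq> (\<lambda>z. z +o B' \<delta>) ` Z' \<delta>"
          using TZ[of \<delta>] by (auto simp: \<phi>)
        show "(\<lambda>z. z +o B' \<delta>) ` Z' \<delta> \<subseteq> \<phi> \<delta> ` (\<lambda>z. z +o B \<delta>) ` Z \<delta>"
        proof (rule image_subsetI)
          fix z' assume "z' \<in> Z' \<delta>"
          then obtain z where z: "z \<in> Z \<delta>" "z' - T z \<in> B' \<delta>" using surj by blast
          then have "z' +o B' \<delta> = \<phi> \<delta> (z +o B \<delta>)" unfolding \<phi> coset_eq_iff[OF B'] by blast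
          then show "z' +o B' \<delta> \<in> \<phi> \<delta> ` (\<lambda>z. z +o B \<delta>) ` Z \<delta>" using z(1) by blast
        qed
      qed
    qed
  next
    fix C D assume "C \<in> (\<lambda>z. z +o B \<delta>) ` Z \<delta>" "D \<in> (\<lambda>z. z +o B \<delta>) ` Z \<delta>"
    then obtain z w where C: "C = z +o B \<delta>" and D: "D = w +o B \<delta>" by blast
    show "\<phi> \<delta> (C + D) = \<phi> \<delta> C + \<phi> \<delta> D"
      unfolding C D \<phi> coset_plus_coset[OF B] coset_plus_coset[OF B'] add ..
  next
    fix a C assume "C \<in> (\<lambda>z. z +o B \<delta>) ` Z \<delta>"
    then obtain z where C: "C = z +o B \<delta>" by blast
    show "\<phi> \<delta> (fscale a ` C + B \<delta>) = fscale a ` \<phi> \<delta> C + B' \<delta>"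
      unfolding C \<phi> scale_coset[OF B] scale_coset[OF B'] scale ..
  qed
  moreover have "\<phi> \<delta>' (ptrans (quotient_pvspace Z B) \<delta> \<delta>' C) =
      ptrans (quotient_pvspace Z' B') \<delta> \<delta>' (\<phi> \<delta> C)"
    if "\<delta> \<le> \<delta>'" and mem: "C \<in> vcarrier (pspace (quotient_pvspace Z B) \<delta>)" for \<delta> \<delta>' C
  proof -
    obtain z where C: "C = z +o B \<delta>" using mem by auto
    show ?thesis
      unfolding quotient_pvspace_simps C \<phi> coset_plus_subspace[OF B B monoB[OF that(1)]]
        coset_plus_subspace[OF B' B' monoB'[OF that(1)]] ..
  qed
  ultimately show ?thesis unfolding pvspace_iso_def by blast
qed

lemma pvspace_iso_persistent_homology:
  fixes T :: "('a list \<Rightarrow> 'k::field) \<Rightarrow> 'b list \<Rightarrow> 'k"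
  assumes F: "filtration_on X F" and G: "filtration_on Y G"
    and add: "\<And>x y. T (x + y) = T x + T y" and scale: "\<And>a x. T (fscale a x) = fscale a (T x)"
    and TZ: "\<And>\<delta>. T ` cycles (F \<delta>) k \<subseteq> cycles (G \<delta>) k"
    and TB: "\<And>\<delta>. T ` boundaries (F \<delta>) k \<subseteq> boundaries (G \<delta>) k"
    and inj: "\<And>\<delta> z. z \<in> cycles (F \<delta>) k \<Longrightarrow> T z \<in> boundaries (G \<delta>) k \<Longrightarrow> z \<in> boundaries (F \<delta>) k"
    and surj: "\<And>\<delta> z'. z' \<in> cycles (G \<delta>) k \<Longrightarrow> \<exists>z\<in>cycles (F \<delta>) k. z' - T z \<in> boundaries (G \<delta>) k"
  shows "pvspace_iso (persistent_homology F k :: ('k, ('a list \<Rightarrow> 'k) set) pvspace)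
    (persistent_homology G k :: ('k, ('b list \<Rightarrow> 'k) set) pvspace)"
proof -
  have cF: "finite X" "F \<delta> \<subseteq> Pow X" and cG: "finite Y" "G \<delta> \<subseteq> Pow Y" for \<delta>
    using F G complex_onD(1,2) unfolding filtration_on_def by blast+
  have mF: "F \<delta> \<subseteq> F \<delta>'" and mG: "G \<delta> \<subseteq> G \<delta>'" if "\<delta> \<le> \<delta>'" for \<delta> \<delta>'
    using F G that unfolding filtration_on_def by (auto dest: monoD)
  show ?thesis
    unfolding persistent_homology_eq
    by (rule pvspace_iso_quotient[OF add scale subspace_cycles[OF cF] subspace_boundaries[OF cF]
        subspace_boundaries[OF cG] boundaries_mono[OF mF] boundaries_mono[OF mG] TZ TB inj surj])
qed

text \<open>Exterior multiplication by the vertex \<open>v\<close>; the sign is accumulated by the recursion.\<close>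

fun wedge :: "'a \<Rightarrow> ('a list \<Rightarrow> 'k::field) \<Rightarrow> 'a list \<Rightarrow> 'k" where
  "wedge v c [] = 0"
| "wedge v c (x # xs) = (if x = v then c xs else 0) - wedge v (\<lambda>ys. c (x # ys)) xs"

lemma wedge_add: "wedge v (\<lambda>ys. c ys + d ys) xs = wedge v c xs + wedge v d xs"
  by (induction xs arbitrary: c d) auto

lemma wedge_minus: "wedge v (\<lambda>ys. - c ys) xs = - wedge v c xs"
  by (induction xs arbitrary: c) auto

lemma wedge_zero: "wedge v (\<lambda>ys. 0) xs = 0"
  by (induction xs) auto

lemma wedge_sum: "wedge v (\<lambda>ys. \<Sum>w\<in>A. f w ys) xs = (\<Sum>w\<in>A. wedge v (f w) xs)"
  by (induction A rule: infinite_finite_induct) (auto simp: wedge_zero wedge_add)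

text \<open>Unfolding the recursion expresses \<open>wedge v c xs\<close> as a signed sum of the
  values of \<open>c\<close> at \<open>xs\<close> with one occurrence of \<open>v\<close>
  deleted.\<close>

lemma wedge_nonzero:
  "wedge v c xs \<noteq> 0 \<Longrightarrow> \<exists>us zs. xs = us @ v # zs \<and> c (us @ zs) \<noteq> 0"
proof (induction xs arbitrary: c)
  case (Cons x xs)
  show ?case
  proof (cases "x = v \<and> c xs \<noteq> 0")
    case True
    then show ?thesis by (intro exI[of _ "[]"] exI[of _ xs]) simp
  next
    case False
    then have "wedge v (\<lambda>ys. c (x # ys)) xs \<noteq> 0" using Cons.prems by (auto split: if_splits)
    from Cons.IH[OF this] obtain us zs where "xs = us @ v # zs" "c (x # us @ zs) \<noteq> 0" by blast
    then show ?thesis by (intro exI[of _ "x # us"] exI[of _ zs]) simp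
  qed
qed simp

lemma alternating_Cons: "alternating c \<Longrightarrow> alternating (\<lambda>ys. c (u # ys))"
  unfolding alternating_def using append_Cons by metis

lemma alternating_wedge:
  assumes "alternating c"
  shows "alternating (wedge v c)"
proof -
  have "wedge v c (us @ y # x # zs) = - wedge v c (us @ x # y # zs)" for us x y zs
    using assms
  proof (induction us arbitrary: c)
    case Nil
    have "(\<lambda>ws. c (y # x # ws)) = (\<lambda>ws. - c (x # y # ws))"
      using alternatingD[OF Nil, of "[]" y x] by auto
    then show ?case by (simp add: wedge_minus)
  next
    case (Cons u us)
    then show ?case
      using Cons.IH[OF alternating_Cons[OF Cons.prems, of u]] alternatingD[OF Cons.prems, of us y x zs]
      by simp
  qed
  then show ?thesis unfolding alternating_def by blast
qed

text \<open>The two terms that delete one of the equal entries cancel; every other term still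
  contains the repetition. In characteristic 2 this is not a consequence of the sign rule.\<close>

lemma wedge_square:
  assumes "\<And>us x zs. c (us @ x # x # zs) = 0"
  shows "wedge v c (us @ x # x # zs) = 0"
  using assms
proof (induction us arbitrary: c)
  case Nil
  have "c (x # x # zs) = 0" for zs using Nil[of "[]"] by simp
  then show ?case by (simp add: wedge_zero)
next
  case (Cons u us)
  have "wedge v (\<lambda>ys. c (u # ys)) (us @ x # x # zs) = 0"
    using Cons.prems[of "u # _"] by (intro Cons.IH) simp
  then show ?case using Cons.prems[of us x zs] by simp
qed

text \<open>Adjacent swaps bring two equal entries together at the cost of a sign only.\<close>

lemma distinct_if_alternating_nonzero:
  assumes alt: "alternating c" and square: "\<And>us x zs. c (us @ x # x # zs) = 0" and "c xs \<noteq> 0"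
  shows "distinct xs"
proof (rule ccontr)
  have "c (us @ x # ms @ x # zs) = 0" for us x ms zs
  proof (induction ms arbitrary: us)
    case Nil
    show ?case using square by simp
  next
    case (Cons m ms)
    have "c (us @ x # (m # ms) @ x # zs) = - c ((us @ [m]) @ x # ms @ x # zs)"
      using alternatingD[OF alt, of us x m "ms @ x # zs"] by simp
    also have "\<dots> = 0" using Cons.IH[of "us @ [m]"] by simp
    finally show ?case .
  qed
  moreover assume "\<not> distinct xs"
  then obtain us x ms zs where "xs = us @ x # ms @ x # zs"
    using not_distinct_decomp by fastforce
  ultimately show False using \<open>c xs \<noteq> 0\<close> by blast
qed

definition star_part :: "'a \<Rightarrow> ('a list \<Rightarrow> 'k::field) \<Rightarrow> 'a list \<Rightarrow> 'k" where
  "star_part w c = (\<lambda>xs. if w \<in> set xs then c xs else 0)"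

text \<open>Domination supplies the simplices that arise by adding \<open>v\<close>. If
  \<open>v\<close> was already present, the lists in question have a repetition, where
  \<open>wedge\<close> vanishes.\<close>

lemma wedge_star_part_chain:
  assumes K: "complex_on X K" and dom: "\<And>\<sigma>. \<sigma> \<in> K \<Longrightarrow> w \<in> \<sigma> \<Longrightarrow> insert v \<sigma> \<in> K"
    and c: "c \<in> chains K k"
  shows "wedge v (star_part w c) \<in> chains K (Suc k)"
proof -
  note X = complex_onD(1,2)[OF K]
  note c = c[unfolded chains_iff[OF X]]
  have alt: "alternating (star_part w c)"
    unfolding alternating_def
  proof (intro allI)
    fix us x y zs
    have "c (us @ y # x # zs) = - c (us @ x # y # zs)" using c by (intro alternatingD) simp
    then show "star_part w c (us @ y # x # zs) = - star_part w c (us @ x # y # zs)"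
      unfolding star_part_def by auto
  qed
  have "\<not> distinct (us @ x # x # zs)" for us zs and x :: 'a by simp
  then have "star_part w c (us @ x # x # zs) = 0" for us x zs
    using c unfolding star_part_def by metis
  then have square: "wedge v (star_part w c) (us @ x # x # zs) = 0" for us x zs
    by (rule wedge_square)
  show ?thesis
    unfolding chains_iff[OF X]
  proof (intro conjI allI impI)
    show altw: "alternating (wedge v (star_part w c))" by (rule alternating_wedge[OF alt])
    fix xs assume nz: "wedge v (star_part w c) xs \<noteq> 0"
    show "distinct xs" by (rule distinct_if_alternating_nonzero[OF altw square nz])
    obtain us zs where xs: "xs = us @ v # zs" and "star_part w c (us @ zs) \<noteq> 0"
      using wedge_nonzero[OF nz] by blast
    then have w: "w \<in> set (us @ zs)" and "c (us @ zs) \<noteq> 0"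
      unfolding star_part_def by (metis)+
    then have "length (us @ zs) = Suc k" "set (us @ zs) \<in> K" using c by blast+
    then show "length xs = Suc (Suc k)" "set xs \<in> K"
      using dom[OF _ w] unfolding xs by simp_all
  qed
qed

text \<open>Adding \<open>v\<close> to the simplices that contain \<open>w\<close> is a chain homotopy between the identity and a
  chain map onto the chains that avoid \<open>w\<close>.\<close>

lemma wedge_star_part_homotopy:
  assumes "finite X" "v \<in> X" "v \<noteq> w" "w \<in> set xs"
  shows "boundary_on X (wedge v (star_part w c)) xs + wedge v (star_part w (boundary_on X c)) xs = c xs"
proof -
  have "xs \<noteq> []" using assms(4) by auto
  \<comment> \<open>The failure of \<open>star_part w\<close> to commute with the boundary. It
    vanishes on lists that contain \<open>w\<close>, and deleting \<open>v\<close> from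
    \<open>xs\<close> leaves such a list because \<open>v\<close> differs from
    \<open>w\<close>.\<close>
  define e where "e ys = (\<Sum>u\<in>X. star_part w c (u # ys)) + - star_part w (boundary_on X c) ys" for ys
  have "e ys = 0" if "w \<in> set ys" for ys
    using that unfolding e_def star_part_def boundary_on_def by auto
  then have "wedge v e xs = 0"
    using wedge_nonzero[of v e xs] assms(3,4) by fastforce
  then have e: "(\<Sum>u\<in>X. wedge v (\<lambda>ys. star_part w c (u # ys)) xs) =
      wedge v (star_part w (boundary_on X c)) xs"
    unfolding e_def wedge_add wedge_minus wedge_sum by simp
  have "boundary_on X (wedge v (star_part w c)) xs =
      (\<Sum>u\<in>X. (if u = v then star_part w c xs else 0) - wedge v (\<lambda>ys. star_part w c (u # ys)) xs)"
    using \<open>xs \<noteq> []\<close> unfolding boundary_on_def by simp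
  also have "\<dots> = star_part w c xs - wedge v (star_part w (boundary_on X c)) xs"
    unfolding sum_subtractf e using assms(1,2) by simp
  finally show ?thesis using assms(4) unfolding star_part_def by simp
qed

lemma chains_avoiding:
  assumes "finite X" "K \<subseteq> Pow X"
    and c: "c \<in> chains K k" and "\<And>xs. w \<in> set xs \<Longrightarrow> c xs = 0"
  shows "c \<in> chains {\<sigma> \<in> K. w \<notin> \<sigma>} k"
proof -
  have "{\<sigma> \<in> K. w \<notin> \<sigma>} \<subseteq> Pow X" using assms(2) by blast
  then show ?thesis
    using assms(4) c unfolding chains_iff[OF assms(1,2)] chains_iff[OF assms(1) \<open>{\<sigma> \<in> K. w \<notin> \<sigma>} \<subseteq> Pow X\<close>]
    by blast
qed

lemma filtration_on_restrict:
  assumes F: "filtration_on X F" and P: "\<And>\<sigma> \<tau>. P \<sigma> \<Longrightarrow> \<tau> \<subseteq> \<sigma> \<Longrightarrow> P \<tau>"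
  shows "filtration_on X (\<lambda>\<delta>. {\<sigma> \<in> F \<delta>. P \<sigma>})"
  unfolding filtration_on_def
proof (intro conjI allI monoI)
  fix \<delta>
  have "complex_on X (F \<delta>)" using F unfolding filtration_on_def by blast
  note K = complex_onD[OF this]
  have "\<tau> \<in> F \<delta> \<and> P \<tau>" if "\<sigma> \<in> F \<delta>" "P \<sigma>" "\<tau> \<subseteq> \<sigma>" "\<tau> \<noteq> {}" for \<sigma> \<tau>
    using K(3)[OF that(1,3,4)] P[OF that(2,3)] by simp
  then show "complex_on X {\<sigma> \<in> F \<delta>. P \<sigma>}"
    using K(1,2) unfolding complex_on_def by auto
next
  show "{\<sigma> \<in> F x. P \<sigma>} \<subseteq> {\<sigma> \<in> F y. P \<sigma>}" if "x \<le> y" for x y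
    using F that unfolding filtration_on_def by (auto dest: monoD)
qed

text \<open>Write \<open>h\<close> for the homotopy. Subtracting \<open>boundary_on X (h c)\<close>
  does not change the boundary of \<open>c\<close>, and the result avoids \<open>w\<close> as soon
  as \<open>h\<close> kills the boundary of \<open>c\<close>. This applies to a chain bounding a
  cycle that avoids \<open>w\<close>, which gives injectivity, and to an arbitrary cycle, which
  gives surjectivity.\<close>

lemma pvspace_iso_remove_dominated:
  assumes F: "filtration_on X F" and "v \<in> X" "v \<noteq> w"
    and dom: "\<And>\<delta> \<sigma>. \<sigma> \<in> F \<delta> \<Longrightarrow> w \<in> \<sigma> \<Longrightarrow> insert v \<sigma> \<in> F \<delta>"
  shows "pvspace_iso
    (persistent_homology (\<lambda>\<delta>. {\<sigma> \<in> F \<delta>. w \<notin> \<sigma>}) k :: ('k::field, ('a list \<Rightarrow> 'k) set) pvspace)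
    (persistent_homology F k :: ('k, ('a list \<Rightarrow> 'k) set) pvspace)"
proof -
  define G where "G \<delta> = {\<sigma> \<in> F \<delta>. w \<notin> \<sigma>}" for \<delta>
  have cF: "complex_on X (F \<delta>)" for \<delta> using F unfolding filtration_on_def by blast
  note XF = complex_onD(1,2)[OF cF]
  have G: "filtration_on X G"
    unfolding G_def by (rule filtration_on_restrict[OF F]) auto
  then have cG: "complex_on X (G \<delta>)" for \<delta> unfolding filtration_on_def by blast
  note XG = complex_onD(1,2)[OF cG]
  have GF: "G \<delta> \<subseteq> F \<delta>" for \<delta> unfolding G_def by blast
  let ?h = "\<lambda>c :: 'a list \<Rightarrow> 'k. wedge v (star_part w c)"
  have h: "?h c \<in> chains (F \<delta>) (Suc j)" if "c \<in> chains (F \<delta>) j" for c \<delta> j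
    by (rule wedge_star_part_chain[OF cF dom that])
  have wedge0: "wedge v 0 = (0 :: 'a list \<Rightarrow> 'k)"
    by (rule ext) (simp add: zero_fun_def wedge_zero)
  have "star_part w 0 = (0 :: 'a list \<Rightarrow> 'k)"
    unfolding star_part_def by auto
  then have h0: "?h 0 = 0" using wedge0 by simp
  have homotopy: "boundary_on X (?h c) xs + ?h (boundary_on X c) xs = c xs" if "w \<in> set xs" for c xs
    by (rule wedge_star_part_homotopy[OF XF(1) \<open>v \<in> X\<close> \<open>v \<noteq> w\<close> that])
  note sub = subspace_chains[OF XF]
  have "pvspace_iso (persistent_homology G k :: ('k, ('a list \<Rightarrow> 'k) set) pvspace)
      (persistent_homology F k :: ('k, ('a list \<Rightarrow> 'k) set) pvspace)"
  proof (rule pvspace_iso_persistent_homology[OF G F, of "\<lambda>c. c"])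
    show "(\<lambda>c :: 'a list \<Rightarrow> 'k. c) ` cycles (G \<delta>) k \<subseteq> cycles (F \<delta>) k" for \<delta>
      using cycles_mono[OF GF] by simp
    show "(\<lambda>c :: 'a list \<Rightarrow> 'k. c) ` boundaries (G \<delta>) k \<subseteq> boundaries (F \<delta>) k" for \<delta>
      using boundaries_mono[OF GF] by simp
  next
    fix \<delta> and z :: "'a list \<Rightarrow> 'k"
    assume z: "z \<in> cycles (G \<delta>) k" and "z \<in> boundaries (F \<delta>) k"
    then obtain b where b: "b \<in> chains (F \<delta>) (Suc k)" "z = boundary_on X b"
      unfolding boundaries_eq[OF XF] by blast
    have "z \<in> chains (G \<delta>) k" using z unfolding cycles_def by blast
    then have "z xs = 0" if "w \<in> set xs" for xs
      using that unfolding chains_iff[OF XG] by (auto simp: G_def)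
    then have "star_part w z = 0" unfolding star_part_def by auto
    then have hz: "?h z = 0" using wedge0 by simp
    define b' where "b' = b - boundary_on X (?h b)"
    have hb: "boundary_on X (?h b) \<in> chains (F \<delta>) (Suc k)"
      by (rule boundary_on_chain[OF cF h[OF b(1)]])
    have "b' \<in> chains (F \<delta>) (Suc k)"
      unfolding b'_def by (rule fs.subspace_diff[OF sub b(1) hb])
    moreover have "b' xs = 0" if "w \<in> set xs" for xs
      using homotopy[OF that, of b] hz unfolding b'_def b(2) by simp
    ultimately have "b' \<in> chains (G \<delta>) (Suc k)"
      unfolding G_def by (rule chains_avoiding[OF XF])
    moreover have "boundary_on X b' = z"
      unfolding b'_def boundary_on_linear boundary_on_boundary_on[OF cF h[OF b(1)]] b(2) by simp
    ultimately show "z \<in> boundaries (G \<delta>) k" unfolding boundaries_eq[OF XG] by blast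
  next
    fix \<delta> and z :: "'a list \<Rightarrow> 'k"
    assume "z \<in> cycles (F \<delta>) k"
    then have z: "z \<in> chains (F \<delta>) k" "boundary_on X z = 0" unfolding cycles_eq[OF XF] by auto
    define z' where "z' = z - boundary_on X (?h z)"
    have hz: "boundary_on X (?h z) \<in> chains (F \<delta>) k"
      by (rule boundary_on_chain[OF cF h[OF z(1)]])
    have "z' \<in> chains (F \<delta>) k"
      unfolding z'_def by (rule fs.subspace_diff[OF sub z(1) hz])
    moreover have "z' xs = 0" if "w \<in> set xs" for xs
      using homotopy[OF that, of z] h0 unfolding z'_def z(2) by simp
    ultimately have "z' \<in> chains (G \<delta>) k"
      unfolding G_def by (rule chains_avoiding[OF XF])
    moreover have "boundary_on X z' = 0"
      unfolding z'_def boundary_on_linear boundary_on_boundary_on[OF cF h[OF z(1)]] z(2) by simp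
    ultimately have "z' \<in> cycles (G \<delta>) k" unfolding cycles_eq[OF XG] by blast
    moreover have "z - z' \<in> boundaries (F \<delta>) k"
      unfolding z'_def boundaries_eq[OF XF] using h[OF z(1)] by simp
    ultimately show "\<exists>z'\<in>cycles (G \<delta>) k. z - z' \<in> boundaries (F \<delta>) k" by blast
  qed simp_all
  then show ?thesis unfolding G_def .
qed

lemma pvspace_iso_refl: "pvspace_iso P P"
  unfolding pvspace_iso_def linear_iso_def by (intro exI[of _ "\<lambda>_ x. x"]) (auto simp: bij_betw_def)

text \<open>The dominating vertices \<open>r w\<close> lie outside \<open>V\<close>, so none of them
  is ever deleted and domination persists in the smaller filtrations.\<close>

lemma pvspace_iso_remove_dominated_set:
  assumes "finite V" and F: "filtration_on X F" and "\<And>w. w \<in> V \<Longrightarrow> r w \<in> X - V"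
    and dom: "\<And>\<delta> \<sigma> w. \<sigma> \<in> F \<delta> \<Longrightarrow> w \<in> V \<Longrightarrow> w \<in> \<sigma> \<Longrightarrow> insert (r w) \<sigma> \<in> F \<delta>"
  shows "pvspace_iso
    (persistent_homology (\<lambda>\<delta>. {\<sigma> \<in> F \<delta>. \<sigma> \<inter> V = {}}) k :: ('k::field, ('a list \<Rightarrow> 'k) set) pvspace)
    (persistent_homology F k :: ('k, ('a list \<Rightarrow> 'k) set) pvspace)"
  using assms(1,3,4)
proof (induction V)
  case empty
  show ?case by (simp add: pvspace_iso_refl)
next
  case (insert w V)
  define G where "G \<delta> = {\<sigma> \<in> F \<delta>. \<sigma> \<inter> V = {}}" for \<delta>
  have G: "filtration_on X G"
    unfolding G_def by (rule filtration_on_restrict[OF F]) auto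
  have "pvspace_iso
      (persistent_homology (\<lambda>\<delta>. {\<sigma> \<in> G \<delta>. w \<notin> \<sigma>}) k :: ('k, ('a list \<Rightarrow> 'k) set) pvspace)
      (persistent_homology G k :: ('k, ('a list \<Rightarrow> 'k) set) pvspace)"
  proof (rule pvspace_iso_remove_dominated[OF G])
    show "r w \<in> X" "r w \<noteq> w" using insert.prems(1)[of w] by auto
    show "insert (r w) \<sigma> \<in> G \<delta>" if "\<sigma> \<in> G \<delta>" "w \<in> \<sigma>" for \<delta> \<sigma>
      using that insert.prems(1)[of w] insert.prems(2)[of \<sigma> \<delta> w] unfolding G_def by auto
  qed
  moreover have "(\<lambda>\<delta>. {\<sigma> \<in> G \<delta>. w \<notin> \<sigma>}) = (\<lambda>\<delta>. {\<sigma> \<in> F \<delta>. \<sigma> \<inter> insert w V = {}})"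
    unfolding G_def by auto
  moreover have "pvspace_iso (persistent_homology G k :: ('k, ('a list \<Rightarrow> 'k) set) pvspace)
      (persistent_homology F k :: ('k, ('a list \<Rightarrow> 'k) set) pvspace)"
    unfolding G_def using insert.prems by (intro insert.IH) auto
  ultimately show ?case by (metis (no_types) pvspace_iso_trans)
qed

text \<open>A chain is a function of lists and is therefore pulled back along the vertex map. The
  cut-off to lists in \<open>T\<close> is there because \<open>\<pi>\<close> is controlled on
  \<open>T\<close> only.\<close>

definition relabel :: "('b \<Rightarrow> 'a) \<Rightarrow> 'b set \<Rightarrow> ('a list \<Rightarrow> 'k::field) \<Rightarrow> 'b list \<Rightarrow> 'k" where
  "relabel \<pi> T c = (\<lambda>xs. if set xs \<subseteq> T then c (map \<pi> xs) else 0)"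

lemma relabel_chain:
  assumes K: "complex_on X K" and L: "complex_on T L"
    and iff: "\<And>\<sigma>. \<sigma> \<subseteq> T \<Longrightarrow> \<pi> ` \<sigma> \<in> K \<Longrightarrow> \<sigma> \<in> L" and c: "c \<in> chains K k"
  shows "relabel \<pi> T c \<in> chains L k"
proof -
  note c = c[unfolded chains_iff[OF complex_onD(1,2)[OF K]]]
  show ?thesis
    unfolding chains_iff[OF complex_onD(1,2)[OF L]]
  proof (intro conjI allI impI)
    fix xs assume "relabel \<pi> T c xs \<noteq> 0"
    then have xs: "set xs \<subseteq> T" "c (map \<pi> xs) \<noteq> 0" unfolding relabel_def by (auto split: if_splits)
    then have "length (map \<pi> xs) = Suc k" "distinct (map \<pi> xs)" "set (map \<pi> xs) \<in> K" using c by blast+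
    then show "length xs = Suc k" "distinct xs" "set xs \<in> L"
      using iff[OF xs(1)] by (auto simp: distinct_map)
  next
    show "alternating (relabel \<pi> T c)"
      unfolding alternating_def
    proof (intro allI)
      fix us x y zs
      have "c (map \<pi> us @ \<pi> y # \<pi> x # map \<pi> zs) = - c (map \<pi> us @ \<pi> x # \<pi> y # map \<pi> zs)"
        using c by (intro alternatingD) simp
      then show "relabel \<pi> T c (us @ y # x # zs) = - relabel \<pi> T c (us @ x # y # zs)"
        unfolding relabel_def by auto
    qed
  qed
qed

lemma boundary_on_relabel:
  assumes "bij_betw \<pi> T X"
  shows "boundary_on T (relabel \<pi> T c) = relabel \<pi> T (boundary_on X c)"
proof
  fix ys
  show "boundary_on T (relabel \<pi> T c) ys = relabel \<pi> T (boundary_on X c) ys"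
  proof (cases "ys \<noteq> [] \<and> set ys \<subseteq> T")
    case True
    then have "boundary_on T (relabel \<pi> T c) ys = (\<Sum>v\<in>T. c (\<pi> v # map \<pi> ys))"
      unfolding boundary_on_def relabel_def by auto
    also have "\<dots> = (\<Sum>x\<in>X. c (x # map \<pi> ys))"
      by (rule sum.reindex_bij_betw[OF assms])
    finally show ?thesis using True unfolding boundary_on_def relabel_def by auto
  next
    case False
    then show ?thesis unfolding boundary_on_def relabel_def by auto
  qed
qed

lemma relabel_relabel:
  assumes "bij_betw \<pi> T X" "\<And>z. z \<in> T \<Longrightarrow> s (\<pi> z) = z" and "\<And>xs. c xs \<noteq> 0 \<Longrightarrow> set xs \<subseteq> T"
  shows "relabel \<pi> T (relabel s X c) = c"
proof
  fix xs
  show "relabel \<pi> T (relabel s X c) xs = c xs"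
  proof (cases "set xs \<subseteq> T")
    case True
    then have "map s (map \<pi> xs) = xs" "set (map \<pi> xs) \<subseteq> X"
      using assms(1,2) by (auto simp: map_idI subset_iff dest: bij_betwE)
    then show ?thesis using True unfolding relabel_def by simp
  next
    case False
    then show ?thesis using assms(3) unfolding relabel_def by auto
  qed
qed

lemma pvspace_iso_relabel:
  assumes F: "filtration_on X F" and G: "filtration_on T G" and \<pi>: "bij_betw \<pi> T X"
    and iff: "\<And>\<delta> \<sigma>. \<sigma> \<subseteq> T \<Longrightarrow> \<sigma> \<in> G \<delta> \<longleftrightarrow> \<pi> ` \<sigma> \<in> F \<delta>"
  shows "pvspace_iso (persistent_homology F k :: ('k::field, ('a list \<Rightarrow> 'k) set) pvspace)
    (persistent_homology G k :: ('k, ('b list \<Rightarrow> 'k) set) pvspace)"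
proof -
  define s where "s = the_inv_into T \<pi>"
  have s: "bij_betw s X T" unfolding s_def by (rule bij_betw_the_inv_into[OF \<pi>])
  have s\<pi>: "s (\<pi> z) = z" if "z \<in> T" for z
    unfolding s_def using \<pi> that by (simp add: the_inv_into_f_f bij_betw_def)
  have \<pi>s: "\<pi> (s x) = x" if "x \<in> X" for x
    unfolding s_def using \<pi> that by (simp add: f_the_inv_into_f bij_betw_def)
  have cF: "complex_on X (F \<delta>)" and cG: "complex_on T (G \<delta>)" for \<delta>
    using F G unfolding filtration_on_def by blast+
  note XF = complex_onD(1,2)[OF cF] and XG = complex_onD(1,2)[OF cG]
  have iff': "\<sigma> \<in> F \<delta>" if "\<sigma> \<subseteq> X" "s ` \<sigma> \<in> G \<delta>" for \<delta> \<sigma>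
  proof -
    have "s ` \<sigma> \<subseteq> T" using that(2) XG(2) by blast
    moreover have "\<pi> ` s ` \<sigma> = \<sigma>" using that(1) \<pi>s by (force simp: image_image)
    ultimately show ?thesis using iff[of "s ` \<sigma>" \<delta>] that(2) by simp
  qed
  have L: "relabel \<pi> T c \<in> chains (G \<delta>) j" if "c \<in> chains (F \<delta>) j" for c :: "'a list \<Rightarrow> 'k" and \<delta> j
    by (rule relabel_chain[OF cF cG _ that]) (simp add: iff)
  have M: "relabel s X c \<in> chains (F \<delta>) j" if "c \<in> chains (G \<delta>) j" for c :: "'b list \<Rightarrow> 'k" and \<delta> j
    by (rule relabel_chain[OF cG cF iff' that])
  have inv_M: "relabel \<pi> T (relabel s X c) = c" if "c \<in> chains (G \<delta>) j" for c :: "'b list \<Rightarrow> 'k" and \<delta> j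
    by (rule relabel_relabel[OF \<pi> s\<pi>]) (use that XG(2) in \<open>auto simp: chains_iff[OF XG]\<close>)
  have inv_L: "relabel s X (relabel \<pi> T c) = c" if "c \<in> chains (F \<delta>) j" for c :: "'a list \<Rightarrow> 'k" and \<delta> j
    by (rule relabel_relabel[OF s \<pi>s]) (use that XF(2) in \<open>auto simp: chains_iff[OF XF]\<close>)
  have zero: "relabel \<rho> A 0 = 0" for \<rho> :: "'c \<Rightarrow> 'd" and A
    unfolding relabel_def by auto
  have Z: "relabel \<pi> T z \<in> cycles (G \<delta>) k" if "z \<in> cycles (F \<delta>) k" for z :: "'a list \<Rightarrow> 'k" and \<delta>
    using that L unfolding cycles_eq[OF XF] cycles_eq[OF XG]
    by (simp add: boundary_on_relabel[OF \<pi>] zero)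
  have Z': "relabel s X z \<in> cycles (F \<delta>) k" if "z \<in> cycles (G \<delta>) k" for z :: "'b list \<Rightarrow> 'k" and \<delta>
    using that M unfolding cycles_eq[OF XF] cycles_eq[OF XG]
    by (simp add: boundary_on_relabel[OF s] zero)
  show ?thesis
  proof (rule pvspace_iso_persistent_homology[OF F G, of "relabel \<pi> T"])
    show "relabel \<pi> T (x + y) = relabel \<pi> T x + relabel \<pi> T y" for x y :: "'a list \<Rightarrow> 'k"
      unfolding relabel_def by auto
    show "relabel \<pi> T (fscale a x) = fscale a (relabel \<pi> T x)" for a and x :: "'a list \<Rightarrow> 'k"
      unfolding relabel_def by auto
    show "relabel \<pi> T ` cycles (F \<delta>) k \<subseteq> (cycles (G \<delta>) k :: ('b list \<Rightarrow> 'k) set)" for \<delta>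
      using Z by blast
    show "relabel \<pi> T ` boundaries (F \<delta>) k \<subseteq> (boundaries (G \<delta>) k :: ('b list \<Rightarrow> 'k) set)" for \<delta>
      unfolding boundaries_eq[OF XF] boundaries_eq[OF XG]
      using L by (auto simp: boundary_on_relabel[OF \<pi>, symmetric])
  next
    fix \<delta> and z :: "'a list \<Rightarrow> 'k"
    assume z: "z \<in> cycles (F \<delta>) k" and "relabel \<pi> T z \<in> boundaries (G \<delta>) k"
    then obtain b where b: "b \<in> chains (G \<delta>) (Suc k)" "relabel \<pi> T z = boundary_on T b"
      unfolding boundaries_eq[OF XG] by blast
    have "z \<in> chains (F \<delta>) k" using z unfolding cycles_def by blast
    then have "z = relabel s X (boundary_on T b)" using inv_L b(2) by metis
    also have "\<dots> = boundary_on X (relabel s X b)" by (rule boundary_on_relabel[OF s, symmetric])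
    finally show "z \<in> boundaries (F \<delta>) k" unfolding boundaries_eq[OF XF] using M[OF b(1)] by blast
  next
    fix \<delta> and z :: "'b list \<Rightarrow> 'k"
    assume z: "z \<in> cycles (G \<delta>) k"
    then have "z - relabel \<pi> T (relabel s X z) = 0" using inv_M unfolding cycles_def by auto
    then show "\<exists>z'\<in>cycles (F \<delta>) k. z - relabel \<pi> T z' \<in> boundaries (G \<delta>) k"
      using Z'[OF z] fs.subspace_0[OF subspace_boundaries[OF XG]] by metis
  qed
qed

section \<open>Dowker complexes of a correspondence\<close>

lemma filtration_on_dowker_sink:
  assumes "finite X"
  shows "filtration_on X (dowker_sink X \<omega>)"
  unfolding filtration_on_def complex_on_def
proof (intro conjI allI ballI impI monoI)
  show "\<tau> \<in> dowker_sink X \<omega> \<delta>" if "\<sigma> \<in> dowker_sink X \<omega> \<delta>" "\<tau> \<subseteq> \<sigma>" "\<tau> \<noteq> {}" for \<delta> \<sigma> \<tau>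
    using that unfolding dowker_sink_def by blast
  show "dowker_sink X \<omega> x \<subseteq> dowker_sink X \<omega> y" if "x \<le> y" for x y
    using order_trans[OF _ that] unfolding dowker_sink_def by blast
qed (use assms in \<open>auto simp: dowker_sink_def\<close>)

text \<open>A point of \<open>R\<close> dominates every other point with the same image in \<open>X\<close>; deleting the dominated
  points leaves a copy of \<open>X\<close>.\<close>

lemma pvspace_iso_dowker_sink_pullback:
  fixes \<pi> :: "'b \<Rightarrow> 'a"
  assumes "finite R" and surj: "\<pi> ` R = X"
  shows "pvspace_iso
    (persistent_homology (dowker_sink X \<omega>) k :: ('k::field, ('a list \<Rightarrow> 'k) set) pvspace)
    (persistent_homology (dowker_sink R (\<lambda>z z'. \<omega> (\<pi> z) (\<pi> z'))) k ::
      ('k, ('b list \<Rightarrow> 'k) set) pvspace)"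
proof -
  define F where "F = dowker_sink R (\<lambda>z z'. \<omega> (\<pi> z) (\<pi> z'))"
  \<comment> \<open>A section of \<open>\<pi>\<close>: it selects one point of \<open>R\<close> over
    each point of \<open>X\<close>, and these points form the copy \<open>T\<close> of
    \<open>X\<close>.\<close>
  define s where "s = inv_into R \<pi>"
  have sR: "s x \<in> R" and \<pi>s: "\<pi> (s x) = x" if "x \<in> X" for x
    using that surj unfolding s_def by (auto simp: inv_into_into f_inv_into_f)
  define T where "T = s ` X"
  have "T \<subseteq> R" unfolding T_def using sR by blast
  have "finite X" using assms by auto
  have \<pi>T: "\<pi> z \<in> X" "s (\<pi> z) = z" if "z \<in> T" for z
    using that \<pi>s unfolding T_def by auto
  have bij: "bij_betw \<pi> T X"
    by (rule bij_betw_byWitness[where f' = s]) (use \<pi>T \<pi>s in \<open>auto simp: T_def\<close>)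
  define G where "G \<delta> = {\<sigma> \<in> F \<delta>. \<sigma> \<inter> (R - T) = {}}" for \<delta>
  have F: "filtration_on R F"
    unfolding F_def by (rule filtration_on_dowker_sink[OF \<open>finite R\<close>])
  have G_eq: "G \<delta> = {\<sigma> \<in> F \<delta>. \<sigma> \<subseteq> T}" for \<delta>
    unfolding G_def F_def dowker_sink_def using \<open>T \<subseteq> R\<close> by blast
  have GR: "filtration_on R G"
    unfolding G_def by (rule filtration_on_restrict[OF F]) auto
  have G: "filtration_on T G"
    unfolding filtration_on_def
  proof (intro conjI allI)
    fix \<delta>
    have "complex_on R (G \<delta>)" using GR unfolding filtration_on_def by blast
    note face = complex_onD(3)[OF this]
    have "G \<delta> \<subseteq> Pow T" unfolding G_eq by blast
    then show "complex_on T (G \<delta>)"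
      unfolding complex_on_def using finite_subset[OF \<open>T \<subseteq> R\<close> \<open>finite R\<close>] face by simp
  qed (use GR in \<open>simp add: filtration_on_def\<close>)
  \<comment> \<open>The witness of a simplex still ranges over all of \<open>R\<close>, but only its
    image under \<open>\<pi>\<close> enters the weight, and these images exhaust
    \<open>X\<close>.\<close>
  have iff: "\<sigma> \<in> G \<delta> \<longleftrightarrow> \<pi> ` \<sigma> \<in> dowker_sink X \<omega> \<delta>" if "\<sigma> \<subseteq> T" for \<sigma> \<delta>
  proof -
    have "\<sigma> \<subseteq> R" "\<pi> ` \<sigma> \<subseteq> X" using that \<open>T \<subseteq> R\<close> surj by auto
    then show ?thesis
      using that unfolding G_eq F_def dowker_sink_def surj[symmetric] by auto
  qed
  have "pvspace_iso (persistent_homology (dowker_sink X \<omega>) k :: ('k, ('a list \<Rightarrow> 'k) set) pvspace)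
      (persistent_homology G k :: ('k, ('b list \<Rightarrow> 'k) set) pvspace)"
    by (rule pvspace_iso_relabel[OF filtration_on_dowker_sink[OF \<open>finite X\<close>] G bij iff])
  moreover have "pvspace_iso (persistent_homology G k :: ('k, ('b list \<Rightarrow> 'k) set) pvspace)
      (persistent_homology F k :: ('k, ('b list \<Rightarrow> 'k) set) pvspace)"
    unfolding G_def
  proof (rule pvspace_iso_remove_dominated_set[OF _ F, where r = "\<lambda>w. s (\<pi> w)"])
    show "s (\<pi> w) \<in> R - (R - T)" if "w \<in> R - T" for w
      using that surj \<open>T \<subseteq> R\<close> unfolding T_def by auto
    \<comment> \<open>The points \<open>w\<close> and \<open>s (\<pi> w)\<close> have the same
      weights, so the same witness works for the enlarged simplex.\<close>
    show "insert (s (\<pi> w)) \<sigma> \<in> F \<delta>" if "\<sigma> \<in> F \<delta>" "w \<in> \<sigma>" for \<delta> \<sigma> w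
    proof -
      have "w \<in> R" using that unfolding F_def dowker_sink_def by blast
      then have "s (\<pi> w) \<in> R" "\<pi> (s (\<pi> w)) = \<pi> w" using sR \<pi>s surj by auto
      then show ?thesis using that unfolding F_def dowker_sink_def by auto
    qed
  qed (use \<open>finite R\<close> in auto)
  ultimately show ?thesis unfolding F_def by (rule pvspace_iso_trans)
qed

section \<open>Sink filtrations as sublevel filtrations of the full simplex\<close>

definition dowker_value :: "'a set \<Rightarrow> ('a \<Rightarrow> 'a \<Rightarrow> real) \<Rightarrow> 'a set \<Rightarrow> real" where
  "dowker_value R \<omega> \<sigma> = Min ((\<lambda>z'. Max ((\<lambda>z. \<omega> z z') ` \<sigma>)) ` R)"

lemma dowker_value_le_iff:
  assumes "finite R" "\<sigma> \<subseteq> R" "\<sigma> \<noteq> {}"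
  shows "dowker_value R \<omega> \<sigma> \<le> \<delta> \<longleftrightarrow> (\<exists>z'\<in>R. \<forall>z\<in>\<sigma>. \<omega> z z' \<le> \<delta>)"
proof -
  have "finite \<sigma>" "R \<noteq> {}" using assms by (auto intro: finite_subset)
  then show ?thesis
    unfolding dowker_value_def using assms by (simp add: Min_le_iff)
qed

lemma dowker_sink_eq_sublevel:
  assumes "finite R"
  shows "dowker_sink R \<omega> = sublevel (Pow R - {{}}) (dowker_value R \<omega>)"
  unfolding dowker_sink_def sublevel_def using dowker_value_le_iff[OF assms] by (intro ext) auto

lemma face_monotone_dowker_value:
  assumes "finite R"
  shows "face_monotone (Pow R - {{}}) (dowker_value R \<omega>)"
  unfolding face_monotone_def
proof (intro ballI allI impI)
  fix \<sigma> \<tau> assume \<sigma>: "\<sigma> \<in> Pow R - {{}}" and \<tau>: "\<tau> \<subseteq> \<sigma>" "\<tau> \<noteq> {}"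
  have "\<exists>z'\<in>R. \<forall>z\<in>\<sigma>. \<omega> z z' \<le> dowker_value R \<omega> \<sigma>"
    using \<sigma> dowker_value_le_iff[OF assms, of \<sigma> \<omega> "dowker_value R \<omega> \<sigma>"] by simp
  then have "\<exists>z'\<in>R. \<forall>z\<in>\<tau>. \<omega> z z' \<le> dowker_value R \<omega> \<sigma>" using \<tau> by blast
  moreover have "\<tau> \<subseteq> R" using \<sigma> \<tau> by blast
  ultimately show "dowker_value R \<omega> \<tau> \<le> dowker_value R \<omega> \<sigma>"
    unfolding dowker_value_le_iff[OF assms \<open>\<tau> \<subseteq> R\<close> \<tau>(2)] by simp
qed

lemma dowker_value_le_plus:
  assumes "finite R" and \<sigma>: "\<sigma> \<subseteq> R" "\<sigma> \<noteq> {}"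
    and near: "\<And>z z'. z \<in> R \<Longrightarrow> z' \<in> R \<Longrightarrow> \<omega>' z z' \<le> \<omega> z z' + e"
  shows "dowker_value R \<omega>' \<sigma> \<le> dowker_value R \<omega> \<sigma> + e"
proof -
  obtain z' where z': "z' \<in> R" "\<And>z. z \<in> \<sigma> \<Longrightarrow> \<omega> z z' \<le> dowker_value R \<omega> \<sigma>"
    using dowker_value_le_iff[OF assms(1) \<sigma>, of \<omega> "dowker_value R \<omega> \<sigma>"] by auto
  have "\<omega>' z z' \<le> dowker_value R \<omega> \<sigma> + e" if "z \<in> \<sigma>" for z
    using near[of z z'] z' that \<sigma>(1) by force
  then show ?thesis
    unfolding dowker_value_le_iff[OF assms(1) \<sigma>] using z'(1) by blast
qed

lemma is_persistence_diagram_dgm_sink: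
  fixes X :: "'a set"
  assumes "finite X"
  shows "is_persistence_diagram
    (persistent_homology (dowker_sink X \<omega>) k :: ('k::field, ('a list \<Rightarrow> 'k) set) pvspace)
    (dgm_sink TYPE('k) k X \<omega>)"
proof -
  have "complex_on X (Pow X - {{}})" unfolding complex_on_def using assms by auto
  from is_persistence_diagram_sublevel_diagram[OF this face_monotone_dowker_value[OF assms], where 'k = 'k]
  show ?thesis
    unfolding dgm_sink_def sublevel_diagram_def dowker_sink_eq_sublevel[OF assms] .
qed

text \<open>Isomorphic persistence vector spaces have the same diagram; applied to both projections
  of \<open>R\<close>, this moves the two networks to one vertex set.\<close>

lemma dgm_sink_pullback:
  fixes \<pi> :: "'b \<Rightarrow> 'a"
  assumes "finite R" and "\<pi> ` R = X"
  shows "dgm_sink TYPE('k::field) k X \<omega> =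
    sublevel_diagram TYPE('k) k (Pow R - {{}}) (dowker_value R (\<lambda>z z'. \<omega> (\<pi> z) (\<pi> z')))"
proof -
  have "finite X" using assms by auto
  have "is_persistence_diagram
      (persistent_homology (dowker_sink X \<omega>) k :: ('k, ('a list \<Rightarrow> 'k) set) pvspace)
      (dgm_sink TYPE('k) k R (\<lambda>z z'. \<omega> (\<pi> z) (\<pi> z')))"
    by (rule is_persistence_diagram_iso[OF pvspace_iso_dowker_sink_pullback[OF assms]
          is_persistence_diagram_dgm_sink[OF \<open>finite R\<close>]])
  then have "dgm_sink TYPE('k) k X \<omega> = dgm_sink TYPE('k) k R (\<lambda>z z'. \<omega> (\<pi> z) (\<pi> z'))"
    unfolding dgm_sink_def[of _ k X]
    by (rule persistence_diagram_eqI[OF pvspace_closed_persistent_homology[OF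
            filtration_on_dowker_sink[OF \<open>finite X\<close>]]])
  also have "\<dots> = sublevel_diagram TYPE('k) k (Pow R - {{}}) (dowker_value R (\<lambda>z z'. \<omega> (\<pi> z) (\<pi> z')))"
    unfolding dgm_sink_def sublevel_diagram_def dowker_sink_eq_sublevel[OF \<open>finite R\<close>] ..
  finally show ?thesis .
qed

lemma bottleneck_distance_dgm_sink_le:
  fixes X :: "'a set" and Y :: "'b set"
  assumes "finite R" and X: "fst ` R = X" and Y: "snd ` R = Y" and "0 \<le> e"
    and dis: "\<And>x y x' y'. (x, y) \<in> R \<Longrightarrow> (x', y') \<in> R \<Longrightarrow> \<bar>\<omega>X x x' - \<omega>Y y y'\<bar> \<le> e"
  shows "bottleneck_distance (dgm_sink TYPE('k::field) k X \<omega>X) (dgm_sink TYPE('k) k Y \<omega>Y) \<le> ereal e"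
proof (rule bottleneck_distance_le_near[OF _ \<open>0 \<le> e\<close>])
  have S: "complex_on R (Pow R - {{}})" unfolding complex_on_def using \<open>finite R\<close> by auto
  let ?f = "dowker_value R (\<lambda>z z'. \<omega>X (fst z) (fst z'))"
    and ?g = "dowker_value R (\<lambda>z z'. \<omega>Y (snd z) (snd z'))"
  have dis': "\<bar>\<omega>X (fst z) (fst z') - \<omega>Y (snd z) (snd z')\<bar> \<le> e" if "z \<in> R" "z' \<in> R" for z z'
    using dis[of "fst z" "snd z" "fst z'" "snd z'"] that by simp
  have "\<bar>?f \<sigma> - ?g \<sigma>\<bar> \<le> e" if "\<sigma> \<in> Pow R - {{}}" for \<sigma>
  proof -
    have \<sigma>: "\<sigma> \<subseteq> R" "\<sigma> \<noteq> {}" using that by auto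
    have "?f \<sigma> \<le> ?g \<sigma> + e"
      by (rule dowker_value_le_plus[OF \<open>finite R\<close> \<sigma>]) (use dis' in force)
    moreover have "?g \<sigma> \<le> ?f \<sigma> + e"
      by (rule dowker_value_le_plus[OF \<open>finite R\<close> \<sigma>]) (use dis' in force)
    ultimately show ?thesis by simp
  qed
  then show "near e (dgm_sink TYPE('k) k X \<omega>X) (dgm_sink TYPE('k) k Y \<omega>Y)"
    unfolding dgm_sink_pullback[OF \<open>finite R\<close> X] dgm_sink_pullback[OF \<open>finite R\<close> Y]
    by (intro sublevel_diagram_stability[OF S] face_monotone_dowker_value \<open>finite R\<close> \<open>0 \<le> e\<close>)
next
  have fin: "finite X" "finite Y" using assms(1) X Y by auto
  show "fst p \<noteq> snd p" if "p \<in># dgm_sink TYPE('k) k X \<omega>X" for p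
    using is_persistence_diagram_dgm_sink[OF fin(1), where 'k = 'k] that
    unfolding is_persistence_diagram_def by fastforce
  show "fst p \<noteq> snd p" if "p \<in># dgm_sink TYPE('k) k Y \<omega>Y" for p
    using is_persistence_diagram_dgm_sink[OF fin(2), where 'k = 'k] that
    unfolding is_persistence_diagram_def by fastforce
qed

lemma dgm_source_eq_dgm_sink: "dgm_source TYPE('k::field) k X \<omega> = dgm_sink TYPE('k) k X (\<lambda>x y. \<omega> y x)"
proof -
  have "dowker_source X \<omega> = dowker_sink X (\<lambda>x y. \<omega> y x)"
    by (rule ext) (simp add: dowker_source_def dowker_sink_def)
  then show ?thesis unfolding dgm_source_def dgm_sink_def by simp
qed

lemma obtain_optimal_correspondence:
  assumes "network X \<omega>X" "network Y \<omega>Y"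
  obtains R where "R \<in> correspondences X Y" "finite R"
    "\<And>x y x' y'. (x, y) \<in> R \<Longrightarrow> (x', y') \<in> R \<Longrightarrow>
      \<bar>\<omega>X x x' - \<omega>Y y y'\<bar> \<le> 2 * network_distance X \<omega>X Y \<omega>Y"
proof -
  have fin: "finite X" "finite Y" and "X \<noteq> {}" "Y \<noteq> {}" using assms unfolding network_def by auto
  have "finite (correspondences X Y)"
    by (rule finite_subset[of _ "Pow (X \<times> Y)"]) (use fin in \<open>auto simp: correspondences_def\<close>)
  moreover have "X \<times> Y \<in> correspondences X Y"
    unfolding correspondences_def using \<open>X \<noteq> {}\<close> \<open>Y \<noteq> {}\<close> by auto
  ultimately have "Min (distortion \<omega>X \<omega>Y ` correspondences X Y) \<in> distortion \<omega>X \<omega>Y ` correspondences X Y"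
    by (intro Min_in) auto
  then obtain R where R: "R \<in> correspondences X Y"
    and dis: "distortion \<omega>X \<omega>Y R = 2 * network_distance X \<omega>X Y \<omega>Y"
    unfolding network_distance_def by auto
  have "finite R"
    by (rule finite_subset[of _ "X \<times> Y"]) (use R fin in \<open>auto simp: correspondences_def\<close>)
  let ?D = "{\<bar>\<omega>X x x' - \<omega>Y y y'\<bar> | x y x' y'. (x, y) \<in> R \<and> (x', y') \<in> R}"
  have "?D = (\<lambda>((x, y), (x', y')). \<bar>\<omega>X x x' - \<omega>Y y y'\<bar>) ` (R \<times> R)"
    by force
  then have "finite ?D" using \<open>finite R\<close> by simp
  then have "\<bar>\<omega>X x x' - \<omega>Y y y'\<bar> \<le> 2 * network_distance X \<omega>X Y \<omega>Y"
    if "(x, y) \<in> R" "(x', y') \<in> R" for x y x' y'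
    unfolding dis[symmetric] distortion_def by (rule Max_ge) (use that in blast)
  then show ?thesis using that[OF R \<open>finite R\<close>] by blast
qed

theorem proposition15:
  fixes X :: "'a set" and \<omega>X :: "'a \<Rightarrow> 'a \<Rightarrow> real"
    and Y :: "'b set" and \<omega>Y :: "'b \<Rightarrow> 'b \<Rightarrow> real"
    and k :: nat
  assumes "network X \<omega>X" and "network Y \<omega>Y"
  shows "bottleneck_distance (dgm_sink TYPE('k::field) k X \<omega>X) (dgm_sink TYPE('k) k Y \<omega>Y)
           \<le> ereal (2 * network_distance X \<omega>X Y \<omega>Y) \<and>
         bottleneck_distance (dgm_source TYPE('k) k X \<omega>X) (dgm_source TYPE('k) k Y \<omega>Y)
           \<le> ereal (2 * network_distance X \<omega>X Y \<omega>Y)"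
proof -
  obtain R where R: "R \<in> correspondences X Y" "finite R"
    and dis: "\<And>x y x' y'. (x, y) \<in> R \<Longrightarrow> (x', y') \<in> R \<Longrightarrow>
      \<bar>\<omega>X x x' - \<omega>Y y y'\<bar> \<le> 2 * network_distance X \<omega>X Y \<omega>Y"
    using obtain_optimal_correspondence[OF assms] by blast
  have XY: "fst ` R = X" "snd ` R = Y" using R(1) unfolding correspondences_def by auto
  have "R \<noteq> {}" using XY assms unfolding network_def by auto
  then obtain x y where xy: "(x, y) \<in> R" by auto
  have nonneg: "0 \<le> 2 * network_distance X \<omega>X Y \<omega>Y"
    by (rule order_trans[OF abs_ge_zero dis[OF xy xy]])
  show ?thesis
    unfolding dgm_source_eq_dgm_sink
    by (intro conjI bottleneck_distance_dgm_sink_le[OF R(2) XY nonneg] dis)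
qed

end
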